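(* Let $\mathcal M=(\mathbf M^{(\lambda)})_{\lambda>0}$ be a weight matrix on $\mathbb N_0^d$. (Roumieu case) Assume $\mathcal M$ satisfies: - (R1) for every $\lambda>0$ there exist $\kappa\ge\lambda$ and $B,C,H>0$ such that $\alpha^{\alpha/2}M^{(\lambda)}_\beta\le B\,C^{|\alpha|}H^{|\alpha+\beta|}M^{(\kappa)}_{\alpha+\beta}$ for all $\alpha,\beta\in\mathbb N_0^d$; - (R2) for every $\lambda>0$ there exist $\kappa\ge\lambda$ and $A\ge1$ such that $M^{(\lambda)}_{\alpha+e_j}\le A^{|\alpha|+1}M^{(\kappa)}_\alpha$ for all $\alpha\in\mathbb N_0^d$ and $1\le j\le d$. Then the Hermite functions $(H_\gamma)_{\gamma\in\mathbb N_0^d}$ form an absolute Schauder basis of $\mathcal S_{\{\mathcal M\}}$. Moreover, the map $$T:\mathcal S_{\{\mathcal M\}}\to\Lambda_{\{\mathcal M\}},\qquad f\mapsto(\xi_\gamma(f))_{\gamma\in\mathbb N_0^d},\qquad \xi_\gamma(f):=\int_{\mathbb R^d}f(x)H_\gamma(x)\,dx,$$ is a (topological) isomorphism. (Beurling case) Assume $\mathcal M$ satisfies: - (B1) for every $\lambda>0$ there exist $0<\kappa\le\lambda$ and $H>0$ such that for every $C>0$ there is $B>0$ with $\alpha^{\alpha/2}M^{(\kappa)}_\beta\le B\,C^{|\alpha|}H^{|\alpha+\beta|}M^{(\lambda)}_{\alpha+\beta}$ for all $\alpha,\beta\in\mathbb N_0^d$; - (B2) for every $\lambda>0$ there exist $0<\kappa\le\lambda$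 and $A\ge1$ such that $M^{(\kappa)}_{\alpha+e_j}\le A^{|\alpha|+1}M^{(\lambda)}_\alpha$ for all $\alpha\in\mathbb N_0^d$ and $1\le j\le d$. Then the Hermite functions form an absolute Schauder basis of $\mathcal S_{(\mathcal M)}$, and the same map $T:\mathcal S_{(\mathcal M)}\to\Lambda_{(\mathcal M)}$ is a (topological) isomorphism.
   Context: A weight matrix is a family $\mathcal M=(\mathbf M^{(\lambda)})_{\lambda>0}$ with $\mathbf M^{(\lambda)}=(M^{(\lambda)}_\alpha)_{\alpha\in\mathbb N_0^d}$ sequences of positive reals, $M^{(\lambda)}_0=1$, and $M^{(\lambda)}_\alpha\le M^{(\kappa)}_\alpha$ for all $\alpha$ whenever $0<\lambda\le\kappa$. Notation: $|\alpha|=\alpha_1+\dots+\alpha_d$; $e_j$ is the $j$-th unit vector; $\alpha^{\alpha/2}:=\prod_{j}\alpha_j^{\alpha_j/2}$ with $0^0:=1$; $\alpha^{1/2}:=(\alpha_1^{1/2},\dots,\alpha_d^{1/2})$. For a sequence $\mathbf M=(M_\alpha)$ and $h>0$, $\|f\|_{\infty,\mathbf M,h}:=\sup_{\alpha,\beta\in\mathbb N_0^d}\frac{\|x^\alpha\partial^\beta f\|_\infty}{h^{|\alpha+\beta|}M_{\alpha+\beta}}$. $\mathcal S_{\{\mathcal M\}}$ is the set of $f\in C^\infty(\mathbb R^d)$ with $\|f\|_{\infty,\mathbf M^{(\lambda)},h}<\infty$ for some $\lambda,h>0$, with the inductive limit topology; $\mathcal S_{(\mathcal M)}$ is the set of $f\in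 C^\infty(\mathbb R^d)$ with $\|f\|_{\infty,\mathbf M^{(\lambda)},h}<\infty$ for all $\lambda,h>0$, with the projective limit topology. The associated weight function of $\mathbf M$ is $\omega_{\mathbf M}(t)=\sup_{\alpha\in\mathbb N^d_{0,t}}\log\frac{|t^\alpha|}{M_\alpha}$ for $t\in\mathbb R^d$, where $\mathbb N^d_{0,t}=\{\alpha:\alpha_j=0\text{ whenever }t_j=0\}$ and $0^0=1$. For $h>0$ put $\|\mathbf c\|_{\mathbf M,h}:=\sup_{\alpha}|c_\alpha|e^{\omega_{\mathbf M}(\alpha^{1/2}/h)}$. $\Lambda_{\{\mathcal M\}}$ is the space of $\mathbf c\in\mathbb C^{\mathbb N_0^d}$ with $\|\mathbf c\|_{\mathbf M^{(\lambda)},h}<\infty$ for some $\lambda,h>0$ (inductive limit topology over $j\in\mathbb N$ of the norms $\|\cdot\|_{\mathbf M^{(j)},j}$); $\Lambda_{(\mathcal M)}$ is the space of $\mathbf c$ with $\|\mathbf c\|_{\mathbf M^{(\lambda)},h}<\infty$ for all $\lambda,h>0$ (projective limit topology given by the norms $\|\cdot\|_{\mathbf M^{(1/j)},1/j}$, $j\in\mathbb N$). Hermite functions: $H_\gamma(x)=(2^{|\gamma|}\gamma!\pi^{d/2})^{-1/2}h_\gamma(x)e^{-|x|^2/2}$, with $h_\gamma(x)=(-1)^{|\gamma|}e^{|x|^2}\partial^\gamma e^{-|x|^2}$. *)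

theory Defs
  imports "HOL-Analysis.Analysis" "HOL-Library.Function_Algebras"
begin

text \<open>Dimension d = CARD('n); points of R^d are real^'n; multi-indices are 'n => nat.\<close>

definition msize :: "('n::finite \<Rightarrow> nat) \<Rightarrow> nat" where
  "msize \<alpha> = (\<Sum>j\<in>UNIV. \<alpha> j)"

definition unit_mi :: "'n \<Rightarrow> ('n \<Rightarrow> nat)" where
  "unit_mi j = (\<lambda>i. if i = j then 1 else 0)"

definition mfact :: "('n::finite \<Rightarrow> nat) \<Rightarrow> real" where
  "mfact \<alpha> = (\<Prod>j\<in>UNIV. fact (\<alpha> j))"

definition xpow :: "real^'n::finite \<Rightarrow> ('n \<Rightarrow> nat) \<Rightarrow> real" where
  "xpow x \<alpha> = (\<Prod>j\<in>UNIV. (x$j) ^ (\<alpha> j))"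

text \<open>alpha^(alpha/2) = prod_j alpha_j^(alpha_j/2), with 0^0 = 1\<close>
definition mhalfpow :: "('n::finite \<Rightarrow> nat) \<Rightarrow> real" where
  "mhalfpow \<alpha> = (\<Prod>j\<in>UNIV. sqrt (real (\<alpha> j)) ^ (\<alpha> j))"

definition partials_family ::
  "(real^'n::finite \<Rightarrow> complex) \<Rightarrow> (('n \<Rightarrow> nat) \<Rightarrow> real^'n \<Rightarrow> complex) \<Rightarrow> bool" where
  "partials_family f D \<longleftrightarrow> D 0 = f \<and> (\<forall>\<beta>. continuous_on UNIV (D \<beta>)) \<and>
     (\<forall>\<beta> i x. ((\<lambda>t. D \<beta> (x + t *\<^sub>R axis i 1)) has_vector_derivative D (\<beta> + unit_mi i) x) (at 0))"

definition smooth :: "(real^'n::finite \<Rightarrow> complex) \<Rightarrow> bool" where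
  "smooth f \<longleftrightarrow> (\<exists>D. partials_family f D)"

definition pder :: "('n::finite \<Rightarrow> nat) \<Rightarrow> (real^'n \<Rightarrow> complex) \<Rightarrow> real^'n \<Rightarrow> complex" where
  "pder \<beta> f = (SOME D. partials_family f D) \<beta>"

definition hermite_poly :: "('n::finite \<Rightarrow> nat) \<Rightarrow> real^'n \<Rightarrow> complex" where
  "hermite_poly \<gamma> x = (-1) ^ msize \<gamma> * complex_of_real (exp ((norm x)\<^sup>2)) *
      pder \<gamma> (\<lambda>y. complex_of_real (exp (- (norm y)\<^sup>2))) x"

definition hermite_fun :: "('n::finite \<Rightarrow> nat) \<Rightarrow> real^'n \<Rightarrow> complex" where
  "hermite_fun \<gamma> x = complex_of_real (1 / sqrt (2 ^ msize \<gamma> * mfact \<gamma> * pi powr (real CARD('n) / 2)))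
      * hermite_poly \<gamma> x * complex_of_real (exp (- (norm x)\<^sup>2 / 2))"

definition hermite_coeff :: "('n::finite \<Rightarrow> nat) \<Rightarrow> (real^'n \<Rightarrow> complex) \<Rightarrow> complex" where
  "hermite_coeff \<gamma> f = integral\<^sup>L lborel (\<lambda>x. f x * hermite_fun \<gamma> x)"

definition weight_matrix :: "(real \<Rightarrow> ('n::finite \<Rightarrow> nat) \<Rightarrow> real) \<Rightarrow> bool" where
  "weight_matrix M \<longleftrightarrow> (\<forall>l>0. (\<forall>\<alpha>. M l \<alpha> > 0) \<and> M l 0 = 1) \<and>
     (\<forall>l k \<alpha>. 0 < l \<and> l \<le> k \<longrightarrow> M l \<alpha> \<le> M k \<alpha>)"

definition sup_norm :: "('a \<Rightarrow> complex) \<Rightarrow> ereal" where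
  "sup_norm g = (SUP x. ereal (cmod (g x)))"

definition gs_norm :: "(('n::finite \<Rightarrow> nat) \<Rightarrow> real) \<Rightarrow> real \<Rightarrow> (real^'n \<Rightarrow> complex) \<Rightarrow> ereal" where
  "gs_norm Ms h f = (SUP \<alpha>. SUP \<beta>.
      sup_norm (\<lambda>x. complex_of_real (xpow x \<alpha>) * pder \<beta> f x)
        * ereal (1 / (h ^ msize (\<alpha> + \<beta>) * Ms (\<alpha> + \<beta>))))"

definition S_Roumieu :: "(real \<Rightarrow> ('n::finite \<Rightarrow> nat) \<Rightarrow> real) \<Rightarrow> (real^'n \<Rightarrow> complex) set" where
  "S_Roumieu M = {f. smooth f \<and> (\<exists>l>0. \<exists>h>0. gs_norm (M l) h f < \<infinity>)}"

definition S_Beurling :: "(real \<Rightarrow> ('n::finite \<Rightarrow> nat) \<Rightarrow> real) \<Rightarrow> (real^'n \<Rightarrow> complex) set" where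
  "S_Beurling M = {f. smooth f \<and> (\<forall>l>0. \<forall>h>0. gs_norm (M l) h f < \<infinity>)}"

definition assoc_weight :: "(('n::finite \<Rightarrow> nat) \<Rightarrow> real) \<Rightarrow> real^'n \<Rightarrow> ereal" where
  "assoc_weight Ms t = (SUP \<alpha>\<in>{\<alpha>. \<forall>j. t$j = 0 \<longrightarrow> \<alpha> j = 0}. ereal (ln (\<bar>xpow t \<alpha>\<bar> / Ms \<alpha>)))"

definition eexp :: "ereal \<Rightarrow> ereal" where
  "eexp w = (case w of ereal r \<Rightarrow> ereal (exp r) | PInfty \<Rightarrow> \<infinity> | MInfty \<Rightarrow> 0)"

definition lam_norm :: "(('n::finite \<Rightarrow> nat) \<Rightarrow> real) \<Rightarrow> real \<Rightarrow> (('n \<Rightarrow> nat) \<Rightarrow> complex) \<Rightarrow> ereal" where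
  "lam_norm Ms h c = (SUP \<alpha>. ereal (cmod (c \<alpha>)) *
      eexp (assoc_weight Ms (\<chi> j. sqrt (real (\<alpha> j)) / h)))"

definition Lam_Roumieu :: "(real \<Rightarrow> ('n::finite \<Rightarrow> nat) \<Rightarrow> real) \<Rightarrow> (('n \<Rightarrow> nat) \<Rightarrow> complex) set" where
  "Lam_Roumieu M = {c. \<exists>l>0. \<exists>h>0. lam_norm (M l) h c < \<infinity>}"

definition Lam_Beurling :: "(real \<Rightarrow> ('n::finite \<Rightarrow> nat) \<Rightarrow> real) \<Rightarrow> (('n \<Rightarrow> nat) \<Rightarrow> complex) set" where
  "Lam_Beurling M = {c. \<forall>l>0. \<forall>h>0. lam_norm (M l) h c < \<infinity>}"

definition abs_convex :: "('a \<Rightarrow> complex) set \<Rightarrow> bool" where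
  "abs_convex V \<longleftrightarrow> (\<forall>u\<in>V. \<forall>v\<in>V. \<forall>a b::complex. cmod a + cmod b \<le> 1 \<longrightarrow>
      (\<lambda>x. a * u x + b * v x) \<in> V)"

text \<open>Locally convex inductive limit of the normed steps {g. N i g < infinity}, i in I:
  0-neighbourhoods are the absolutely convex sets meeting every step in a 0-neighbourhood.\<close>
definition ind_top :: "('a \<Rightarrow> complex) set \<Rightarrow> 'i set \<Rightarrow> ('i \<Rightarrow> ('a \<Rightarrow> complex) \<Rightarrow> ereal)
    \<Rightarrow> ('a \<Rightarrow> complex) topology" where
  "ind_top X I N = topology (\<lambda>U. U \<subseteq> X \<and> (\<forall>f\<in>U. \<exists>V. V \<subseteq> X \<and> abs_convex V \<and>
      (\<forall>i\<in>I. \<exists>\<epsilon>>0. \<forall>g\<in>X. N i g < ereal \<epsilon> \<longrightarrow> g \<in> V) \<and>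
      (\<lambda>g x. f x + g x) ` V \<subseteq> U))"

definition proj_top :: "('a \<Rightarrow> complex) set \<Rightarrow> 'i set \<Rightarrow> ('i \<Rightarrow> ('a \<Rightarrow> complex) \<Rightarrow> ereal)
    \<Rightarrow> ('a \<Rightarrow> complex) topology" where
  "proj_top X I N = topology (\<lambda>U. U \<subseteq> X \<and> (\<forall>f\<in>U. \<exists>F \<epsilon>. finite F \<and> F \<subseteq> I \<and> \<epsilon> > 0 \<and>
      {g\<in>X. \<forall>i\<in>F. N i (\<lambda>x. g x - f x) < ereal \<epsilon>} \<subseteq> U))"

definition S_Roumieu_top :: "(real \<Rightarrow> ('n::finite \<Rightarrow> nat) \<Rightarrow> real) \<Rightarrow> (real^'n \<Rightarrow> complex) topology" where
  "S_Roumieu_top M = ind_top (S_Roumieu M) {(l, h). l > 0 \<and> h > 0} (\<lambda>(l, h). gs_norm (M l) h)"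

definition S_Beurling_top :: "(real \<Rightarrow> ('n::finite \<Rightarrow> nat) \<Rightarrow> real) \<Rightarrow> (real^'n \<Rightarrow> complex) topology" where
  "S_Beurling_top M = proj_top (S_Beurling M) {(l, h). l > 0 \<and> h > 0} (\<lambda>(l, h). gs_norm (M l) h)"

definition Lam_Roumieu_top :: "(real \<Rightarrow> ('n::finite \<Rightarrow> nat) \<Rightarrow> real) \<Rightarrow> (('n \<Rightarrow> nat) \<Rightarrow> complex) topology" where
  "Lam_Roumieu_top M = ind_top (Lam_Roumieu M) {j::nat. j \<ge> 1} (\<lambda>j. lam_norm (M (real j)) (real j))"

definition Lam_Beurling_top :: "(real \<Rightarrow> ('n::finite \<Rightarrow> nat) \<Rightarrow> real) \<Rightarrow> (('n \<Rightarrow> nat) \<Rightarrow> complex) topology" where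
  "Lam_Beurling_top M = proj_top (Lam_Beurling M) {j::nat. j \<ge> 1}
     (\<lambda>j. lam_norm (M (1 / real j)) (1 / real j))"

definition cont_seminorm :: "('a \<Rightarrow> complex) topology \<Rightarrow> (('a \<Rightarrow> complex) \<Rightarrow> real) \<Rightarrow> bool" where
  "cont_seminorm X p \<longleftrightarrow>
     (\<forall>f\<in>topspace X. \<forall>g\<in>topspace X. p (\<lambda>x. f x + g x) \<le> p f + p g) \<and>
     (\<forall>f\<in>topspace X. \<forall>a. p (\<lambda>x. a * f x) = cmod a * p f) \<and>
     continuous_map X euclideanreal p"

definition expands :: "('a \<Rightarrow> complex) topology \<Rightarrow> ('i \<Rightarrow> 'a \<Rightarrow> complex) \<Rightarrow> ('i \<Rightarrow> complex)
    \<Rightarrow> ('a \<Rightarrow> complex) \<Rightarrow> bool" where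
  "expands X e c f \<longleftrightarrow>
     limitin X (\<lambda>F. (\<lambda>x. \<Sum>i\<in>F. c i * e i x)) f (finite_subsets_at_top UNIV)"

definition basis_coeff :: "('a \<Rightarrow> complex) topology \<Rightarrow> ('i \<Rightarrow> 'a \<Rightarrow> complex)
    \<Rightarrow> ('a \<Rightarrow> complex) \<Rightarrow> 'i \<Rightarrow> complex" where
  "basis_coeff X e f = (THE c. expands X e c f)"

definition abs_schauder_basis :: "('a \<Rightarrow> complex) topology \<Rightarrow> ('i \<Rightarrow> 'a \<Rightarrow> complex) \<Rightarrow> bool" where
  "abs_schauder_basis X e \<longleftrightarrow>
     (\<forall>i. e i \<in> topspace X) \<and>
     (\<forall>f\<in>topspace X. \<exists>!c. expands X e c f) \<and>
     (\<forall>i. continuous_map X euclidean (\<lambda>f. basis_coeff X e f i)) \<and>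
     (\<forall>p. cont_seminorm X p \<longrightarrow>
        (\<forall>f\<in>topspace X. (\<lambda>i. cmod (basis_coeff X e f i) * p (e i)) summable_on UNIV))"

definition top_lin_iso :: "('a \<Rightarrow> complex) topology \<Rightarrow> ('b \<Rightarrow> complex) topology
    \<Rightarrow> (('a \<Rightarrow> complex) \<Rightarrow> ('b \<Rightarrow> complex)) \<Rightarrow> bool" where
  "top_lin_iso X Y T \<longleftrightarrow> homeomorphic_map X Y T \<and>
     (\<forall>f\<in>topspace X. \<forall>g\<in>topspace X. \<forall>a b.
        T (\<lambda>x. a * f x + b * g x) = (\<lambda>y. a * T f y + b * T g y))"

definition condR1 :: "(real \<Rightarrow> ('n::finite \<Rightarrow> nat) \<Rightarrow> real) \<Rightarrow> bool" where
  "condR1 M \<longleftrightarrow> (\<forall>l>0. \<exists>k\<ge>l. \<exists>B>0. \<exists>C>0. \<exists>H>0. \<forall>\<alpha> \<beta>.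
     mhalfpow \<alpha> * M l \<beta> \<le> B * C ^ msize \<alpha> * H ^ msize (\<alpha> + \<beta>) * M k (\<alpha> + \<beta>))"

definition condR2 :: "(real \<Rightarrow> ('n::finite \<Rightarrow> nat) \<Rightarrow> real) \<Rightarrow> bool" where
  "condR2 M \<longleftrightarrow> (\<forall>l>0. \<exists>k\<ge>l. \<exists>A\<ge>1. \<forall>\<alpha> j.
     M l (\<alpha> + unit_mi j) \<le> A ^ (msize \<alpha> + 1) * M k \<alpha>)"

definition condB1 :: "(real \<Rightarrow> ('n::finite \<Rightarrow> nat) \<Rightarrow> real) \<Rightarrow> bool" where
  "condB1 M \<longleftrightarrow> (\<forall>l>0. \<exists>k. 0 < k \<and> k \<le> l \<and> (\<exists>H>0. \<forall>C>0. \<exists>B>0. \<forall>\<alpha> \<beta>.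
     mhalfpow \<alpha> * M k \<beta> \<le> B * C ^ msize \<alpha> * H ^ msize (\<alpha> + \<beta>) * M l (\<alpha> + \<beta>)))"

definition condB2 :: "(real \<Rightarrow> ('n::finite \<Rightarrow> nat) \<Rightarrow> real) \<Rightarrow> bool" where
  "condB2 M \<longleftrightarrow> (\<forall>l>0. \<exists>k. 0 < k \<and> k \<le> l \<and> (\<exists>A\<ge>1. \<forall>\<alpha> j.
     M k (\<alpha> + unit_mi j) \<le> A ^ (msize \<alpha> + 1) * M l \<alpha>))"

end

theory Submission
  imports Defs "HOL-Probability.Probability"
begin

text \<open>
  Passing to another index by (R1) or (B1), every weight \<open>h^|\<sigma>| M_\<sigma>\<close> can be replaced by an admissible
  one, that is a weight \<open>G\<close> with \<open>sqrt (\<sigma>_j + 1) G_\<sigma> \<le> G_(\<sigma> + e_j)\<close>; conditions (R2) and (B2) absorb finite shifts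
  of the index. For an admissible \<open>G\<close> the operators \<open>x_j \<plusminus> \<partial>_j\<close> map functions bounded by \<open>G\<close> to functions bounded
  by \<open>3 G_(\<cdot> + e_j)\<close>. Since \<open>(x_j - \<partial>_j)(x_j + \<partial>_j)\<close> multiplies the Hermite coefficient with index \<open>\<gamma>\<close> by
  \<open>2 \<gamma>_j\<close>, iterating it bounds \<open>\<gamma>^(\<beta>/2) |\<xi>_\<gamma>(f)|\<close> by \<open>G_(\<beta> + 3)\<close> up to a geometric factor.
  Conversely the ladder relations and \<open>\<parallel>H_n\<parallel>_\<infinity>\<^sup>2 \<le> 2n + 2\<close> in one variable give
  \<open>|x^\<alpha> \<partial>^\<beta> H_\<gamma>(x)| \<le> C^|\<sigma>| sqrt ((\<gamma> + \<sigma> + 1)! / \<gamma>!)\<close> with \<open>\<sigma> = \<alpha> + \<beta>\<close>, and admissibility turns a bound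
  \<open>|c_\<gamma>| \<gamma>^(\<beta>/2) \<le> K G_\<beta>\<close> into \<open>|c_\<gamma>| sqrt ((\<gamma> + \<sigma>)! / \<gamma>!) \<le> K 2^|\<sigma>| G_\<sigma>\<close>; so the Hermite series of \<open>c\<close>
  converges absolutely in the function space.

  Injectivity is the completeness of the Hermite functions: if all coefficients of \<open>f\<close> vanish, then \<open>f\<close> is orthogonal
  to all polynomials times \<open>exp (-|x|\<^sup>2/2)\<close>, hence, expanding exponential series, to \<open>exp (-a|x - y|\<^sup>2)\<close> for
  arbitrarily large \<open>a\<close>, and these Gaussians concentrate at \<open>y\<close>.
\<close>

section \<open>Hermite functions of one variable\<close>

text \<open>No logarithmic convexity is assumed, so nothing gives \<open>M\<close> the growth by
  sqrt(\<sigma>_j + 1) in one unit step that the commutators of x_j and \<partial>_j demand;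
  \<open>adm_hull\<close> installs it by summing over all splittings of an index, and (R1) or (B1)
  controls that sum through the binomial theorem. Both cases reach the analysis only through
  \<open>dominated\<close>: bounds by w are carried to bounds by w', in either direction of the
  isomorphism. In the Roumieu case w is given and w' is sought; in the Beurling case w' is
  prescribed, radius included, and the freedom of C in (B1) makes the radius fit.

  The index shifts have separate origins. For coefficients, rounding \<beta>/2 up to a whole power
  costs 1, and passing from sup norms to integrals by the weight \<open>decay\<close> costs 2. For
  series, the sup bound of the Hermite functions costs 1 and the summable factor \<open>rho\<close>
  costs 4. The norm of the sequence space, an exponential of a supremum of logarithms, is unfolded
  into the bounds on |c_\<gamma>| \<gamma>^(\<beta>/2) for all \<beta>, so both spaces are described
  by the same kind of inequality.\<close>

fun hpoly :: "nat \<Rightarrow> real \<Rightarrow> real" where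
  "hpoly 0 x = 1"
| "hpoly (Suc 0) x = 2 * x"
| "hpoly (Suc (Suc n)) x = 2 * x * hpoly (Suc n) x - 2 * real (Suc n) * hpoly n x"

text \<open>At n = 0 truncated subtraction gives the meaningless index 0 - 1 = 0, but its
  coefficient vanishes. The same convention is relied on wherever \<open>n - 1\<close> or
  \<open>\<gamma> - unit_mi i\<close> occurs below.\<close>

lemma hpoly_Suc: "hpoly (Suc n) x = 2 * x * hpoly n x - 2 * real n * hpoly (n - 1) x"
  by (cases n) auto

lemma hpoly_has_derivative:
  "(hpoly n has_real_derivative 2 * real n * hpoly (n - 1) x) (at x)"
proof (induction n rule: induct_nat_012)
  case 0
  have "hpoly 0 = (\<lambda>x. 1)" by auto
  then show ?case by simp
next
  case 1
  have "hpoly (Suc 0) = (\<lambda>x. 2 * x)" by auto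
  then show ?case by (auto intro!: derivative_eq_intros)
next
  case (ge2 n)
  have eq: "hpoly (Suc (Suc n)) = (\<lambda>x. 2 * x * hpoly (Suc n) x - 2 * real (Suc n) * hpoly n x)"
    by auto
  have "(hpoly (Suc (Suc n)) has_real_derivative
      (2 * hpoly (Suc n) x + 2 * x * (2 * real (Suc n) * hpoly n x) - 2 * real (Suc n) * (2 * real n * hpoly (n - 1) x))) (at x)"
    unfolding eq using ge2 by (auto intro!: derivative_eq_intros)
  moreover have "2 * hpoly (Suc n) x + 2 * x * (2 * real (Suc n) * hpoly n x) - 2 * real (Suc n) * (2 * real n * hpoly (n - 1) x)
     = 2 * real (Suc (Suc n)) * hpoly (Suc n) x"
    by (simp only: hpoly_Suc) (simp add: algebra_simps)
  ultimately show ?case by (simp del: hpoly.simps)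
qed

text \<open>The L2 norm of \<open>hpoly n\<close> times exp(-x^2/2). The constant of
  \<open>hermite_fun\<close> in several variables is the product of these numbers, which distributes
  pi^(d/2) over the coordinates.\<close>

definition herm_norm :: "nat \<Rightarrow> real" where
  "herm_norm n = sqrt (2 ^ n * fact n * sqrt pi)"

lemma herm_norm_pos: "herm_norm n > 0"
  by (simp add: herm_norm_def)

lemma herm_norm_Suc: "herm_norm (Suc n) = sqrt 2 * sqrt (real (Suc n)) * herm_norm n"
proof -
  have "(2 ^ Suc n * fact (Suc n) * sqrt pi :: real) = 2 * real (Suc n) * (2 ^ n * fact n * sqrt pi)"
    by (simp add: algebra_simps)
  then show ?thesis unfolding herm_norm_def by (simp only: real_sqrt_mult)
qed

definition herm :: "nat \<Rightarrow> real \<Rightarrow> real" where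
  "herm n x = hpoly n x * exp (- x\<^sup>2 / 2) / herm_norm n"

text \<open>With this factor the square roots of \<open>herm_norm (Suc n)\<close> cancel against
  each other. Together with the downward version that follows, it reduces identities between
  normalised functions to identities between polynomials.\<close>

lemma herm_Suc_scaled:
  "sqrt (real (Suc n) / 2) * herm (Suc n) x = hpoly (Suc n) x * exp (- x\<^sup>2 / 2) / (2 * herm_norm n)"
proof -
  define r where "r = sqrt (real (Suc n))"
  have r: "r > 0" unfolding r_def by simp
  have s: "sqrt 2 * sqrt 2 = (2::real)" by simp
  show ?thesis
    unfolding herm_def herm_norm_Suc real_sqrt_divide r_def[symmetric]
    using r herm_norm_pos[of n] s by (simp add: field_simps del: hpoly.simps real_sqrt_mult_self)
qed

lemma herm_pred_scaled:
  "sqrt (real n / 2) * herm (n - 1) x = real n * hpoly (n - 1) x * exp (- x\<^sup>2 / 2) / herm_norm n"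
proof (cases n)
  case (Suc m)
  define r where "r = sqrt (real (Suc m))"
  have r: "r > 0" unfolding r_def by simp
  have rr: "real (Suc m) = r * r" unfolding r_def by simp
  show ?thesis
    unfolding herm_def Suc herm_norm_Suc real_sqrt_divide r_def[symmetric] rr
    using r herm_norm_pos[of m] by (simp add: field_simps)
qed simp

lemma herm_times:
  "x * herm n x = sqrt (real (Suc n) / 2) * herm (Suc n) x + sqrt (real n / 2) * herm (n - 1) x"
  unfolding herm_Suc_scaled herm_pred_scaled
  using herm_norm_pos[of n] by (simp add: herm_def hpoly_Suc field_simps)

lemma herm_has_derivative:
  "(herm n has_real_derivative sqrt (real n / 2) * herm (n - 1) x - sqrt (real (Suc n) / 2) * herm (Suc n) x) (at x)"
proof -
  have D: "(herm n has_real_derivative (2 * real n * hpoly (n - 1) x * exp (- x\<^sup>2 / 2)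
      + hpoly n x * (exp (- x\<^sup>2 / 2) * (- x))) / herm_norm n) (at x)"
    unfolding herm_def[abs_def]
    using herm_norm_pos[of n] by (auto intro!: derivative_eq_intros hpoly_has_derivative simp: field_simps)
  have "sqrt (real n / 2) * herm (n - 1) x - sqrt (real (Suc n) / 2) * herm (Suc n) x
     = 2 * (sqrt (real n / 2) * herm (n - 1) x) - x * herm n x"
    using herm_times[of x n] by simp
  also have "\<dots> = (2 * real n * hpoly (n - 1) x * exp (- x\<^sup>2 / 2)
      + hpoly n x * (exp (- x\<^sup>2 / 2) * (- x))) / herm_norm n"
    unfolding herm_pred_scaled using herm_norm_pos[of n] by (simp add: herm_def field_simps)
  finally show ?thesis using D by simp
qed

text \<open>The annihilation and creation operators in one variable. The derivative is a variable
  \<open>d\<close>, so that the relations apply to a derivative obtained from an existence statement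
  as well as to \<open>dherm 1\<close>.\<close>

lemma herm_lowering:
  assumes "(herm n has_real_derivative d) (at x)"
  shows "x * herm n x + d = sqrt (2 * real n) * herm (n - 1) x"
    and "x * herm n x - d = sqrt (2 * real (Suc n)) * herm (Suc n) x"
proof -
  have d: "d = sqrt (real n / 2) * herm (n - 1) x - sqrt (real (Suc n) / 2) * herm (Suc n) x"
    using DERIV_unique[OF assms herm_has_derivative] .
  have s: "2 * sqrt (a / 2) = sqrt (2 * a)" if "a \<ge> 0" for a :: real
    using that by (simp add: real_sqrt_divide real_sqrt_mult field_simps)
  show "x * herm n x + d = sqrt (2 * real n) * herm (n - 1) x"
    unfolding d herm_times using s[of "real n"] by (simp add: algebra_simps)
  show "x * herm n x - d = sqrt (2 * real (Suc n)) * herm (Suc n) x"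
    unfolding d herm_times using s[of "real (Suc n)"] by (simp add: algebra_simps)
qed

text \<open>The k-th derivative of \<open>herm n\<close>, given by a recursion to the neighbouring
  indices instead of an iterated limit. In this form a bound valid for all n passes from k to
  \<open>Suc k\<close>.\<close>

primrec dherm :: "nat \<Rightarrow> nat \<Rightarrow> real \<Rightarrow> real" where
  "dherm 0 n x = herm n x"
| "dherm (Suc k) n x = sqrt (real n / 2) * dherm k (n - 1) x - sqrt (real (Suc n) / 2) * dherm k (Suc n) x"

lemma dherm_has_derivative: "(dherm k n has_real_derivative dherm (Suc k) n x) (at x)"
proof (induction k arbitrary: n)
  case 0
  then show ?case using herm_has_derivative[of n x] by (simp add: fun_eq_iff[symmetric])
next
  case (Suc k)
  have "((\<lambda>x. sqrt (real n / 2) * dherm k (n - 1) x - sqrt (real (Suc n) / 2) * dherm k (Suc n) x)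
     has_real_derivative (sqrt (real n / 2) * dherm (Suc k) (n - 1) x - sqrt (real (Suc n) / 2) * dherm (Suc k) (Suc n) x)) (at x)"
    by (intro DERIV_diff DERIV_cmult Suc)
  then show ?case
    by (simp add: fun_eq_iff[symmetric])
qed

lemma continuous_on_dherm: "continuous_on UNIV (dherm k n)"
  by (intro continuous_at_imp_continuous_on ballI DERIV_isCont[OF dherm_has_derivative])

lemma continuous_on_herm: "continuous_on UNIV (herm n)"
  using continuous_on_dherm[of 0 n] by (simp add: fun_eq_iff[symmetric])

lemma power_div_fact_le_exp:
  fixes y :: real
  assumes "y \<ge> 0"
  shows "y ^ k / fact k \<le> exp y"
proof -
  have "sum (\<lambda>n. y ^ n /\<^sub>R fact n) {k} \<le> (\<Sum>n. y ^ n /\<^sub>R fact n)"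
    using assms summable_exp_generic[of y] by (intro sum_le_suminf) auto
  then show ?thesis by (simp add: exp_def divide_inverse mult.commute)
qed

lemma power_mult_gauss_bounded: "\<exists>C. \<forall>x::real. \<bar>x ^ k * exp (- x\<^sup>2 / 2)\<bar> \<le> C"
proof (intro exI allI)
  fix x :: real
  have 1: "(x\<^sup>2 / 2) ^ k / fact k \<le> exp (x\<^sup>2 / 2)"
    by (rule power_div_fact_le_exp) auto
  \<comment> \<open>The exponential series in x^2/2 controls only even powers; this inequality
    reduces a power of arbitrary parity to an even one.\<close>
  have "\<bar>x ^ k\<bar> \<le> 1 + (\<bar>x ^ k\<bar>)\<^sup>2"
    using sum_power2_ge_zero[of "\<bar>x ^ k\<bar> - 1" 0] by (simp add: power2_eq_square algebra_simps)
  also have "(\<bar>x ^ k\<bar>)\<^sup>2 = (x\<^sup>2) ^ k"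
    by (simp add: power_mult[symmetric] mult.commute)
  also have "\<dots> \<le> 2 ^ k * fact k * exp (x\<^sup>2 / 2)"
    using 1 by (simp add: field_simps)
  also have "1 + \<dots> \<le> (1 + 2 ^ k * fact k) * exp (x\<^sup>2 / 2)"
    by (simp add: algebra_simps)
  finally show "\<bar>x ^ k * exp (- x\<^sup>2 / 2)\<bar> \<le> 1 + 2 ^ k * fact k"
    by (simp add: abs_mult exp_minus field_simps)
qed

text \<open>Solving \<open>herm_times\<close> for the highest index trades it for lower indices and
  one more factor x, so the induction on n has to keep the exponent \<open>k\<close>
  arbitrary.\<close>

lemma herm_decay: "\<exists>C. \<forall>x. \<bar>x ^ k * herm n x\<bar> \<le> C"
proof (induction n arbitrary: k rule: induct_nat_012)
  case 0
  obtain C where C: "\<bar>x ^ k * exp (- x\<^sup>2 / 2)\<bar> \<le> C" for x :: real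
    using power_mult_gauss_bounded by blast
  have "\<bar>x ^ k * herm 0 x\<bar> \<le> C / sqrt (sqrt pi)" for x
    using C[of x] by (simp add: herm_def herm_norm_def abs_mult divide_right_mono)
  then show ?case by blast
next
  case 1
  obtain C where C: "\<bar>x ^ Suc k * exp (- x\<^sup>2 / 2)\<bar> \<le> C" for x :: real
    using power_mult_gauss_bounded by blast
  have "\<bar>x ^ k * herm (Suc 0) x\<bar> \<le> 2 * C / sqrt (2 * sqrt pi)" for x
  proof -
    have "x ^ k * herm (Suc 0) x = 2 * (x ^ Suc k * exp (- x\<^sup>2 / 2)) / sqrt (2 * sqrt pi)"
      by (simp add: herm_def herm_norm_def)
    then show ?thesis using C[of x] by (simp add: abs_mult divide_right_mono)
  qed
  then show ?case by blast
next
  case (ge2 n)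
  obtain C1 where C1: "\<bar>x ^ k * herm n x\<bar> \<le> C1" for x using ge2(1) by blast
  obtain C2 where C2: "\<bar>x ^ Suc k * herm (Suc n) x\<bar> \<le> C2" for x using ge2(2) by blast
  define s where "s = sqrt (real (Suc (Suc n)) / 2)"
  have s: "s > 0" unfolding s_def by simp
  have "\<bar>x ^ k * herm (Suc (Suc n)) x\<bar> \<le> (C2 + sqrt (real (Suc n) / 2) * C1) / s" for x
  proof -
    have "s * (x ^ k * herm (Suc (Suc n)) x) = x ^ Suc k * herm (Suc n) x - sqrt (real (Suc n) / 2) * (x ^ k * herm n x)"
    proof -
      have "s * (x ^ k * herm (Suc (Suc n)) x) = x ^ k * (s * herm (Suc (Suc n)) x)" by simp
      also have "s * herm (Suc (Suc n)) x = x * herm (Suc n) x - sqrt (real (Suc n) / 2) * herm n x"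
        unfolding s_def herm_times[of x "Suc n"] by simp
      finally show ?thesis by (simp add: algebra_simps)
    qed
    also have "\<bar>\<dots>\<bar> \<le> C2 + sqrt (real (Suc n) / 2) * C1"
      using C1[of x] C2[of x] by (intro order.trans[OF abs_triangle_ineq4] add_mono) (auto simp: abs_mult intro!: mult_left_mono simp del: power_Suc)
    finally have "s * \<bar>x ^ k * herm (Suc (Suc n)) x\<bar> \<le> C2 + sqrt (real (Suc n) / 2) * C1"
      using s by (simp add: abs_mult)
    then show ?thesis using s by (simp add: field_simps)
  qed
  then show ?case by blast
qed

section \<open>Integrals of derivatives, orthonormality and the sup bound in one variable\<close>

lemma integral_translation:
  fixes g :: "'a::euclidean_space \<Rightarrow> 'b::{banach, second_countable_topology}"
  assumes "integrable lborel g"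
  shows "integrable lborel (\<lambda>x. g (x + a))" and "integral\<^sup>L lborel (\<lambda>x. g (x + a)) = integral\<^sup>L lborel g"
proof -
  have eq: "distr lborel borel ((+) a) = (lborel :: 'a measure)" by (rule lborel_distr_plus)
  have m: "(+) a \<in> measurable lborel (borel :: 'a measure)" by simp
  have g: "g \<in> borel_measurable borel" using assms by (simp add: borel_measurable_integrable)
  show "integrable lborel (\<lambda>x. g (x + a))"
    using assms integrable_distr_eq[OF m g] by (simp add: eq add.commute)
  show "integral\<^sup>L lborel (\<lambda>x. g (x + a)) = integral\<^sup>L lborel g"
    using integral_distr[OF m g] by (simp add: eq add.commute)
qed

lemma directional_derivative_at:
  fixes g :: "'a::real_normed_vector \<Rightarrow> 'b::real_normed_vector"
  assumes "\<And>x. ((\<lambda>t. g (x + t *\<^sub>R b)) has_vector_derivative g' x) (at 0)"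
  shows "((\<lambda>t. g (x + t *\<^sub>R b)) has_vector_derivative g' (x + t *\<^sub>R b)) (at t)"
proof -
  have "((\<lambda>s. g ((x + t *\<^sub>R b) + s *\<^sub>R b)) has_vector_derivative g' (x + t *\<^sub>R b)) (at (t - t))"
    using assms[of "x + t *\<^sub>R b"] by simp
  then have "((\<lambda>s. g ((x + t *\<^sub>R b) + s *\<^sub>R b)) \<circ> (\<lambda>s. s - t) has_vector_derivative 1 *\<^sub>R g' (x + t *\<^sub>R b)) (at t)"
    by (intro vector_diff_chain_at) (auto intro!: derivative_eq_intros)
  then show ?thesis by (simp add: o_def algebra_simps)
qed

text \<open>Translation invariance makes the integral of every difference quotient vanish; the weight
  \<open>W\<close> dominates the quotients.\<close>
lemma integral_directional_derivative_eq_0: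
  fixes g g' :: "'a::euclidean_space \<Rightarrow> 'b::{banach, second_countable_topology}" and W :: "'a \<Rightarrow> real"
  assumes der: "\<And>x. ((\<lambda>t. g (x + t *\<^sub>R b)) has_vector_derivative g' x) (at 0)"
    and W: "integrable lborel W"
    and shift: "\<And>x s. 0 \<le> s \<Longrightarrow> s \<le> 1 \<Longrightarrow> W (x + s *\<^sub>R b) \<le> C * W x"
    and g: "g \<in> borel_measurable borel" "\<And>x. norm (g x) \<le> K * W x"
    and g': "g' \<in> borel_measurable borel" "\<And>x. norm (g' x) \<le> K * W x" and K: "K \<ge> 0"
  shows "integral\<^sup>L lborel g' = 0"
proof -
  define q where "q n x = real (Suc n) *\<^sub>R (g (x + (1 / real (Suc n)) *\<^sub>R b) - g x)" for n :: nat and x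
  have int_g: "integrable lborel g"
    by (rule Bochner_Integration.integrable_bound[OF integrable_mult_right[OF W, of K]])
       (use g in \<open>auto intro: order.trans[OF _ abs_ge_self]\<close>)
  have int_q: "integral\<^sup>L lborel (q n) = 0" for n
    unfolding q_def using int_g integral_translation[OF int_g] by simp
  note der' = directional_derivative_at[OF der]
  have bound: "norm (q n x) \<le> K * C * W x" for n x
  proof -
    define \<delta> where "\<delta> = 1 / real (Suc n)"
    have \<delta>: "0 < \<delta>" "\<delta> \<le> 1" unfolding \<delta>_def by auto
    \<comment> \<open>Mean value inequality on the segment from x to x + \<delta> b: there the
      derivative is at most K times the weight at the moved point, and \<open>shift\<close> returns
      it to the weight at x.\<close>
    have "norm (g (x + \<delta> *\<^sub>R b) - g (x + 0 *\<^sub>R b)) \<le> (K * C * W x) * norm (\<delta> - 0)"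
    proof (rule differentiable_bound[of "{0..\<delta>}" "\<lambda>t. g (x + t *\<^sub>R b)" "\<lambda>t h. h *\<^sub>R g' (x + t *\<^sub>R b)"])
      fix t assume t: "t \<in> {0..\<delta>}"
      show "((\<lambda>t. g (x + t *\<^sub>R b)) has_derivative (\<lambda>h. h *\<^sub>R g' (x + t *\<^sub>R b))) (at t within {0..\<delta>})"
        using der'[of x t] has_derivative_at_withinI unfolding has_vector_derivative_def by blast
      have "norm (g' (x + t *\<^sub>R b)) \<le> K * W (x + t *\<^sub>R b)" by (rule g')
      also have "\<dots> \<le> K * (C * W x)" using shift[of t x] t \<delta> K by (intro mult_left_mono) auto
      finally show "onorm (\<lambda>h. h *\<^sub>R g' (x + t *\<^sub>R b)) \<le> K * C * W x"
        by (intro onorm_le) (simp add: mult.commute[of "\<bar>_\<bar>"] mult.assoc[symmetric] mult_right_mono)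
    qed (use \<delta> in auto)
    then have "norm (g (x + \<delta> *\<^sub>R b) - g x) \<le> K * C * W x * \<delta>" using \<delta> by simp
    then have "(1 / \<delta>) * norm (g (x + \<delta> *\<^sub>R b) - g x) \<le> K * C * W x" using \<delta> by (simp add: field_simps)
    then show ?thesis using \<delta> unfolding q_def \<delta>_def by simp
  qed
  have lim: "(\<lambda>n. q n x) \<longlonglongrightarrow> g' x" for x
  proof -
    have "((\<lambda>t. (g (x + t *\<^sub>R b) - g x) /\<^sub>R t) \<longlongrightarrow> g' x) (at 0)"
    proof (rule LIM_zero_cancel, rule tendsto_norm_zero_cancel)
      have "((\<lambda>t. norm (g (x + t *\<^sub>R b) - g x - t *\<^sub>R g' x) / norm t) \<longlongrightarrow> 0) (at 0)"
        using der[of x] unfolding has_vector_derivative_def has_derivative_at by simp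
      moreover have "norm (g (x + t *\<^sub>R b) - g x - t *\<^sub>R g' x) / norm t
          = norm ((g (x + t *\<^sub>R b) - g x) /\<^sub>R t - g' x)" if "t \<noteq> 0" for t
      proof -
        have "(g (x + t *\<^sub>R b) - g x) /\<^sub>R t - g' x = (g (x + t *\<^sub>R b) - g x - t *\<^sub>R g' x) /\<^sub>R t"
          using that by (simp add: algebra_simps)
        then show ?thesis by (simp add: divide_inverse)
      qed
      ultimately show "((\<lambda>t. norm ((g (x + t *\<^sub>R b) - g x) /\<^sub>R t - g' x)) \<longlongrightarrow> 0) (at 0)"
        by (subst tendsto_cong[OF eventually_at_topological[THEN iffD2], rotated]) (auto intro!: exI[of _ UNIV])
    qed
    moreover have "filterlim (\<lambda>n. 1 / real (Suc n)) (at 0) sequentially"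
      unfolding filterlim_at using LIMSEQ_inverse_real_of_nat by (auto simp: inverse_eq_divide)
    ultimately have "(\<lambda>n. (g (x + (1 / real (Suc n)) *\<^sub>R b) - g x) /\<^sub>R (1 / real (Suc n))) \<longlonglongrightarrow> g' x"
      by (rule filterlim_compose)
    then show ?thesis by (simp add: q_def)
  qed
  have "(\<lambda>n. integral\<^sup>L lborel (q n)) \<longlonglongrightarrow> integral\<^sup>L lborel g'"
  proof (rule integral_dominated_convergence[where w = "\<lambda>x. K * C * W x"])
    show "q n \<in> borel_measurable lborel" for n
      unfolding q_def using g(1) by measurable
  qed (use g' W bound lim in auto)
  then show ?thesis using int_q by (simp add: LIMSEQ_const_iff)
qed

lemma integrable_inverse_1_plus_square_UNIV: "integrable lborel (\<lambda>x::real. 1 / (1 + x\<^sup>2))"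
  using integrable_inverse_1_plus_square
  by (simp add: set_integrable_def inverse_eq_divide)

lemma herm_le_inverse_square: "\<exists>K\<ge>0. \<forall>x. \<bar>herm n x\<bar> \<le> K * (1 / (1 + x\<^sup>2))"
proof -
  obtain C where C: "\<And>x. \<bar>x ^ 0 * herm n x\<bar> \<le> C" using herm_decay by blast
  obtain D where D: "\<And>x. \<bar>x ^ 2 * herm n x\<bar> \<le> D" using herm_decay by blast
  have "\<bar>herm n x\<bar> * (1 + x\<^sup>2) \<le> C + D" for x
    using C[of x] D[of x] by (simp add: abs_mult algebra_simps)
  moreover have "0 < 1 + x\<^sup>2" for x :: real by (simp add: add_pos_nonneg)
  ultimately have "\<bar>herm n x\<bar> \<le> (C + D) * (1 / (1 + x\<^sup>2))" for x
    by (simp add: field_simps)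
  moreover have "C \<ge> 0" "D \<ge> 0" using C[of 0] D[of 0] by auto
  ultimately show ?thesis by (intro exI[of _ "C + D"]) auto
qed

lemma herm_mult_le_inverse_square: "\<exists>K\<ge>0. \<forall>x. \<bar>herm m x * herm n x\<bar> \<le> K * (1 / (1 + x\<^sup>2))"
proof -
  obtain C where C: "\<And>x. \<bar>x ^ 0 * herm m x\<bar> \<le> C" using herm_decay by blast
  obtain K where K: "K \<ge> 0" "\<And>x. \<bar>herm n x\<bar> \<le> K * (1 / (1 + x\<^sup>2))" using herm_le_inverse_square by blast
  have "C \<ge> 0" using C[of 0] by auto
  moreover have "\<bar>herm m x * herm n x\<bar> \<le> C * (K * (1 / (1 + x\<^sup>2)))" for x
    using C[of x] K(2)[of x] \<open>C \<ge> 0\<close> unfolding abs_mult by (intro mult_mono) auto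
  ultimately show ?thesis using K(1) by (intro exI[of _ "C * K"]) auto
qed

lemma borel_measurable_herm [measurable]: "herm n \<in> borel_measurable borel"
  by (rule borel_measurable_continuous_onI[OF continuous_on_herm])

lemma integrable_herm_mult: "integrable lborel (\<lambda>x. herm m x * herm n x)"
proof -
  obtain K where K: "K \<ge> 0" "\<And>x. \<bar>herm m x * herm n x\<bar> \<le> K * (1 / (1 + x\<^sup>2))"
    using herm_mult_le_inverse_square by blast
  show ?thesis
    by (rule Bochner_Integration.integrable_bound[OF integrable_mult_right[OF integrable_inverse_1_plus_square_UNIV, of K]])
       (use K in \<open>auto intro: order.trans[OF _ abs_ge_self]\<close>)
qed

lemma inverse_square_shift:
  fixes x s :: real
  assumes "0 \<le> s" "s \<le> 1"
  shows "1 / (1 + (x + s)\<^sup>2) \<le> 3 * (1 / (1 + x\<^sup>2))"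
proof -
  have p: "0 < 1 + y\<^sup>2" for y :: real by (simp add: add_pos_nonneg)
  have s2: "s\<^sup>2 \<le> 1" using assms by (simp add: power_le_one)
  have "1 + x\<^sup>2 \<le> 3 * (1 + (x + s)\<^sup>2)"
  proof -
    \<comment> \<open>The difference of the two sides is 2 + 2x^2 + 6xs + 3s^2, and this sum of
      squares equals 2x^2 + 6xs + 5s^2; the missing 2s^2 is covered by s^2 \<le> 1.\<close>
    have "0 \<le> (x + 2 * s)\<^sup>2 + (x + s)\<^sup>2" by simp
    then show ?thesis using s2 by (simp add: power2_eq_square algebra_simps)
  qed
  then show ?thesis using p[of x] p[of "x + s"] by (simp add: field_simps)
qed

text \<open>In the derivative of the product h_m h_n the terms with the factor x from the two ladder
  relations cancel. That the integral of the derivative vanishes then says that raising is adjoint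
  to lowering.\<close>

lemma herm_inner_Suc:
  "sqrt (real (Suc n)) * integral\<^sup>L lborel (\<lambda>x. herm m x * herm (Suc n) x)
    = sqrt (real m) * integral\<^sup>L lborel (\<lambda>x. herm (m - 1) x * herm n x)"
proof -
  define g' where "g' x = sqrt (2 * real m) * (herm (m - 1) x * herm n x) - sqrt (2 * real (Suc n)) * (herm m x * herm (Suc n) x)" for x
  obtain K1 where K1: "K1 \<ge> 0" "\<And>x. \<bar>herm (m - 1) x * herm n x\<bar> \<le> K1 * (1 / (1 + x\<^sup>2))"
    using herm_mult_le_inverse_square by blast
  obtain K2 where K2: "K2 \<ge> 0" "\<And>x. \<bar>herm m x * herm (Suc n) x\<bar> \<le> K2 * (1 / (1 + x\<^sup>2))"
    using herm_mult_le_inverse_square by blast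
  obtain K3 where K3: "K3 \<ge> 0" "\<And>x. \<bar>herm m x * herm n x\<bar> \<le> K3 * (1 / (1 + x\<^sup>2))"
    using herm_mult_le_inverse_square by blast
  define K where "K = sqrt (2 * real m) * K1 + sqrt (2 * real (Suc n)) * K2 + K3"
  have K: "K \<ge> 0" unfolding K_def using K1 K2 K3 by (intro add_nonneg_nonneg mult_nonneg_nonneg) auto
  have W: "0 \<le> 1 / (1 + x\<^sup>2)" for x :: real by (intro divide_nonneg_nonneg add_nonneg_nonneg) auto
  have g'bd: "norm (g' x) \<le> K * (1 / (1 + x\<^sup>2))" for x
  proof -
    have "norm (g' x) \<le> sqrt (2 * real m) * \<bar>herm (m - 1) x * herm n x\<bar> + sqrt (2 * real (Suc n)) * \<bar>herm m x * herm (Suc n) x\<bar>"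
      unfolding g'_def real_norm_def by (rule order.trans[OF abs_triangle_ineq4]) (simp add: abs_mult)
    also have "\<dots> \<le> sqrt (2 * real m) * (K1 * (1 / (1 + x\<^sup>2))) + sqrt (2 * real (Suc n)) * (K2 * (1 / (1 + x\<^sup>2)))"
      using K1 K2 by (intro add_mono mult_left_mono) auto
    also have "\<dots> \<le> K * (1 / (1 + x\<^sup>2))"
      unfolding K_def using mult_nonneg_nonneg[OF K3(1) W[of x]] by (simp add: algebra_simps)
    finally show ?thesis .
  qed
  have gbd: "norm (herm m x * herm n x) \<le> K * (1 / (1 + x\<^sup>2))" for x
  proof -
    have "K3 \<le> K" unfolding K_def using K1 K2 K3 by auto
    then show ?thesis using K3(2)[of x] W[of x] mult_right_mono[of K3 K] by fastforce
  qed
  have der: "((\<lambda>t. herm m (x + t *\<^sub>R 1) * herm n (x + t *\<^sub>R 1)) has_vector_derivative g' x) (at 0)" for x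
  proof -
    obtain d e where d: "(herm m has_real_derivative d) (at x)" and e: "(herm n has_real_derivative e) (at x)"
      using herm_has_derivative by blast
    have "g' x = (sqrt (2 * real m) * herm (m - 1) x) * herm n x - herm m x * (sqrt (2 * real (Suc n)) * herm (Suc n) x)"
      unfolding g'_def by simp
    also have "\<dots> = d * herm n x + herm m x * e"
      unfolding herm_lowering(1)[OF d, symmetric] herm_lowering(2)[OF e, symmetric] by (simp add: algebra_simps)
    finally have g': "g' x = d * herm n x + e * herm m x" by simp
    have "((\<lambda>y. herm m y * herm n y) has_real_derivative g' x) (at (0 + x))"
      unfolding g' using DERIV_mult[OF d e] by simp
    then have "((\<lambda>t. herm m (t + x) * herm n (t + x)) has_real_derivative g' x) (at 0)"
      unfolding DERIV_shift .
    then show ?thesis by (simp add: has_real_derivative_iff_has_vector_derivative add.commute)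
  qed
  have "integral\<^sup>L lborel g' = 0"
  proof (rule integral_directional_derivative_eq_0[OF der integrable_inverse_1_plus_square_UNIV])
    show "1 / (1 + (x + s *\<^sub>R 1)\<^sup>2) \<le> 3 * (1 / (1 + x\<^sup>2))" if "0 \<le> s" "s \<le> 1" for x s :: real
      using inverse_square_shift[OF that] by simp
    show "g' \<in> borel_measurable borel" unfolding g'_def by measurable
  qed (use g'bd gbd K in auto)
  then have "sqrt (2 * real m) * integral\<^sup>L lborel (\<lambda>x. herm (m - 1) x * herm n x)
      = sqrt (2 * real (Suc n)) * integral\<^sup>L lborel (\<lambda>x. herm m x * herm (Suc n) x)"
    unfolding g'_def using integrable_herm_mult by simp
  then have "sqrt 2 * (sqrt (real m) * integral\<^sup>L lborel (\<lambda>x. herm (m - 1) x * herm n x))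
      = sqrt 2 * (sqrt (real (Suc n)) * integral\<^sup>L lborel (\<lambda>x. herm m x * herm (Suc n) x))"
    by (simp only: real_sqrt_mult mult.assoc)
  then show ?thesis by simp
qed

lemma integral_gauss: "has_bochner_integral lborel (\<lambda>x::real. exp (- x\<^sup>2)) (sqrt pi)"
proof -
  have "has_bochner_integral lborel (\<lambda>x::real. exp (- x\<^sup>2)) (2 *\<^sub>R (sqrt pi / 2))"
    by (rule has_bochner_integral_even_function[OF gaussian_moment_0]) simp
  then show ?thesis by simp
qed

text \<open>\<open>herm_inner_Suc\<close> lowers both indices by one until n = 0. There remains the
  Gaussian integral or, for m > 0, the same relation with the lower index 0, whose right side has
  the factor sqrt 0.\<close>

lemma herm_orthonormal:
  "integral\<^sup>L lborel (\<lambda>x. herm m x * herm n x) = (if m = n then 1 else 0)"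
proof (induction n arbitrary: m)
  case 0
  have "integral\<^sup>L lborel (\<lambda>x. herm 0 x * herm 0 x) = 1"
  proof -
    have "herm 0 x * herm 0 x = exp (- x\<^sup>2) / sqrt pi" for x
      by (simp add: herm_def herm_norm_def exp_add[symmetric] field_simps)
    then show ?thesis using has_bochner_integral_integral_eq[OF integral_gauss] by simp
  qed
  moreover have "integral\<^sup>L lborel (\<lambda>x. herm m x * herm 0 x) = 0" if "m = Suc k" for k
    using herm_inner_Suc[of k 0] unfolding that by (simp add: mult.commute)
  ultimately show ?case by (cases m) auto
next
  case (Suc n)
  show ?case using herm_inner_Suc[of n m] Suc[of "m - 1"]
    by (cases "m = 0") (auto split: if_splits)
qed

text \<open>The square of h_n at x is the integral of 2 h_n h_n' up to x, because h_n vanishes at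
  minus infinity. The integrand is at most h_n^2 + h_n'^2, and by orthonormality the integral of its
  majorant \<open>S\<close> over the whole line is 1 + n + (n + 1).\<close>

lemma herm_square_le: "(herm n x)\<^sup>2 \<le> 2 * real (Suc n)"
proof -
  define S where "S y = (herm n y * herm n y) + (real n * (herm (n - 1) y * herm (n - 1) y) + real (Suc n) * (herm (Suc n) y * herm (Suc n) y))" for y
  have S: "integrable lborel S" "integral\<^sup>L lborel S = 2 * real (Suc n)"
    unfolding S_def using integrable_herm_mult by (simp_all add: herm_orthonormal)
  have le: "2 * (herm n y * dherm 1 n y) \<le> S y" for y
  proof -
    have "2 * (herm n y * dherm 1 n y) \<le> (herm n y)\<^sup>2 + (dherm 1 n y)\<^sup>2"
      using sum_squares_bound[of "herm n y" "dherm 1 n y"] by simp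
    also have "(dherm 1 n y)\<^sup>2 \<le> 2 * (sqrt (real n / 2) * herm (n - 1) y)\<^sup>2 + 2 * (sqrt (real (Suc n) / 2) * herm (Suc n) y)\<^sup>2"
    proof -
      have "(a - b)\<^sup>2 \<le> 2 * a\<^sup>2 + 2 * b\<^sup>2" for a b :: real
        using sum_squares_ge_zero[of "a + b" 0] by (simp add: power2_eq_square algebra_simps)
      then show ?thesis by simp
    qed
    also have "\<dots> = real n * (herm (n - 1) y * herm (n - 1) y) + real (Suc n) * (herm (Suc n) y * herm (Suc n) y)"
      by (simp add: power_mult_distrib power2_eq_square[of "herm _ _"])
    finally show ?thesis unfolding S_def by (simp add: power2_eq_square)
  qed
  have S0: "S y \<ge> 0" for y unfolding S_def by simp
  have le2: "(herm n x)\<^sup>2 - (herm n a)\<^sup>2 \<le> 2 * real (Suc n)" if "a \<le> x" for a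
  proof -
    have "((\<lambda>y. (herm n y)\<^sup>2) has_vector_derivative 2 * (herm n y * dherm 1 n y)) (at y within {a..x})" for y
    proof -
      have "(herm n has_real_derivative dherm 1 n y) (at y)"
        using herm_has_derivative[of n y] by simp
      then have "((\<lambda>y. (herm n y)\<^sup>2) has_real_derivative 2 * (herm n y * dherm 1 n y)) (at y)"
        by (auto intro!: derivative_eq_intros)
      then show ?thesis
        unfolding has_real_derivative_iff_has_vector_derivative by (rule has_vector_derivative_at_within)
    qed
    then have "integral\<^sup>L lborel (\<lambda>y. indicator {a..x} y *\<^sub>R (2 * (herm n y * dherm 1 n y))) = (herm n x)\<^sup>2 - (herm n a)\<^sup>2"
      using that
      by (intro integral_FTC_atLeastAtMost)
         (auto intro!: continuous_intros continuous_on_subset[OF continuous_on_herm] continuous_on_subset[OF continuous_on_dherm] simp del: dherm.simps)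
    moreover have "integral\<^sup>L lborel (\<lambda>y. indicator {a..x} y *\<^sub>R (2 * (herm n y * dherm 1 n y))) \<le> integral\<^sup>L lborel S"
      using S0 le S(1) by (intro integral_mono') (auto simp: indicator_def)
    ultimately show ?thesis using S by simp
  qed
  obtain C where C: "\<And>x. \<bar>x ^ 1 * herm n x\<bar> \<le> C" using herm_decay by blast
  have "(\<lambda>k. herm n (- real (Suc k))) \<longlonglongrightarrow> 0"
  proof (rule Lim_null_comparison)
    show "\<forall>\<^sub>F k in sequentially. norm (herm n (- real (Suc k))) \<le> C * inverse (real (Suc k))"
    proof (rule always_eventually, rule allI)
      fix k
      have "\<bar>(- real (Suc k)) ^ 1 * herm n (- real (Suc k))\<bar> \<le> C" by (rule C)
      then have "real (Suc k) * \<bar>herm n (- real (Suc k))\<bar> \<le> C" by (simp only: abs_mult power_one_right abs_minus abs_of_nat)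
      then show "norm (herm n (- real (Suc k))) \<le> C * inverse (real (Suc k))"
        by (simp add: divide_inverse[symmetric] pos_le_divide_eq mult.commute del: of_nat_Suc)
    qed
    show "(\<lambda>k. C * inverse (real (Suc k))) \<longlonglongrightarrow> 0"
      using tendsto_mult_right_zero[OF LIMSEQ_inverse_real_of_nat] .
  qed
  then have lim: "(\<lambda>k. (herm n x)\<^sup>2 - (herm n (- real (Suc k)))\<^sup>2) \<longlonglongrightarrow> (herm n x)\<^sup>2 - 0\<^sup>2"
    by (intro tendsto_intros)
  have "(herm n x)\<^sup>2 - 0\<^sup>2 \<le> 2 * real (Suc n)"
  proof (rule LIMSEQ_le_const2[OF lim])
    obtain N where "real N \<ge> - x" using real_arch_simple by blast
    then show "\<exists>N. \<forall>k\<ge>N. (herm n x)\<^sup>2 - (herm n (- real (Suc k)))\<^sup>2 \<le> 2 * real (Suc n)"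
      by (intro exI[of _ N] allI impI le2) auto
  qed
  then show ?thesis by simp
qed

text \<open>At s = 0 this is sqrt(2(n + 1)), the bound from \<open>herm_square_le\<close>. Each
  factor x and each derivative raises s by one; the formula is chosen so that either neighbouring
  index contributes at most half of the next value.\<close>

definition herm_bound :: "nat \<Rightarrow> nat \<Rightarrow> real" where
  "herm_bound n s = sqrt 2 ^ Suc s * sqrt (fact (n + s + 1) / fact n)"

lemma herm_bound_step:
  "sqrt (real n / 2) * herm_bound (n - 1) s \<le> herm_bound n (Suc s) / 2"
  "sqrt (real (Suc n) / 2) * herm_bound (Suc n) s \<le> herm_bound n (Suc s) / 2"
proof -
  have B: "herm_bound n (Suc s) / 2 = sqrt 2 ^ Suc s * sqrt (fact (n + s + 2) / fact n / 2)"
  proof -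
    have "sqrt (r / 2) = sqrt 2 * sqrt r / 2" for r :: real
      by (simp add: real_sqrt_divide field_simps)
    then show ?thesis by (simp add: herm_bound_def del: fact_Suc divide_divide_eq_left)
  qed
  \<comment> \<open>After squaring, the lower neighbour requires n^2 (n + s)! \<le> (n + s + 2)!;
    for the upper neighbour the corresponding relation is an equality.\<close>
  have "real n / 2 * (fact (n - 1 + s + 1) / fact (n - 1)) \<le> fact (n + s + 2) / fact n / 2"
  proof (cases n)
    case (Suc m)
    have "real n / 2 * (fact (n - 1 + s + 1) / fact (n - 1)) = real n * real n * fact (n + s) / fact n / 2"
    proof -
      have "fact n = real n * fact (n - 1)" "n - 1 + s + 1 = n + s" "real n > 0" by (auto simp: Suc)
      then show ?thesis by (simp only:) (simp add: field_simps)
    qed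
    also have "real n * real n * fact (n + s) \<le> (real (n + s + 2) * real (n + s + 1)) * fact (n + s)"
      by (intro mult_right_mono mult_mono) auto
    also have "\<dots> = fact (n + s + 2)" by (simp add: algebra_simps)
    finally show ?thesis by (simp add: divide_right_mono)
  qed simp
  then have "sqrt (real n / 2 * (fact (n - 1 + s + 1) / fact (n - 1))) \<le> sqrt (fact (n + s + 2) / fact n / 2)"
    by (simp only: real_sqrt_le_iff)
  then have "sqrt 2 ^ Suc s * sqrt (real n / 2 * (fact (n - 1 + s + 1) / fact (n - 1))) \<le> sqrt 2 ^ Suc s * sqrt (fact (n + s + 2) / fact n / 2)"
    by (intro mult_left_mono) auto
  then show "sqrt (real n / 2) * herm_bound (n - 1) s \<le> herm_bound n (Suc s) / 2"
    unfolding B unfolding herm_bound_def real_sqrt_mult by (simp only: mult.left_commute)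
  have "real (Suc n) / 2 * (fact (Suc n + s + 1) / fact (Suc n)) = fact (n + s + 2) / fact n / (2::real)"
    by (simp add: divide_simps del: of_nat_Suc)
  then have "sqrt (real (Suc n) / 2 * (fact (Suc n + s + 1) / fact (Suc n))) \<le> sqrt (fact (n + s + 2) / fact n / 2)"
    by simp
  then have "sqrt 2 ^ Suc s * sqrt (real (Suc n) / 2 * (fact (Suc n + s + 1) / fact (Suc n))) \<le> sqrt 2 ^ Suc s * sqrt (fact (n + s + 2) / fact n / 2)"
    by (intro mult_left_mono) auto
  then show "sqrt (real (Suc n) / 2) * herm_bound (Suc n) s \<le> herm_bound n (Suc s) / 2"
    unfolding B unfolding herm_bound_def real_sqrt_mult by (simp only: mult.left_commute)
qed

lemma dherm_le: "\<bar>x ^ a * dherm b n x\<bar> \<le> herm_bound n (a + b)"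
proof -
  \<comment> \<open>Multiplication by x and differentiation differ only in the sign
    \<open>\<epsilon>\<close> between the two neighbouring terms, so this single estimate serves
    both inductions.\<close>
  have step: "\<bar>sqrt (real n / 2) * u + \<epsilon> * (sqrt (real (Suc n) / 2) * v)\<bar> \<le> herm_bound n (Suc s)"
    if "\<bar>u\<bar> \<le> herm_bound (n - 1) s" "\<bar>v\<bar> \<le> herm_bound (Suc n) s" "\<bar>\<epsilon>\<bar> = 1" for u v \<epsilon> n s
  proof -
    have "\<bar>sqrt (real n / 2) * u + \<epsilon> * (sqrt (real (Suc n) / 2) * v)\<bar> \<le> sqrt (real n / 2) * \<bar>u\<bar> + sqrt (real (Suc n) / 2) * \<bar>v\<bar>"
      using that(3) by (intro order.trans[OF abs_triangle_ineq]) (auto simp: abs_mult)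
    also have "\<dots> \<le> sqrt (real n / 2) * herm_bound (n - 1) s + sqrt (real (Suc n) / 2) * herm_bound (Suc n) s"
      using that by (intro add_mono mult_left_mono) auto
    also have "\<dots> \<le> herm_bound n (Suc s)" using herm_bound_step[of n s] by simp
    finally show ?thesis .
  qed
  show ?thesis
  proof (induction b arbitrary: n)
    case 0
    show ?case
    proof (induction a arbitrary: n)
      case 0
      have "\<bar>herm n x\<bar> \<le> sqrt (2 * real (Suc n))"
        using herm_square_le[of n x] by (intro real_le_rsqrt) auto
      also have "\<dots> = herm_bound n 0"
        by (simp add: herm_bound_def real_sqrt_mult[symmetric] del: of_nat_Suc)
      finally show ?case by simp
    next
      case (Suc a)
      have "x ^ Suc a * dherm 0 n x = x ^ a * (x * herm n x)" by simp
      also have "\<dots> = sqrt (real n / 2) * (x ^ a * dherm 0 (n - 1) x) + 1 * (sqrt (real (Suc n) / 2) * (x ^ a * dherm 0 (Suc n) x))"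
        unfolding herm_times[of x n] by (simp add: algebra_simps)
      also have "\<bar>\<dots>\<bar> \<le> herm_bound n (Suc (a + 0))"
        by (rule step[OF Suc Suc]) simp
      finally show ?case by simp
    qed
  next
    case (Suc b)
    have "x ^ a * dherm (Suc b) n x = sqrt (real n / 2) * (x ^ a * dherm b (n - 1) x) + (-1) * (sqrt (real (Suc n) / 2) * (x ^ a * dherm b (Suc n) x))"
      by (simp add: algebra_simps)
    also have "\<bar>\<dots>\<bar> \<le> herm_bound n (Suc (a + b))"
      by (rule step[OF Suc Suc]) simp
    finally show ?case by simp
  qed
qed

section \<open>Hermite functions of several variables\<close>

lemma unit_mi_apply: "unit_mi j i = (if i = j then 1 else 0)"
  by (simp add: unit_mi_def)

lemma msize_0 [simp]: "msize (0 :: 'n::finite \<Rightarrow> nat) = 0"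
  by (simp add: msize_def)

lemma msize_add: "msize (\<alpha> + \<beta>) = msize \<alpha> + msize \<beta>"
  by (simp add: msize_def sum.distrib)

lemma msize_unit_mi [simp]: "msize (unit_mi j) = 1"
  by (simp add: msize_def unit_mi_apply)

lemma mi_diff_unit_add: "\<beta> j > 0 \<Longrightarrow> \<beta> - unit_mi j + unit_mi j = (\<beta> :: 'n \<Rightarrow> nat)"
  by (auto simp: fun_eq_iff unit_mi_apply)

lemma mi_induct [case_names zero step]:
  fixes \<beta> :: "'n::finite \<Rightarrow> nat"
  assumes "P 0" and "\<And>\<beta> i. P \<beta> \<Longrightarrow> P (\<beta> + unit_mi i)"
  shows "P \<beta>"
proof (induction "msize \<beta>" arbitrary: \<beta>)
  case 0
  then have "\<beta> = 0" by (auto simp: msize_def fun_eq_iff)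
  then show ?case using assms(1) by metis
next
  case (Suc n)
  then have "msize \<beta> \<noteq> 0" by linarith
  then have "\<exists>i. \<beta> i \<noteq> 0" by (rule contrapos_np) (simp add: msize_def)
  then obtain i where i: "\<beta> i > 0" by blast
  have "msize (\<beta> - unit_mi i) + msize (unit_mi i) = Suc n"
    using Suc(2) mi_diff_unit_add[of \<beta> i, OF i] by (metis msize_add)
  then have "P (\<beta> - unit_mi i)" using Suc(1) by simp
  from assms(2)[OF this, of i] show ?case using mi_diff_unit_add[of \<beta> i, OF i] by simp
qed

section \<open>Smooth functions and calculus of partial derivatives\<close>

lemma partials_family_unique:
  assumes "partials_family f D" "partials_family f E"
  shows "D \<beta> = E \<beta>"
proof (induction \<beta> rule: mi_induct)
  case zero
  show ?case using assms unfolding partials_family_def by metis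
next
  case (step \<beta> i)
  have "D (\<beta> + unit_mi i) x = E (\<beta> + unit_mi i) x" for x
    using assms step vector_derivative_unique_at unfolding partials_family_def by metis
  then show ?case by (rule ext)
qed

text \<open>Uniqueness of the family makes the choice inside \<open>pder\<close> harmless. For every
  concrete function below, all derivatives are computed at once by exhibiting one family and
  applying this rule.\<close>

lemma pder_eq: "partials_family f D \<Longrightarrow> pder \<beta> f = D \<beta>"
  unfolding pder_def using partials_family_unique[of f "SOME D. partials_family f D" D] someI[of "partials_family f" D]
  by blast

lemma partials_family_pder: "smooth f \<Longrightarrow> partials_family f (\<lambda>\<beta>. pder \<beta> f)"
  unfolding smooth_def using pder_eq by (metis ext)

lemma partials_family_smooth: "partials_family f D \<Longrightarrow> smooth f"
  by (auto simp: smooth_def)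

lemma pder_0: "smooth f \<Longrightarrow> pder 0 f = f"
  using partials_family_pder unfolding partials_family_def by blast

lemma continuous_on_pder: "smooth f \<Longrightarrow> continuous_on UNIV (pder \<beta> f)"
  using partials_family_pder unfolding partials_family_def by blast

lemma continuous_on_smooth: "smooth f \<Longrightarrow> continuous_on UNIV f"
  using continuous_on_pder[of f 0] by (simp add: pder_0)

lemma pder_has_vector_derivative:
  "smooth f \<Longrightarrow> ((\<lambda>t. pder \<beta> f (x + t *\<^sub>R axis i 1)) has_vector_derivative pder (\<beta> + unit_mi i) f x) (at 0)"
  using partials_family_pder unfolding partials_family_def by blast

lemma partials_family_lincomb:
  assumes "smooth f" "smooth g"
  shows "partials_family (\<lambda>x. a * f x + b * g x) (\<lambda>\<beta> x. a * pder \<beta> f x + b * pder \<beta> g x)"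
  unfolding partials_family_def using assms
  by (auto simp: pder_0 intro!: continuous_intros continuous_on_pder derivative_eq_intros pder_has_vector_derivative)

lemma smooth_lincomb: "smooth f \<Longrightarrow> smooth g \<Longrightarrow> smooth (\<lambda>x. a * f x + b * g x)"
  using partials_family_lincomb partials_family_smooth by blast

lemma pder_lincomb:
  "smooth f \<Longrightarrow> smooth g \<Longrightarrow> pder \<beta> (\<lambda>x. a * f x + b * g x) = (\<lambda>x. a * pder \<beta> f x + b * pder \<beta> g x)"
  using pder_eq[OF partials_family_lincomb] .

lemma partials_family_pder_shift:
  assumes "smooth f"
  shows "partials_family (pder \<delta> f) (\<lambda>\<beta>. pder (\<delta> + \<beta>) f)"
  unfolding partials_family_def using assms pder_has_vector_derivative[OF assms]
  by (auto simp: continuous_on_pder add.assoc[symmetric])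

lemma smooth_pder: "smooth f \<Longrightarrow> smooth (pder \<delta> f)"
  using partials_family_pder_shift partials_family_smooth by blast

lemma pder_pder: "smooth f \<Longrightarrow> pder \<beta> (pder \<delta> f) = pder (\<delta> + \<beta>) f"
  by (rule pder_eq[OF partials_family_pder_shift])

lemma has_vector_derivative_coord:
  "((\<lambda>t. complex_of_real ((x + t *\<^sub>R axis i 1) $ j)) has_vector_derivative (if i = j then 1 else 0)) (at 0)"
  by (auto intro!: derivative_eq_intros simp: axis_def)

lemma partials_family_mult_coord:
  assumes "smooth f"
  shows "partials_family (\<lambda>x. complex_of_real (x $ j) * f x)
    (\<lambda>\<beta> x. complex_of_real (x $ j) * pder \<beta> f x + of_nat (\<beta> j) * pder (\<beta> - unit_mi j) f x)"
  unfolding partials_family_def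
proof (intro conjI allI)
  show "(\<lambda>x. complex_of_real (x $ j) * pder 0 f x + of_nat ((0 :: _ \<Rightarrow> nat) j) * pder (0 - unit_mi j) f x) = (\<lambda>x. complex_of_real (x $ j) * f x)"
    using assms by (simp add: pder_0)
next
  fix \<beta> :: "'a \<Rightarrow> nat"
  show "continuous_on UNIV (\<lambda>x. complex_of_real (x $ j) * pder \<beta> f x + of_nat (\<beta> j) * pder (\<beta> - unit_mi j) f x)"
    using assms by (intro continuous_intros continuous_on_pder)
next
  fix \<beta> :: "'a \<Rightarrow> nat" and i x
  \<comment> \<open>Leibniz bookkeeping. When \<beta>_j = 0 the truncated index
    \<open>\<beta> - unit_mi j\<close> is wrong, but it is multiplied by \<beta>_j, so only the case
    \<beta>_j > 0 needs a true index identity.\<close>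
  have eq: "(if i = j then 1 else 0) * pder \<beta> f x + of_nat (\<beta> j) * pder (\<beta> - unit_mi j + unit_mi i) f x
      = of_nat ((\<beta> + unit_mi i) j) * pder (\<beta> + unit_mi i - unit_mi j) f x"
  proof (cases "i = j")
    case True
    have "\<beta> + unit_mi j - unit_mi j = \<beta>" by (auto simp: fun_eq_iff)
    then show ?thesis
      using True by (cases "\<beta> j > 0") (auto simp: mi_diff_unit_add unit_mi_apply distrib_right)
  next
    case False
    have "of_nat (\<beta> j) * pder (\<beta> - unit_mi j + unit_mi i) f x = of_nat (\<beta> j) * pder (\<beta> + unit_mi i - unit_mi j) f x"
    proof (cases "\<beta> j > 0")
      case True
      then have "\<beta> - unit_mi j + unit_mi i = \<beta> + unit_mi i - unit_mi j"
        using False by (auto simp: fun_eq_iff unit_mi_apply)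
      then show ?thesis by simp
    qed simp
    then show ?thesis using False by (simp add: unit_mi_apply)
  qed
  have "((\<lambda>t. complex_of_real ((x + t *\<^sub>R axis i 1) $ j) * pder \<beta> f (x + t *\<^sub>R axis i 1) + of_nat (\<beta> j) * pder (\<beta> - unit_mi j) f (x + t *\<^sub>R axis i 1))
    has_vector_derivative
      (complex_of_real ((x + 0 *\<^sub>R axis i 1) $ j) * pder (\<beta> + unit_mi i) f x + (if i = j then 1 else 0) * pder \<beta> f (x + 0 *\<^sub>R axis i 1))
       + of_nat (\<beta> j) * pder (\<beta> - unit_mi j + unit_mi i) f x) (at 0)"
    by (intro has_vector_derivative_add has_vector_derivative_mult has_vector_derivative_coord
        has_vector_derivative_mult_right pder_has_vector_derivative assms)
  then show "((\<lambda>t. complex_of_real ((x + t *\<^sub>R axis i 1) $ j) * pder \<beta> f (x + t *\<^sub>R axis i 1) + of_nat (\<beta> j) * pder (\<beta> - unit_mi j) f (x + t *\<^sub>R axis i 1))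
    has_vector_derivative complex_of_real (x $ j) * pder (\<beta> + unit_mi i) f x + of_nat ((\<beta> + unit_mi i) j) * pder (\<beta> + unit_mi i - unit_mi j) f x) (at 0)"
    using eq by (simp only: scaleR_zero_left add_0_right add.assoc)
qed

lemma smooth_mult_coord: "smooth f \<Longrightarrow> smooth (\<lambda>x. complex_of_real (x $ j) * f x)"
  using partials_family_mult_coord partials_family_smooth by blast

lemma pder_mult_coord:
  "smooth f \<Longrightarrow> pder \<beta> (\<lambda>x. complex_of_real (x $ j) * f x) =
    (\<lambda>x. complex_of_real (x $ j) * pder \<beta> f x + of_nat (\<beta> j) * pder (\<beta> - unit_mi j) f x)"
  using pder_eq[OF partials_family_mult_coord] .

text \<open>Varying one coordinate changes only one factor. The lemma is applied twice: to the
  Gaussian, whose derivatives define \<open>hermite_poly\<close>, and to the Hermite functions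
  themselves.\<close>

lemma partials_family_prod:
  fixes d :: "'n::finite \<Rightarrow> nat \<Rightarrow> real \<Rightarrow> real"
  assumes "\<And>j k x. (d j k has_real_derivative d j (Suc k) x) (at x)"
  shows "partials_family (\<lambda>x::real^'n. complex_of_real (\<Prod>j\<in>UNIV. d j 0 (x $ j)))
    (\<lambda>\<beta> x. complex_of_real (\<Prod>j\<in>UNIV. d j (\<beta> j) (x $ j)))"
  unfolding partials_family_def
proof (intro conjI allI)
  have cont: "continuous_on UNIV (d j k)" for j k
    by (intro continuous_at_imp_continuous_on ballI DERIV_isCont[OF assms])
  fix \<beta> :: "'n \<Rightarrow> nat"
  show "continuous_on UNIV (\<lambda>x::real^'n. complex_of_real (\<Prod>j\<in>UNIV. d j (\<beta> j) (x $ j)))"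
    by (intro continuous_intros continuous_on_compose2[OF cont]) auto
  fix i :: 'n and x :: "real^'n"
  have split: "(\<Prod>j\<in>(UNIV::'n set). d j (\<beta>' j) (y $ j)) = d i (\<beta>' i) (y $ i) * (\<Prod>j\<in>UNIV - {i}. d j (\<beta>' j) (y $ j))"
    for \<beta>' and y :: "real^'n"
    by (rule prod.remove) auto
  have 1: "(\<Prod>j\<in>UNIV. d j (\<beta> j) ((x + t *\<^sub>R axis i 1) $ j)) = d i (\<beta> i) (t + x $ i) * (\<Prod>j\<in>UNIV - {i}. d j (\<beta> j) (x $ j))" for t
  proof -
    have "(\<Prod>j\<in>UNIV - {i}. d j (\<beta> j) ((x + t *\<^sub>R axis i 1) $ j)) = (\<Prod>j\<in>UNIV - {i}. d j (\<beta> j) (x $ j))"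
      by (rule prod.cong) (auto simp: axis_def)
    then show ?thesis unfolding split by (simp add: axis_def add.commute)
  qed
  have 2: "(\<Prod>j\<in>UNIV. d j ((\<beta> + unit_mi i) j) (x $ j)) = d i (Suc (\<beta> i)) (x $ i) * (\<Prod>j\<in>UNIV - {i}. d j (\<beta> j) (x $ j))"
  proof -
    have "(\<Prod>j\<in>UNIV - {i}. d j ((\<beta> + unit_mi i) j) (x $ j)) = (\<Prod>j\<in>UNIV - {i}. d j (\<beta> j) (x $ j))"
      by (rule prod.cong) (auto simp: unit_mi_apply)
    then show ?thesis unfolding split by (simp add: unit_mi_apply)
  qed
  have "(d i (\<beta> i) has_real_derivative d i (Suc (\<beta> i)) (x $ i)) (at (0 + x $ i))"
    using assms by simp
  then have "((\<lambda>t. d i (\<beta> i) (t + x $ i)) has_real_derivative d i (Suc (\<beta> i)) (x $ i)) (at 0)"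
    unfolding DERIV_shift .
  from DERIV_cmult_right[OF this, of "\<Prod>j\<in>UNIV - {i}. d j (\<beta> j) (x $ j)"]
  show "((\<lambda>t. complex_of_real (\<Prod>j\<in>UNIV. d j (\<beta> j) ((x + t *\<^sub>R axis i 1) $ j))) has_vector_derivative
         complex_of_real (\<Prod>j\<in>UNIV. d j ((\<beta> + unit_mi i) j) (x $ j))) (at 0)"
    unfolding 1 2 by (rule has_vector_derivative_of_real)
qed auto

lemma norm_power2_eq_sum: "(norm (x :: real^'n))\<^sup>2 = (\<Sum>j\<in>UNIV. (x $ j)\<^sup>2)"
  by (simp add: power2_norm_eq_inner inner_vec_def power2_eq_square[of "_ $ _"])

lemma exp_norm_power2: "exp (c * (norm (x :: real^'n))\<^sup>2) = (\<Prod>j\<in>UNIV. exp (c * (x $ j)\<^sup>2))"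
  by (simp add: norm_power2_eq_sum sum_distrib_left exp_sum)

lemma sqrt_prod: "sqrt (\<Prod>i\<in>A. f i) = (\<Prod>i\<in>A. sqrt (f i))"
  by (induction A rule: infinite_finite_induct) (auto simp: real_sqrt_mult)

text \<open>The recurrence \<open>hpoly_Suc\<close> yields the one-variable Rodrigues formula:
  (-1)^k \<open>hpoly k\<close> times exp(-y^2) is the k-th derivative of exp(-y^2). Signs,
  Gaussians and normalising constants then factor over the coordinates.\<close>

lemma hermite_fun_eq:
  "hermite_fun \<gamma> x = complex_of_real (\<Prod>j\<in>UNIV. herm (\<gamma> j) (x $ j))"
proof -
  define d where "d j k y = (-1) ^ k * hpoly k y * exp (- y\<^sup>2)" for j :: 'a and k :: nat and y :: real
  have dd: "(d j k has_real_derivative d j (Suc k) y) (at y)" for j k y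
  proof -
    have "(d j k has_real_derivative (-1) ^ k * (2 * real k * hpoly (k - 1) y) * exp (- y\<^sup>2) + (-1) ^ k * hpoly k y * (exp (- y\<^sup>2) * (- (2 * y)))) (at y)"
      unfolding d_def[abs_def] by (auto intro!: derivative_eq_intros hpoly_has_derivative)
    then show ?thesis by (simp add: d_def hpoly_Suc algebra_simps)
  qed
  have "(\<lambda>y::real^'a. complex_of_real (exp (- (norm y)\<^sup>2))) = (\<lambda>y. complex_of_real (\<Prod>j\<in>UNIV. d j 0 (y $ j)))"
    using exp_norm_power2[of "-1", where 'n = 'a] by (simp add: d_def del: of_real_prod)
  then have "pder \<gamma> (\<lambda>y::real^'a. complex_of_real (exp (- (norm y)\<^sup>2))) x = complex_of_real (\<Prod>j\<in>UNIV. d j (\<gamma> j) (x $ j))"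
    using pder_eq[OF partials_family_prod[of d, OF dd]] by (simp del: of_real_prod)
  then have H1: "hermite_fun \<gamma> x = complex_of_real (1 / sqrt (2 ^ msize \<gamma> * mfact \<gamma> * pi powr (real CARD('a) / 2)) *
      ((-1) ^ msize \<gamma> * exp ((norm x)\<^sup>2) * (\<Prod>j\<in>UNIV. d j (\<gamma> j) (x $ j))) * exp (- (norm x)\<^sup>2 / 2))"
    by (simp add: hermite_fun_def hermite_poly_def)
  have H2: "sqrt (2 ^ msize \<gamma> * mfact \<gamma> * pi powr (real CARD('a) / 2)) = (\<Prod>j\<in>UNIV. herm_norm (\<gamma> j))"
  proof -
    have "pi powr (real CARD('a) / 2) = sqrt pi ^ CARD('a)"
      by (simp add: powr_half_sqrt[symmetric] powr_realpow[symmetric] powr_powr)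
    then have "2 ^ msize \<gamma> * mfact \<gamma> * pi powr (real CARD('a) / 2) = (\<Prod>j\<in>UNIV. 2 ^ \<gamma> j * fact (\<gamma> j) * sqrt pi)"
      by (simp add: msize_def mfact_def power_sum prod.distrib)
    then show ?thesis by (simp add: herm_norm_def sqrt_prod)
  qed
  have H3: "(-1) ^ msize \<gamma> * exp ((norm x)\<^sup>2) * (\<Prod>j\<in>UNIV. d j (\<gamma> j) (x $ j)) * exp (- (norm x)\<^sup>2 / 2)
      = (\<Prod>j\<in>UNIV. hpoly (\<gamma> j) (x $ j) * exp (- (x $ j)\<^sup>2 / 2))"
  proof -
    have "(-1) ^ msize \<gamma> * exp ((norm x)\<^sup>2) * (\<Prod>j\<in>UNIV. d j (\<gamma> j) (x $ j)) * exp (- (norm x)\<^sup>2 / 2)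
       = (\<Prod>j\<in>UNIV. (-1) ^ \<gamma> j * exp ((x $ j)\<^sup>2) * d j (\<gamma> j) (x $ j) * exp (- (x $ j)\<^sup>2 / 2))"
      using exp_norm_power2[of 1 x] exp_norm_power2[of "-1/2" x]
      by (simp add: msize_def power_sum prod.distrib)
    also have "\<dots> = (\<Prod>j\<in>UNIV. hpoly (\<gamma> j) (x $ j) * exp (- (x $ j)\<^sup>2 / 2))"
      by (intro prod.cong) (auto simp: d_def exp_minus field_simps power_mult_distrib[symmetric])
    finally show ?thesis .
  qed
  have "1 / N * A * E = (A * E) / N" for N A E :: real by simp
  then show ?thesis unfolding H1 H2 by (simp only: H3 herm_def prod_dividef)
qed

lemma partials_family_hermite_fun:
  "partials_family (hermite_fun \<gamma>) (\<lambda>\<beta> x. complex_of_real (\<Prod>j\<in>UNIV. dherm (\<beta> j) (\<gamma> j) (x $ j)))"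
  using partials_family_prod[of "\<lambda>j k. dherm k (\<gamma> j)", OF dherm_has_derivative]
  by (simp add: hermite_fun_eq[abs_def] del: dherm.simps(2))

lemma smooth_hermite_fun: "smooth (hermite_fun \<gamma>)"
  by (rule partials_family_smooth[OF partials_family_hermite_fun])

lemma pder_hermite_fun:
  "pder \<beta> (hermite_fun \<gamma>) x = complex_of_real (\<Prod>j\<in>UNIV. dherm (\<beta> j) (\<gamma> j) (x $ j))"
  by (simp only: pder_eq[OF partials_family_hermite_fun])

lemma hermite_fun_bound:
  "cmod (complex_of_real (xpow x \<alpha>) * pder \<beta> (hermite_fun \<gamma>) x) \<le> (\<Prod>j\<in>UNIV. herm_bound (\<gamma> j) (\<alpha> j + \<beta> j))"
proof -
  have "cmod (complex_of_real (xpow x \<alpha>) * pder \<beta> (hermite_fun \<gamma>) x) = (\<Prod>j\<in>UNIV. \<bar>(x $ j) ^ \<alpha> j * dherm (\<beta> j) (\<gamma> j) (x $ j)\<bar>)"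
    by (simp only: xpow_def pder_hermite_fun of_real_mult[symmetric] norm_of_real prod.distrib[symmetric] abs_prod)
  also have "\<dots> \<le> (\<Prod>j\<in>UNIV. herm_bound (\<gamma> j) (\<alpha> j + \<beta> j))"
    by (intro prod_mono) (use dherm_le in auto)
  finally show ?thesis .
qed

text \<open>Fubini for products of one-variable functions. Lebesgue measure is represented as the
  image of a product measure over \<open>Basis\<close>, and \<open>ix\<close> translates basis
  vectors back into coordinate indices.\<close>

lemma integrable_prod_cart:
  fixes f :: "'n::finite \<Rightarrow> real \<Rightarrow> real"
  assumes "\<And>j. integrable lborel (f j)"
  shows "integrable lborel (\<lambda>x::real^'n. \<Prod>j\<in>UNIV. f j (x $ j))" (is ?A)
    and "integral\<^sup>L lborel (\<lambda>x::real^'n. \<Prod>j\<in>UNIV. f j (x $ j)) = (\<Prod>j\<in>UNIV. integral\<^sup>L lborel (f j))" (is ?B)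
proof -
  interpret P: product_sigma_finite "\<lambda>b::real^'n. lborel :: real measure" ..
  define \<phi> where "\<phi> = (\<lambda>y::real^'n \<Rightarrow> real. \<Sum>b\<in>Basis. y b *\<^sub>R b)"
  define ix where "ix b = (THE j::'n. axis j (1::real) = b)" for b :: "real^'n"
  have ix: "ix (axis j 1) = j" for j
    unfolding ix_def by (rule the_equality) (auto simp: axis_eq_axis)
  have bij: "bij_betw (\<lambda>j::'n. axis j (1::real)) UNIV Basis"
    by (auto simp: bij_betw_def inj_on_def axis_eq_axis Basis_vec_def)
  have coord: "\<phi> y $ j = y (axis j 1)" for y j
  proof -
    have "\<phi> y $ j = \<phi> y \<bullet> axis j 1" by (simp add: inner_axis)
    also have "\<dots> = y (axis j 1)" unfolding \<phi>_def
      by (simp add: inner_sum_left inner_Basis axis_in_Basis_iff sum.If_cases if_distrib cong: if_cong)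
    finally show ?thesis .
  qed
  have eq: "(\<Prod>j\<in>UNIV. f j (\<phi> y $ j)) = (\<Prod>b\<in>Basis. f (ix b) (y b))" for y
    unfolding coord using prod.reindex_bij_betw[OF bij, of "\<lambda>b. f (ix b) (y b)"] by (simp add: ix)
  have L: "lborel = distr (\<Pi>\<^sub>M b\<in>Basis. lborel) borel \<phi>" unfolding \<phi>_def by (rule lborel_eq)
  have m\<phi>: "\<phi> \<in> measurable (\<Pi>\<^sub>M b\<in>Basis. lborel) borel" unfolding \<phi>_def by measurable
  have [measurable]: "f j \<in> borel_measurable borel" for j using borel_measurable_integrable[OF assms[of j]] by simp
  have mf: "(\<lambda>x::real^'n. \<Prod>j\<in>UNIV. f j (x $ j)) \<in> borel_measurable borel" by measurable
  show ?A
    unfolding L integrable_distr_eq[OF m\<phi> mf] eq by (rule P.product_integrable_prod) (use assms in auto)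
  have "integral\<^sup>L lborel (\<lambda>x::real^'n. \<Prod>j\<in>UNIV. f j (x $ j)) = integral\<^sup>L (\<Pi>\<^sub>M b\<in>Basis. lborel) (\<lambda>y. \<Prod>b\<in>Basis. f (ix b) (y b))"
    unfolding L integral_distr[OF m\<phi> mf] eq ..
  also have "\<dots> = (\<Prod>b\<in>Basis. integral\<^sup>L lborel (f (ix b)))"
    by (rule P.product_integral_prod) (use assms in auto)
  also have "\<dots> = (\<Prod>j\<in>UNIV. integral\<^sup>L lborel (f j))"
    using prod.reindex_bij_betw[OF bij, of "\<lambda>b. integral\<^sup>L lborel (f (ix b))"] by (simp add: ix)
  finally show ?B .
qed

text \<open>A weight that is integrable by Fubini, changes by at most a factor 3 under shifts of
  length at most 1 along an axis, and has a polynomial as reciprocal, so that bounds on monomials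
  times f produce it.\<close>

definition decay :: "real^'n::finite \<Rightarrow> real" where
  "decay x = (\<Prod>j\<in>UNIV. 1 / (1 + (x $ j)\<^sup>2))"

lemma integrable_decay: "integrable lborel decay"
  unfolding decay_def[abs_def] by (rule integrable_prod_cart[OF integrable_inverse_1_plus_square_UNIV])

lemma one_plus_square_pos: "0 < 1 + (x::real)\<^sup>2"
  by (simp add: add_pos_nonneg)

lemma decay_pos: "0 < decay x"
  unfolding decay_def using one_plus_square_pos by (intro prod_pos) auto

lemma decay_le_1: "decay x \<le> 1"
  unfolding decay_def using one_plus_square_pos by (intro prod_le_1) (auto simp: field_simps less_imp_le)

lemma decay_shift:
  assumes "0 \<le> s" "s \<le> 1"
  shows "decay (x + s *\<^sub>R axis i 1) \<le> 3 * decay x"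
proof -
  have split: "decay y = 1 / (1 + (y $ i)\<^sup>2) * (\<Prod>j\<in>UNIV - {i}. 1 / (1 + (y $ j)\<^sup>2))" for y :: "real^'a"
    unfolding decay_def by (rule prod.remove) auto
  have "(\<Prod>j\<in>UNIV - {i}. 1 / (1 + ((x + s *\<^sub>R axis i 1) $ j)\<^sup>2)) = (\<Prod>j\<in>UNIV - {i}. 1 / (1 + (x $ j)\<^sup>2))"
    by (rule prod.cong) (auto simp: axis_def)
  moreover have "0 \<le> (\<Prod>j\<in>UNIV - {i}. 1 / (1 + (x $ j)\<^sup>2))"
    by (intro prod_nonneg) (use one_plus_square_pos in \<open>auto simp: less_imp_le\<close>)
  ultimately show ?thesis
    unfolding split using mult_right_mono[OF inverse_square_shift[OF assms, of "x $ i"]] by (simp add: axis_def)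
qed

text \<open>Expanding the product, the reciprocal of \<open>decay\<close> is the sum of the monomials with all exponents 0 or 2.\<close>
lemma decay_bound:
  fixes x :: "real^'n::finite"
  assumes "\<And>\<alpha>. (\<forall>j. \<alpha> j \<le> 2) \<Longrightarrow> \<bar>xpow x \<alpha>\<bar> * r \<le> K"
  shows "r \<le> 2 ^ CARD('n) * K * decay x"
proof -
  have "(\<Prod>j\<in>UNIV. 1 + (x $ j)\<^sup>2) * r = (\<Sum>B\<in>Pow UNIV. (\<Prod>j\<in>B. (x $ j)\<^sup>2)) * r"
    using prod_add[of UNIV "\<lambda>j. (x $ j)\<^sup>2" "\<lambda>_. 1"] by (simp add: add.commute)
  also have "\<dots> = (\<Sum>B\<in>Pow UNIV. (\<Prod>j\<in>B. (x $ j)\<^sup>2) * r)"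
    by (simp add: sum_distrib_right)
  also have "\<dots> \<le> (\<Sum>B\<in>Pow (UNIV::'n set). K)"
  proof (rule sum_mono)
    fix B :: "'n set"
    have "xpow x (\<lambda>j. if j \<in> B then 2 else 0) = (\<Prod>j\<in>B. (x $ j)\<^sup>2)"
      unfolding xpow_def by (subst prod.mono_neutral_right[of UNIV B]) (auto intro!: prod.cong)
    moreover have "0 \<le> (\<Prod>j\<in>B. (x $ j)\<^sup>2)" by (simp add: prod_nonneg)
    ultimately show "(\<Prod>j\<in>B. (x $ j)\<^sup>2) * r \<le> K"
      using assms[of "\<lambda>j. if j \<in> B then 2 else 0"] by auto
  qed
  also have "\<dots> = 2 ^ CARD('n) * K" by (simp add: card_Pow)
  finally have "(\<Prod>j\<in>UNIV. 1 + (x $ j)\<^sup>2) * r \<le> 2 ^ CARD('n) * K" .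
  moreover have "decay x = 1 / (\<Prod>j\<in>UNIV. 1 + (x $ j)\<^sup>2)" by (simp add: decay_def prod_dividef)
  moreover have "0 < (\<Prod>j\<in>UNIV. 1 + (x $ j)\<^sup>2)" by (intro prod_pos) (use one_plus_square_pos in auto)
  ultimately show ?thesis by (simp add: field_simps)
qed

lemma pder_hermite_fun_decay: "\<exists>C\<ge>0. \<forall>x. cmod (pder \<beta> (hermite_fun \<gamma>) x) \<le> C * decay x"
proof -
  define C where "C = (\<Sum>\<alpha>\<in>{\<alpha>. \<forall>j. \<alpha> j \<le> 2}. \<Prod>j\<in>UNIV. herm_bound (\<gamma> j) (\<alpha> j + \<beta> j))"
  have fin: "finite {\<alpha>::'a \<Rightarrow> nat. \<forall>j. \<alpha> j \<le> 2}"
    using finite_PiE[of "UNIV::'a set" "\<lambda>_. {..2::nat}"] by (simp add: PiE_UNIV_domain Pi_def)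
  have nn: "0 \<le> (\<Prod>j\<in>UNIV. herm_bound (\<gamma> j) (\<alpha> j + \<beta> j))" for \<alpha>
    by (intro prod_nonneg) (auto simp: herm_bound_def)
  have "cmod (pder \<beta> (hermite_fun \<gamma>) x) \<le> 2 ^ CARD('a) * C * decay x" for x
  proof (rule decay_bound)
    fix \<alpha> :: "'a \<Rightarrow> nat" assume "\<forall>j. \<alpha> j \<le> 2"
    then have "(\<Prod>j\<in>UNIV. herm_bound (\<gamma> j) (\<alpha> j + \<beta> j)) \<le> C"
      unfolding C_def using fin nn by (intro member_le_sum) auto
    then show "\<bar>xpow x \<alpha>\<bar> * cmod (pder \<beta> (hermite_fun \<gamma>) x) \<le> C"
      using hermite_fun_bound[of x \<alpha> \<beta> \<gamma>] by (simp add: norm_mult)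
  qed
  moreover have "C \<ge> 0" unfolding C_def using nn by (simp add: sum_nonneg)
  ultimately show ?thesis by (intro exI[of _ "2 ^ CARD('a) * C"]) auto
qed

lemma hermite_fun_decay: "\<exists>C\<ge>0. \<forall>x. cmod (hermite_fun \<gamma> x) \<le> C * decay x"
  using pder_hermite_fun_decay[of 0 \<gamma>] by (simp add: pder_0[OF smooth_hermite_fun])

lemma integrable_decay_bound:
  fixes f :: "real^'n::finite \<Rightarrow> complex"
  assumes "f \<in> borel_measurable borel" "\<And>x. cmod (f x) \<le> C * decay x"
  shows "integrable lborel f"
  by (rule Bochner_Integration.integrable_bound[OF integrable_mult_right[OF integrable_decay, of C]])
     (use assms in \<open>auto intro: order.trans[OF _ abs_ge_self]\<close>)

lemma borel_measurable_pder: "smooth f \<Longrightarrow> pder \<beta> f \<in> borel_measurable borel"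
  by (rule borel_measurable_continuous_onI[OF continuous_on_pder])

lemma borel_measurable_smooth: "smooth f \<Longrightarrow> f \<in> borel_measurable borel"
  by (rule borel_measurable_continuous_onI[OF continuous_on_smooth])

lemma integrable_mult_pder_hermite_fun:
  assumes "f \<in> borel_measurable borel" "\<And>x. cmod (f x) \<le> K"
  shows "integrable lborel (\<lambda>x. f x * pder \<beta> (hermite_fun \<gamma>) x)"
proof -
  obtain C where C: "C \<ge> 0" "\<And>x. cmod (pder \<beta> (hermite_fun \<gamma>) x) \<le> C * decay x" using pder_hermite_fun_decay by blast
  have [measurable]: "pder \<beta> (hermite_fun \<gamma>) \<in> borel_measurable borel" by (rule borel_measurable_pder[OF smooth_hermite_fun])
  have "K \<ge> 0" using assms(2)[of undefined] norm_ge_zero order.trans by blast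
  show ?thesis
  proof (rule integrable_decay_bound)
    show "cmod (f x * pder \<beta> (hermite_fun \<gamma>) x) \<le> (K * C) * decay x" for x
      unfolding norm_mult mult.assoc using assms(2) C \<open>K \<ge> 0\<close> by (intro mult_mono) auto
  qed (use assms(1) in measurable)
qed

lemma integrable_mult_hermite_fun:
  assumes "f \<in> borel_measurable borel" "\<And>x. cmod (f x) \<le> K"
  shows "integrable lborel (\<lambda>x. f x * hermite_fun \<gamma> x)"
  using integrable_mult_pder_hermite_fun[OF assms, where \<beta> = 0 and \<gamma> = \<gamma>] by (simp add: pder_0[OF smooth_hermite_fun])

text \<open>The derivative of the product f H_\<gamma> integrates to 0 although f is only bounded,
  because H_\<gamma> and its derivative carry the weight \<open>decay\<close>.\<close>

lemma integral_pder_mult_hermite_fun: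
  assumes f: "smooth f" "\<And>x. cmod (f x) \<le> K" "\<And>x. cmod (pder (unit_mi i) f x) \<le> K"
  shows "integral\<^sup>L lborel (\<lambda>x. pder (unit_mi i) f x * hermite_fun \<gamma> x)
    = - integral\<^sup>L lborel (\<lambda>x. f x * pder (unit_mi i) (hermite_fun \<gamma>) x)"
proof -
  have [measurable]: "pder (unit_mi i) (hermite_fun \<gamma>) \<in> borel_measurable borel" "hermite_fun \<gamma> \<in> borel_measurable borel"
    "f \<in> borel_measurable borel" "pder (unit_mi i) f \<in> borel_measurable borel"
    using borel_measurable_pder borel_measurable_smooth smooth_hermite_fun f(1) by auto
  obtain C where C: "C \<ge> 0" "\<And>x. cmod (pder (unit_mi i) (hermite_fun \<gamma>) x) \<le> C * decay x" using pder_hermite_fun_decay by blast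
  obtain D where D: "D \<ge> 0" "\<And>x. cmod (hermite_fun \<gamma> x) \<le> D * decay x" using hermite_fun_decay by blast
  have K: "K \<ge> 0" using f(2)[of undefined] norm_ge_zero order.trans by blast
  have 0: "integral\<^sup>L lborel (\<lambda>x. f x * pder (unit_mi i) (hermite_fun \<gamma>) x + pder (unit_mi i) f x * hermite_fun \<gamma> x) = 0"
  proof (rule integral_directional_derivative_eq_0[where g = "\<lambda>x. f x * hermite_fun \<gamma> x", OF _ integrable_decay decay_shift])
    fix x
    have "((\<lambda>t. pder 0 f (x + t *\<^sub>R axis i 1) * pder 0 (hermite_fun \<gamma>) (x + t *\<^sub>R axis i 1)) has_vector_derivative
      (pder 0 f (x + 0 *\<^sub>R axis i 1) * pder (0 + unit_mi i) (hermite_fun \<gamma>) x + pder (0 + unit_mi i) f x * pder 0 (hermite_fun \<gamma>) (x + 0 *\<^sub>R axis i 1))) (at 0)"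
      by (intro has_vector_derivative_mult pder_has_vector_derivative f smooth_hermite_fun)
    then show "((\<lambda>t. f (x + t *\<^sub>R axis i 1) * hermite_fun \<gamma> (x + t *\<^sub>R axis i 1)) has_vector_derivative
      f x * pder (unit_mi i) (hermite_fun \<gamma>) x + pder (unit_mi i) f x * hermite_fun \<gamma> x) (at 0)"
      by (simp add: pder_0 f smooth_hermite_fun)
    have "cmod (f x * hermite_fun \<gamma> x) \<le> K * (D * decay x)"
      unfolding norm_mult using f(2) D K by (intro mult_mono) auto
    moreover have 3: "0 \<le> K * C * decay x" "0 \<le> K * D * decay x"
      using K C D decay_pos[of x] by auto
    ultimately show "norm (f x * hermite_fun \<gamma> x) \<le> (K * C + K * D) * decay x"
      by (simp add: algebra_simps)
    have "cmod (f x * pder (unit_mi i) (hermite_fun \<gamma>) x + pder (unit_mi i) f x * hermite_fun \<gamma> x) \<le> K * (C * decay x) + K * (D * decay x)"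
      by (rule order.trans[OF norm_triangle_ineq], unfold norm_mult)
         (use f(2,3) C D K in \<open>intro add_mono mult_mono; auto\<close>)
    then show "norm (f x * pder (unit_mi i) (hermite_fun \<gamma>) x + pder (unit_mi i) f x * hermite_fun \<gamma> x) \<le> (K * C + K * D) * decay x"
      by (simp add: algebra_simps)
  qed (use K C D in auto)
  have i1: "integrable lborel (\<lambda>x. f x * pder (unit_mi i) (hermite_fun \<gamma>) x)"
    by (rule integrable_mult_pder_hermite_fun[OF _ f(2)]) measurable
  have i2: "integrable lborel (\<lambda>x. pder (unit_mi i) f x * hermite_fun \<gamma> x)"
    by (rule integrable_mult_hermite_fun[OF _ f(3)]) measurable
  show ?thesis using 0 i1 i2 by (simp add: eq_neg_iff_add_eq_0 add.commute)
qed

section \<open>Admissible weights\<close>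

text \<open>Two steps of the inequality absorb an integer factor \<sigma>_j, which is what Leibniz'
  rule produces when \<partial>^\<beta> meets x_j. The model case, with equality, is
  sqrt(\<sigma>!).\<close>

definition adm :: "(('n::finite \<Rightarrow> nat) \<Rightarrow> real) \<Rightarrow> bool" where
  "adm G \<longleftrightarrow> (\<forall>\<sigma>. 0 < G \<sigma>) \<and> (\<forall>\<sigma> j. sqrt (real (Suc (\<sigma> j))) * G \<sigma> \<le> G (\<sigma> + unit_mi j))"

lemma adm_pos: "adm G \<Longrightarrow> 0 < G \<sigma>"
  by (simp add: adm_def)

lemma adm_step: "adm G \<Longrightarrow> sqrt (real (Suc (\<sigma> j))) * G \<sigma> \<le> G (\<sigma> + unit_mi j)"
  by (simp add: adm_def)

lemma adm_step_le:
  assumes "adm G" "r \<le> sqrt (real (Suc (\<sigma> j)))"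
  shows "r * G \<sigma> \<le> G (\<sigma> + unit_mi j)"
  using mult_right_mono[OF assms(2), of "G \<sigma>"] adm_pos[OF assms(1), of \<sigma>] adm_step[OF assms(1), of \<sigma> j] by linarith

lemma adm_shift: "adm G \<Longrightarrow> adm (\<lambda>\<sigma>. G (\<sigma> + \<mu>))"
  unfolding adm_def[of "\<lambda>\<sigma>. G (\<sigma> + \<mu>)"]
proof (intro conjI allI)
  fix \<sigma> j assume G: "adm G"
  have "sqrt (real (Suc (\<sigma> j))) * G (\<sigma> + \<mu>) \<le> G (\<sigma> + \<mu> + unit_mi j)"
    by (rule adm_step_le[OF G]) simp
  then show "sqrt (real (Suc (\<sigma> j))) * G (\<sigma> + \<mu>) \<le> G (\<sigma> + unit_mi j + \<mu>)"
    by (simp only: add.assoc add.commute[of \<mu>])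
qed (simp add: adm_pos)

lemma adm_mono:
  fixes \<sigma> \<tau> :: "'n::finite \<Rightarrow> nat"
  assumes "adm G" "\<sigma> \<le> \<tau>"
  shows "G \<sigma> \<le> G \<tau>"
proof -
  have "G \<sigma> \<le> G (\<sigma> + \<delta>)" for \<delta>
  proof (induction \<delta> rule: mi_induct)
    case (step \<beta> i)
    have "1 * G (\<sigma> + \<beta>) \<le> G (\<sigma> + \<beta> + unit_mi i)" by (rule adm_step_le[OF assms(1)]) simp
    then show ?case using step by (simp only: add.assoc mult_1)
  qed simp
  moreover have "\<tau> = \<sigma> + (\<tau> - \<sigma>)" using assms(2) by (auto simp: fun_eq_iff le_fun_def)
  ultimately show ?thesis by metis
qed

lemma adm_step_two:
  assumes "adm G" "\<sigma> j > 0"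
  shows "real (\<sigma> j) * G (\<sigma> - unit_mi j) \<le> G (\<sigma> + unit_mi j)"
proof -
  have 1: "sqrt (real (\<sigma> j)) * G (\<sigma> - unit_mi j) \<le> G (\<sigma> - unit_mi j + unit_mi j)"
    by (rule adm_step_le[OF assms(1)]) (use assms(2) in \<open>simp add: unit_mi_apply\<close>)
  have "real (\<sigma> j) * G (\<sigma> - unit_mi j) = sqrt (real (\<sigma> j)) * (sqrt (real (\<sigma> j)) * G (\<sigma> - unit_mi j))"
    by (simp add: mult.assoc[symmetric])
  also have "\<dots> \<le> sqrt (real (\<sigma> j)) * G \<sigma>"
    using 1 unfolding mi_diff_unit_add[of \<sigma> j, OF assms(2)] by (intro mult_left_mono) auto
  also have "\<dots> \<le> G (\<sigma> + unit_mi j)" by (rule adm_step_le[OF assms(1)]) simp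
  finally show ?thesis .
qed

text \<open>The half power \<gamma>^(\<beta>/2), that is, the monomial \<open>xpow\<close> at the
  point \<gamma>^(1/2) where the sequence norms evaluate the associated weight.\<close>

definition hpow :: "('n::finite \<Rightarrow> nat) \<Rightarrow> ('n \<Rightarrow> nat) \<Rightarrow> real" where
  "hpow \<gamma> \<beta> = (\<Prod>j\<in>UNIV. sqrt (real (\<gamma> j)) ^ \<beta> j)"

lemma hpow_nonneg: "0 \<le> hpow \<gamma> \<beta>"
  unfolding hpow_def by (intro prod_nonneg) auto

lemma hpow_0 [simp]: "hpow \<gamma> 0 = 1"
  by (simp add: hpow_def)

lemma prod_fun_upd_unit:
  fixes f :: "'n::finite \<Rightarrow> nat \<Rightarrow> 'a::comm_monoid_mult"
  assumes "f i (Suc (\<beta> i)) = r * f i (\<beta> i)"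
  shows "(\<Prod>j\<in>UNIV. f j ((\<beta> + unit_mi i) j)) = r * (\<Prod>j\<in>UNIV. f j (\<beta> j))"
proof -
  have 1: "(\<Prod>j\<in>UNIV. f j (\<delta> j)) = f i (\<delta> i) * (\<Prod>j\<in>UNIV - {i}. f j (\<delta> j))" for \<delta>
    by (rule prod.remove) auto
  have 2: "(\<Prod>j\<in>UNIV - {i}. f j ((\<beta> + unit_mi i) j)) = (\<Prod>j\<in>UNIV - {i}. f j (\<beta> j))"
    by (rule prod.cong) (auto simp: unit_mi_apply)
  show ?thesis unfolding 1 2 using assms by (simp add: unit_mi_apply mult.assoc)
qed

lemma hpow_add_unit: "hpow \<gamma> (\<beta> + unit_mi i) = sqrt (real (\<gamma> i)) * hpow \<gamma> \<beta>"
  unfolding hpow_def by (rule prod_fun_upd_unit[where f = "\<lambda>j. (^) (sqrt (real (\<gamma> j)))"]) simp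

lemma xpow_add_unit: "xpow x (\<alpha> + unit_mi i) = x $ i * xpow x \<alpha>"
  unfolding xpow_def by (rule prod_fun_upd_unit[where f = "\<lambda>j. (^) (x $ j)"]) simp

lemma xpow_0 [simp]: "xpow x 0 = 1"
  by (simp add: xpow_def)

text \<open>This majorant of \<open>w\<close> is admissible because each term at \<open>\<sigma>\<close> reappears, with \<open>\<delta>\<close> raised by one, at
  \<open>\<sigma> + unit_mi j\<close>, and the binomial coefficients supply the factor that the half powers lack.\<close>
definition adm_hull :: "(('n::finite \<Rightarrow> nat) \<Rightarrow> real) \<Rightarrow> ('n \<Rightarrow> nat) \<Rightarrow> real" where
  "adm_hull w \<sigma> = (\<Sum>\<delta>\<in>{..\<sigma>}. (\<Prod>j\<in>UNIV. real (\<sigma> j choose \<delta> j) * sqrt (real (\<delta> j)) ^ \<delta> j) * w (\<sigma> - \<delta>))"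

lemma atMost_mi_eq_PiE: "{..\<sigma>} = PiE UNIV (\<lambda>j. {..\<sigma> j :: nat})"
  by (auto simp: le_fun_def PiE_def Pi_def)

lemma finite_atMost_mi: "finite {..\<sigma> :: 'n::finite \<Rightarrow> nat}"
  unfolding atMost_mi_eq_PiE by (intro finite_PiE) auto

lemma adm_hull_ge:
  assumes "\<And>\<sigma>. 0 < w \<sigma>"
  shows "w \<sigma> \<le> adm_hull w \<sigma>"
proof -
  have "(\<Prod>j\<in>UNIV. real (\<sigma> j choose (0 :: _ \<Rightarrow> nat) j) * sqrt (real ((0 :: _ \<Rightarrow> nat) j)) ^ (0 :: _ \<Rightarrow> nat) j) * w (\<sigma> - 0) \<le> adm_hull w \<sigma>"
    unfolding adm_hull_def using assms less_imp_le
    by (intro member_le_sum finite_atMost_mi mult_nonneg_nonneg prod_nonneg) (auto simp: le_fun_def less_imp_le)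
  moreover have "\<sigma> - 0 = \<sigma>" by (auto simp: fun_eq_iff)
  ultimately show ?thesis by simp
qed

text \<open>Write s^2 = k + 1 and t^2 = n + 1. The identity (k + 1) C(n+1, k+1) = (n + 1) C(n, k)
  turns the right side into (t^2/s) C(n, k) s^k. Since k \<le> n gives s \<le> t, the factor t^2/s
  is at least t, and s^k exceeds the half power on the left.\<close>

lemma binomial_half_power_step:
  assumes "k \<le> n"
  shows "sqrt (real (Suc n)) * (real (n choose k) * sqrt (real k) ^ k) \<le> real (Suc n choose Suc k) * sqrt (real (Suc k)) ^ Suc k"
proof -
  define s where "s = sqrt (real (Suc k))"
  define t where "t = sqrt (real (Suc n))"
  have st: "0 < s" "s \<le> t" using assms by (auto simp: s_def t_def)
  have ss: "real (Suc k) = s * s" and tt: "real (Suc n) = t * t" by (simp_all add: s_def t_def)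
  have "Suc k * (Suc n choose Suc k) = Suc n * (n choose k)" by (rule Suc_times_binomial)
  then have "real (Suc k) * real (Suc n choose Suc k) = real (Suc n) * real (n choose k)" by (metis of_nat_mult)
  then have e: "s * s * real (Suc n choose Suc k) = t * t * real (n choose k)" unfolding ss tt .
  have "s * (t * real (n choose k)) \<le> t * (t * real (n choose k))" using st by (intro mult_right_mono) auto
  also have "\<dots> = s * (s * real (Suc n choose Suc k))" using e by (simp add: algebra_simps)
  finally have 1: "t * real (n choose k) \<le> s * real (Suc n choose Suc k)" using st by simp
  have "sqrt (real k) ^ k \<le> s ^ k" unfolding s_def by (intro power_mono) auto
  then have "(t * real (n choose k)) * sqrt (real k) ^ k \<le> (s * real (Suc n choose Suc k)) * s ^ k"
    by (rule mult_mono[OF 1]) (use st in auto)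
  then show ?thesis unfolding s_def[symmetric] t_def[symmetric] by (simp add: algebra_simps)
qed

lemma adm_adm_hull:
  fixes w :: "('n::finite \<Rightarrow> nat) \<Rightarrow> real"
  assumes w: "\<And>\<sigma>. 0 < w \<sigma>"
  shows "adm (adm_hull w)"
  unfolding adm_def
proof (intro conjI allI)
  fix \<sigma> :: "'n \<Rightarrow> nat" and i :: 'n
  show "0 < adm_hull w \<sigma>" using adm_hull_ge[of w \<sigma>] w by (meson less_le_trans)
  define c where "c \<sigma> \<delta> = (\<Prod>j\<in>UNIV. real (\<sigma> j choose \<delta> j) * sqrt (real (\<delta> j)) ^ \<delta> j)" for \<sigma> \<delta> :: "'n \<Rightarrow> nat"
  have cs: "c \<sigma> \<delta> = (real (\<sigma> i choose \<delta> i) * sqrt (real (\<delta> i)) ^ \<delta> i) * (\<Prod>j\<in>UNIV - {i}. real (\<sigma> j choose \<delta> j) * sqrt (real (\<delta> j)) ^ \<delta> j)" for \<sigma> \<delta>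
    unfolding c_def by (rule prod.remove) auto
  have c0: "0 \<le> c \<sigma> \<delta>" for \<sigma> \<delta> unfolding c_def by (intro prod_nonneg) auto
  have step: "sqrt (real (Suc (\<sigma> i))) * c \<sigma> \<delta> \<le> c (\<sigma> + unit_mi i) (\<delta> + unit_mi i)" if "\<delta> \<le> \<sigma>" for \<delta>
  proof -
    have 1: "(\<Prod>j\<in>UNIV - {i}. real ((\<sigma> + unit_mi i) j choose (\<delta> + unit_mi i) j) * sqrt (real ((\<delta> + unit_mi i) j)) ^ (\<delta> + unit_mi i) j)
       = (\<Prod>j\<in>UNIV - {i}. real (\<sigma> j choose \<delta> j) * sqrt (real (\<delta> j)) ^ \<delta> j)" (is "_ = ?R")
      by (rule prod.cong) (auto simp: unit_mi_apply)
    have 2: "(\<sigma> + unit_mi i) i = Suc (\<sigma> i)" "(\<delta> + unit_mi i) i = Suc (\<delta> i)" by (auto simp: unit_mi_apply)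
    have "\<delta> i \<le> \<sigma> i" using that by (simp add: le_fun_def)
    moreover have "0 \<le> ?R" by (intro prod_nonneg) auto
    ultimately show ?thesis
      unfolding cs 1 2 mult.assoc[symmetric]
      by (intro mult_right_mono) (use binomial_half_power_step in \<open>simp_all add: mult.assoc\<close>)
  qed
  have "sqrt (real (Suc (\<sigma> i))) * adm_hull w \<sigma> = (\<Sum>\<delta>\<in>{..\<sigma>}. sqrt (real (Suc (\<sigma> i))) * c \<sigma> \<delta> * w (\<sigma> - \<delta>))"
    unfolding adm_hull_def c_def[symmetric] by (simp only: sum_distrib_left mult.assoc)
  also have "\<dots> \<le> (\<Sum>\<delta>\<in>{..\<sigma>}. c (\<sigma> + unit_mi i) (\<delta> + unit_mi i) * w (\<sigma> - \<delta>))"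
    using w step by (intro sum_mono mult_right_mono) (auto simp: less_imp_le)
  also have "\<dots> = (\<Sum>\<delta>\<in>(\<lambda>\<delta>. \<delta> + unit_mi i) ` {..\<sigma>}. c (\<sigma> + unit_mi i) \<delta> * w (\<sigma> + unit_mi i - \<delta>))"
  proof -
    have "\<sigma> + unit_mi i - (\<delta> + unit_mi i) = \<sigma> - \<delta>" for \<delta> by (auto simp: fun_eq_iff)
    then show ?thesis by (subst sum.reindex) (auto simp: inj_on_def simp del: plus_fun_apply)
  qed
  also have "\<dots> \<le> adm_hull w (\<sigma> + unit_mi i)"
    unfolding adm_hull_def c_def[symmetric] using w c0 
    by (intro sum_mono2 finite_atMost_mi) (auto simp: le_fun_def less_imp_le)
  finally show "sqrt (real (Suc (\<sigma> i))) * adm_hull w \<sigma> \<le> adm_hull w (\<sigma> + unit_mi i)" .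
qed

text \<open>The mixed condition bounds the summand belonging to the splitting \<sigma> = \<delta> +
  (\<sigma> - \<delta>) by a term of the binomial expansion of (C + h)^|\<sigma>|, times a factor
  that depends on \<sigma> alone. Passing to the hull therefore costs only a geometric
  factor.\<close>

lemma adm_hull_le:
  fixes w w' :: "('n::finite \<Rightarrow> nat) \<Rightarrow> real"
  assumes "\<And>\<alpha> \<beta>. mhalfpow \<alpha> * w \<beta> \<le> B * C ^ msize \<alpha> * H ^ msize (\<alpha> + \<beta>) * w' (\<alpha> + \<beta>)" and h: "h > 0"
  shows "adm_hull (\<lambda>\<sigma>. h ^ msize \<sigma> * w \<sigma>) \<sigma> \<le> B * (H * (C + h)) ^ msize \<sigma> * w' \<sigma>"
proof -
  have "adm_hull (\<lambda>\<sigma>. h ^ msize \<sigma> * w \<sigma>) \<sigma>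
     \<le> (\<Sum>\<delta>\<in>{..\<sigma>}. (\<Prod>j\<in>UNIV. real (\<sigma> j choose \<delta> j) * C ^ \<delta> j * h ^ (\<sigma> j - \<delta> j)) * (B * H ^ msize \<sigma> * w' \<sigma>))"
    unfolding adm_hull_def
  proof (rule sum_mono)
    fix \<delta> assume d: "\<delta> \<in> {..\<sigma>}"
    have e: "\<delta> + (\<sigma> - \<delta>) = \<sigma>" using d by (auto simp: fun_eq_iff le_fun_def)
    have "(\<Prod>j\<in>UNIV. real (\<sigma> j choose \<delta> j) * sqrt (real (\<delta> j)) ^ \<delta> j) * (h ^ msize (\<sigma> - \<delta>) * w (\<sigma> - \<delta>))
      = (\<Prod>j\<in>UNIV. real (\<sigma> j choose \<delta> j)) * h ^ msize (\<sigma> - \<delta>) * (mhalfpow \<delta> * w (\<sigma> - \<delta>))"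
      by (simp add: prod.distrib mhalfpow_def)
    also have "\<dots> \<le> (\<Prod>j\<in>UNIV. real (\<sigma> j choose \<delta> j)) * h ^ msize (\<sigma> - \<delta>) * (B * C ^ msize \<delta> * H ^ msize \<sigma> * w' \<sigma>)"
      using assms(1)[of \<delta> "\<sigma> - \<delta>"] h unfolding e by (intro mult_left_mono mult_nonneg_nonneg prod_nonneg) auto
    also have "\<dots> = (\<Prod>j\<in>UNIV. real (\<sigma> j choose \<delta> j) * C ^ \<delta> j * h ^ (\<sigma> j - \<delta> j)) * (B * H ^ msize \<sigma> * w' \<sigma>)"
      by (simp add: prod.distrib msize_def power_sum)
    finally show "(\<Prod>j\<in>UNIV. real (\<sigma> j choose \<delta> j) * sqrt (real (\<delta> j)) ^ \<delta> j) * (h ^ msize (\<sigma> - \<delta>) * w (\<sigma> - \<delta>))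
      \<le> (\<Prod>j\<in>UNIV. real (\<sigma> j choose \<delta> j) * C ^ \<delta> j * h ^ (\<sigma> j - \<delta> j)) * (B * H ^ msize \<sigma> * w' \<sigma>)" .
  qed
  also have "\<dots> = (\<Prod>j\<in>UNIV. \<Sum>k\<in>{..\<sigma> j}. real (\<sigma> j choose k) * C ^ k * h ^ (\<sigma> j - k)) * (B * H ^ msize \<sigma> * w' \<sigma>)"
    unfolding atMost_mi_eq_PiE sum_distrib_right[symmetric] by (subst prod_sum_PiE) auto
  also have "\<dots> = (C + h) ^ msize \<sigma> * (B * H ^ msize \<sigma> * w' \<sigma>)"
    by (simp add: binomial_ring[symmetric] msize_def power_sum)
  also have "\<dots> = B * (H * (C + h)) ^ msize \<sigma> * w' \<sigma>" by (simp add: power_mult_distrib)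
  finally show ?thesis .
qed

section \<open>Coefficients of functions with controlled derivatives\<close>

text \<open>The real-valued form of a bound on \<open>gs_norm\<close>: the constant, the powers of h
  and the sequence are merged into one weight, so the estimates can be run for admissible weights
  that do not come from the matrix.\<close>

definition gs_le :: "(real^'n::finite \<Rightarrow> complex) \<Rightarrow> (('n \<Rightarrow> nat) \<Rightarrow> real) \<Rightarrow> bool" where
  "gs_le f w \<longleftrightarrow> smooth f \<and> (\<forall>\<alpha> \<beta> x. cmod (complex_of_real (xpow x \<alpha>) * pder \<beta> f x) \<le> w (\<alpha> + \<beta>))"

lemma gs_leD: "gs_le f w \<Longrightarrow> cmod (complex_of_real (xpow x \<alpha>) * pder \<beta> f x) \<le> w (\<alpha> + \<beta>)"
  by (simp add: gs_le_def)

lemma gs_le_smooth: "gs_le f w \<Longrightarrow> smooth f"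
  by (simp add: gs_le_def)

lemma gs_le_pder_bound: "gs_le f w \<Longrightarrow> cmod (pder \<beta> f x) \<le> w \<beta>"
  using gs_leD[of f w x 0 \<beta>] by simp

lemma gs_le_bound: "gs_le f w \<Longrightarrow> cmod (f x) \<le> w 0"
  using gs_le_pder_bound[of f w 0 x] by (simp add: pder_0 gs_le_smooth)

lemma gs_le_mult_bound: "gs_le f w \<Longrightarrow> cmod (complex_of_real (xpow x \<alpha>) * f x) \<le> w \<alpha>"
  using gs_leD[of f w x \<alpha> 0] by (simp add: pder_0 gs_le_smooth)

lemma gs_le_nonneg: "gs_le f w \<Longrightarrow> 0 \<le> w \<sigma>"
  using gs_le_pder_bound norm_ge_zero order.trans by blast

text \<open>Up to normalisation s = 1 is the annihilation operator and s = -1 the creation operator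
  in the variable j.\<close>

definition ladder :: "complex \<Rightarrow> 'n \<Rightarrow> (real^'n::finite \<Rightarrow> complex) \<Rightarrow> real^'n \<Rightarrow> complex" where
  "ladder s j f = (\<lambda>x. complex_of_real (x $ j) * f x + s * pder (unit_mi j) f x)"

lemma ladder_eq: "ladder s j f = (\<lambda>x. 1 * (complex_of_real (x $ j) * f x) + s * pder (unit_mi j) f x)"
  by (simp add: ladder_def)

text \<open>The factor 3 counts the terms after Leibniz' rule: x_j \<partial>^\<beta> f, the
  commutator term \<beta>_j \<partial>^(\<beta> - e_j) f and the extra derivative. Admissibility
  absorbs the factor \<beta>_j of the second by two unit steps, so all three are bounded at \<alpha>
  + \<beta> + e_j.\<close>

lemma gs_le_ladder:
  assumes G: "adm G" and f: "gs_le f (\<lambda>\<sigma>. K * G \<sigma>)" and s: "cmod s = 1"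
  shows "gs_le (ladder s j f) (\<lambda>\<sigma>. 3 * K * G (\<sigma> + unit_mi j))"
  unfolding gs_le_def
proof (intro conjI allI)
  have sm: "smooth f" by (rule gs_le_smooth[OF f])
  have K: "K \<ge> 0" using gs_le_nonneg[OF f, of 0] adm_pos[OF G, of 0] by (simp add: zero_le_mult_iff)
  show "smooth (ladder s j f)"
    unfolding ladder_eq by (intro smooth_lincomb smooth_mult_coord smooth_pder sm)
  fix \<alpha> \<beta> :: "'a \<Rightarrow> nat" and x
  have D: "pder \<beta> (ladder s j f) x = (complex_of_real (x $ j) * pder \<beta> f x + of_nat (\<beta> j) * pder (\<beta> - unit_mi j) f x) + s * pder (unit_mi j + \<beta>) f x"
    unfolding ladder_eq pder_lincomb[OF smooth_mult_coord[OF sm] smooth_pder[OF sm]] pder_mult_coord[OF sm] pder_pder[OF sm]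
    by simp
  have 1: "cmod (complex_of_real (xpow x \<alpha>) * (complex_of_real (x $ j) * pder \<beta> f x)) \<le> K * G (\<alpha> + \<beta> + unit_mi j)"
  proof -
    have "\<alpha> + unit_mi j + \<beta> = \<alpha> + \<beta> + unit_mi j" by (simp only: add.assoc add.commute[of "unit_mi j"])
    then show ?thesis using gs_leD[OF f, of x "\<alpha> + unit_mi j" \<beta>] by (simp add: xpow_add_unit mult_ac)
  qed
  have 2: "cmod (complex_of_real (xpow x \<alpha>) * (of_nat (\<beta> j) * pder (\<beta> - unit_mi j) f x)) \<le> K * G (\<alpha> + \<beta> + unit_mi j)"
  proof (cases "\<beta> j > 0")
    case True
    then have e: "\<alpha> + (\<beta> - unit_mi j) = \<alpha> + \<beta> - unit_mi j" by (auto simp: fun_eq_iff unit_mi_apply)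
    have "cmod (complex_of_real (xpow x \<alpha>) * (of_nat (\<beta> j) * pder (\<beta> - unit_mi j) f x))
       = real (\<beta> j) * cmod (complex_of_real (xpow x \<alpha>) * pder (\<beta> - unit_mi j) f x)"
      by (simp add: norm_mult)
    also have "\<dots> \<le> real ((\<alpha> + \<beta>) j) * (K * G (\<alpha> + \<beta> - unit_mi j))"
      using gs_leD[OF f, of x \<alpha> "\<beta> - unit_mi j"] unfolding e by (intro mult_mono) auto
    also have "\<dots> = K * (real ((\<alpha> + \<beta>) j) * G (\<alpha> + \<beta> - unit_mi j))" by simp
    also have "\<dots> \<le> K * G (\<alpha> + \<beta> + unit_mi j)"
      using True K by (intro mult_left_mono adm_step_two[OF G]) auto
    finally show ?thesis .
  next
    case False
    then show ?thesis using gs_le_nonneg[OF f, of "\<alpha> + \<beta> + unit_mi j"] by simp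
  qed
  have 3: "cmod (complex_of_real (xpow x \<alpha>) * (s * pder (unit_mi j + \<beta>) f x)) \<le> K * G (\<alpha> + \<beta> + unit_mi j)"
    using gs_leD[OF f, of x \<alpha> "unit_mi j + \<beta>"] s by (simp add: norm_mult add.commute add.left_commute)
  have "cmod (complex_of_real (xpow x \<alpha>) * pder \<beta> (ladder s j f) x)
     \<le> cmod (complex_of_real (xpow x \<alpha>) * (complex_of_real (x $ j) * pder \<beta> f x))
      + cmod (complex_of_real (xpow x \<alpha>) * (of_nat (\<beta> j) * pder (\<beta> - unit_mi j) f x))
      + cmod (complex_of_real (xpow x \<alpha>) * (s * pder (unit_mi j + \<beta>) f x))"
    unfolding D distrib_left by (intro order.trans[OF norm_triangle_ineq] add_mono norm_triangle_ineq) auto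
  also have "\<dots> \<le> 3 * K * G (\<alpha> + \<beta> + unit_mi j)" using 1 2 3 by simp
  finally show "cmod (complex_of_real (xpow x \<alpha>) * pder \<beta> (ladder s j f) x) \<le> 3 * K * G (\<alpha> + \<beta> + unit_mi j)" .
qed

lemma hermite_fun_ladder:
  "complex_of_real (x $ i) * hermite_fun \<gamma> x + pder (unit_mi i) (hermite_fun \<gamma>) x
     = complex_of_real (sqrt (2 * real (\<gamma> i))) * hermite_fun (\<gamma> - unit_mi i) x"
  "complex_of_real (x $ i) * hermite_fun \<gamma> x - pder (unit_mi i) (hermite_fun \<gamma>) x
     = complex_of_real (sqrt (2 * real (Suc (\<gamma> i)))) * hermite_fun (\<gamma> + unit_mi i) x"
proof -
  define R where "R = (\<Prod>j\<in>UNIV - {i}. herm (\<gamma> j) (x $ j))"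
  have H: "hermite_fun \<delta> x = complex_of_real (herm (\<delta> i) (x $ i) * R)" if "\<And>j. j \<noteq> i \<Longrightarrow> \<delta> j = \<gamma> j" for \<delta>
    unfolding hermite_fun_eq R_def by (subst prod.remove[of _ i]) (auto simp: that intro!: prod.cong)
  have D: "pder (unit_mi i) (hermite_fun \<gamma>) x = complex_of_real (dherm 1 (\<gamma> i) (x $ i) * R)"
    unfolding pder_hermite_fun R_def
    by (subst prod.remove[of _ i]) (auto simp: unit_mi_apply intro!: prod.cong)
  have h: "(herm (\<gamma> i) has_real_derivative dherm 1 (\<gamma> i) (x $ i)) (at (x $ i))"
    using herm_has_derivative by simp
  have "complex_of_real (x $ i) * hermite_fun \<gamma> x + pder (unit_mi i) (hermite_fun \<gamma>) x
     = complex_of_real ((x $ i * herm (\<gamma> i) (x $ i) + dherm 1 (\<gamma> i) (x $ i)) * R)"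
    unfolding D by (subst H) (auto simp: algebra_simps)
  also have "\<dots> = complex_of_real (sqrt (2 * real (\<gamma> i))) * hermite_fun (\<gamma> - unit_mi i) x"
    unfolding herm_lowering(1)[OF h] by (subst H) (auto simp: unit_mi_apply)
  finally show "complex_of_real (x $ i) * hermite_fun \<gamma> x + pder (unit_mi i) (hermite_fun \<gamma>) x
     = complex_of_real (sqrt (2 * real (\<gamma> i))) * hermite_fun (\<gamma> - unit_mi i) x" .
  have "complex_of_real (x $ i) * hermite_fun \<gamma> x - pder (unit_mi i) (hermite_fun \<gamma>) x
     = complex_of_real ((x $ i * herm (\<gamma> i) (x $ i) - dherm 1 (\<gamma> i) (x $ i)) * R)"
    unfolding D by (subst H) (auto simp: algebra_simps)
  also have "\<dots> = complex_of_real (sqrt (2 * real (Suc (\<gamma> i)))) * hermite_fun (\<gamma> + unit_mi i) x"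
    unfolding herm_lowering(2)[OF h] by (subst H) (auto simp: unit_mi_apply)
  finally show "complex_of_real (x $ i) * hermite_fun \<gamma> x - pder (unit_mi i) (hermite_fun \<gamma>) x
     = complex_of_real (sqrt (2 * real (Suc (\<gamma> i)))) * hermite_fun (\<gamma> + unit_mi i) x" .
qed

text \<open>Integration by parts moves the operator onto the Hermite function and reverses the sign
  of s. Hence annihilation applied to f raises the index of the coefficient, and creation lowers
  it.\<close>

lemma hermite_coeff_ladder:
  assumes f: "gs_le f w"
  shows "hermite_coeff \<gamma> (ladder 1 i f) = complex_of_real (sqrt (2 * real (Suc (\<gamma> i)))) * hermite_coeff (\<gamma> + unit_mi i) f"
    and "hermite_coeff \<gamma> (ladder (- 1) i f) = complex_of_real (sqrt (2 * real (\<gamma> i))) * hermite_coeff (\<gamma> - unit_mi i) f"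
proof -
  have sm: "smooth f" by (rule gs_le_smooth[OF f])
  note meas = borel_measurable_smooth[OF sm] borel_measurable_pder[OF sm]
  define K where "K = w 0 + w (unit_mi i)"
  have K: "cmod (f x) \<le> K" "cmod (pder (unit_mi i) f x) \<le> K" for x
    using gs_le_bound[OF f, of x] gs_le_pder_bound[OF f, of "unit_mi i" x] gs_le_nonneg[OF f, of 0] gs_le_nonneg[OF f, of "unit_mi i"]
    by (auto simp: K_def)
  have i1: "integrable lborel (\<lambda>x. f x * hermite_fun \<delta> x)" for \<delta>
    by (rule integrable_mult_hermite_fun[OF meas(1) K(1)])
  have i2: "integrable lborel (\<lambda>x. pder (unit_mi i) f x * hermite_fun \<gamma> x)"
    by (rule integrable_mult_hermite_fun[OF meas(2) K(2)])
  have i3: "integrable lborel (\<lambda>x. f x * pder (unit_mi i) (hermite_fun \<gamma>) x)"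
    by (rule integrable_mult_pder_hermite_fun[OF meas(1) K(1)])
  have i4: "integrable lborel (\<lambda>x. complex_of_real (x $ i) * f x * hermite_fun \<gamma> x)"
  proof (rule integrable_mult_hermite_fun)
    show "cmod (complex_of_real (x $ i) * f x) \<le> w (unit_mi i)" for x
      using gs_le_mult_bound[OF f, of x "0 + unit_mi i"] unfolding xpow_add_unit by simp
    show "(\<lambda>x. complex_of_real (x $ i) * f x) \<in> borel_measurable borel"
      by (rule borel_measurable_smooth[OF smooth_mult_coord[OF sm]])
  qed
  have ibp: "integral\<^sup>L lborel (\<lambda>x. pder (unit_mi i) f x * hermite_fun \<gamma> x)
    = - integral\<^sup>L lborel (\<lambda>x. f x * pder (unit_mi i) (hermite_fun \<gamma>) x)"
    by (rule integral_pder_mult_hermite_fun[OF sm K])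
  have "hermite_coeff \<gamma> (ladder s i f) = integral\<^sup>L lborel (\<lambda>x. complex_of_real (x $ i) * f x * hermite_fun \<gamma> x)
      + s * integral\<^sup>L lborel (\<lambda>x. pder (unit_mi i) f x * hermite_fun \<gamma> x)" for s
    unfolding hermite_coeff_def ladder_def using i2 i4 by (simp add: distrib_right mult.assoc)
  then have L: "hermite_coeff \<gamma> (ladder s i f) = integral\<^sup>L lborel (\<lambda>x. complex_of_real (x $ i) * f x * hermite_fun \<gamma> x
      - s * (f x * pder (unit_mi i) (hermite_fun \<gamma>) x))" for s
    unfolding ibp using i3 i4 by simp
  have "hermite_coeff \<gamma> (ladder 1 i f) = integral\<^sup>L lborel (\<lambda>x. complex_of_real (sqrt (2 * real (Suc (\<gamma> i)))) * (f x * hermite_fun (\<gamma> + unit_mi i) x))"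
    unfolding L
  proof (rule Bochner_Integration.integral_cong)
    fix x
    have "complex_of_real (x $ i) * f x * hermite_fun \<gamma> x - 1 * (f x * pder (unit_mi i) (hermite_fun \<gamma>) x)
       = f x * (complex_of_real (x $ i) * hermite_fun \<gamma> x - pder (unit_mi i) (hermite_fun \<gamma>) x)"
      by (simp add: algebra_simps)
    then show "complex_of_real (x $ i) * f x * hermite_fun \<gamma> x - 1 * (f x * pder (unit_mi i) (hermite_fun \<gamma>) x)
       = complex_of_real (sqrt (2 * real (Suc (\<gamma> i)))) * (f x * hermite_fun (\<gamma> + unit_mi i) x)"
      unfolding hermite_fun_ladder by (simp only: mult.left_commute)
  qed simp
  then show "hermite_coeff \<gamma> (ladder 1 i f) = complex_of_real (sqrt (2 * real (Suc (\<gamma> i)))) * hermite_coeff (\<gamma> + unit_mi i) f"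
    unfolding hermite_coeff_def by (simp only: integral_mult_right_zero)
  have "hermite_coeff \<gamma> (ladder (- 1) i f) = integral\<^sup>L lborel (\<lambda>x. complex_of_real (sqrt (2 * real (\<gamma> i))) * (f x * hermite_fun (\<gamma> - unit_mi i) x))"
    unfolding L
  proof (rule Bochner_Integration.integral_cong)
    fix x
    have "complex_of_real (x $ i) * f x * hermite_fun \<gamma> x - (- 1) * (f x * pder (unit_mi i) (hermite_fun \<gamma>) x)
       = f x * (complex_of_real (x $ i) * hermite_fun \<gamma> x + pder (unit_mi i) (hermite_fun \<gamma>) x)"
      by (simp add: algebra_simps)
    then show "complex_of_real (x $ i) * f x * hermite_fun \<gamma> x - (- 1) * (f x * pder (unit_mi i) (hermite_fun \<gamma>) x)
       = complex_of_real (sqrt (2 * real (\<gamma> i))) * (f x * hermite_fun (\<gamma> - unit_mi i) x)"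
      unfolding hermite_fun_ladder by (simp only: mult.left_commute)
  qed simp
  then show "hermite_coeff \<gamma> (ladder (- 1) i f) = complex_of_real (sqrt (2 * real (\<gamma> i))) * hermite_coeff (\<gamma> - unit_mi i) f"
    unfolding hermite_coeff_def by (simp only: integral_mult_right_zero)
qed

lemma hermite_coeff_number:
  assumes G: "adm G" and f: "gs_le f (\<lambda>\<sigma>. K * G \<sigma>)"
  shows "hermite_coeff \<gamma> (ladder (- 1) i (ladder 1 i f)) = of_real (2 * real (\<gamma> i)) * hermite_coeff \<gamma> f"
proof -
  have "hermite_coeff \<gamma> (ladder (- 1) i (ladder 1 i f)) =
      complex_of_real (sqrt (2 * real (\<gamma> i))) * (complex_of_real (sqrt (2 * real (Suc ((\<gamma> - unit_mi i) i)))) * hermite_coeff (\<gamma> - unit_mi i + unit_mi i) f)"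
    unfolding hermite_coeff_ladder(2)[OF gs_le_ladder[OF G f norm_one]] hermite_coeff_ladder(1)[OF f] ..
  also have "\<dots> = of_real (2 * real (\<gamma> i)) * hermite_coeff \<gamma> f"
  proof (cases "\<gamma> i > 0")
    case True
    then have "Suc ((\<gamma> - unit_mi i) i) = \<gamma> i" by (simp add: unit_mi_apply)
    then show ?thesis unfolding mi_diff_unit_add[of \<gamma> i, OF True]
      by (simp only: mult.assoc[symmetric] of_real_mult[symmetric]) simp
  qed simp
  finally show ?thesis .
qed

text \<open>Each number operator is a pair of ladder operators, whence 9 = 3 * 3 and a shift by two
  units. A shifted admissible weight is again admissible, so the estimate can be iterated.\<close>

lemma gs_le_number_power:
  assumes G: "adm G" and f: "gs_le f (\<lambda>\<sigma>. K * G \<sigma>)"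
  shows "\<exists>g. gs_le g (\<lambda>\<sigma>. 9 ^ msize m * K * G (\<sigma> + (m + m))) \<and>
     (\<forall>\<gamma>. hermite_coeff \<gamma> g = of_real (\<Prod>j\<in>UNIV. (2 * real (\<gamma> j)) ^ m j) * hermite_coeff \<gamma> f)"
proof (induction m rule: mi_induct)
  case zero
  show ?case using f by (intro exI[of _ f]) (simp add: zero_fun_def[symmetric])
next
  case (step m i)
  then obtain g where g: "gs_le g (\<lambda>\<sigma>. 9 ^ msize m * K * G (\<sigma> + (m + m)))"
    and c: "\<And>\<gamma>. hermite_coeff \<gamma> g = of_real (\<Prod>j\<in>UNIV. (2 * real (\<gamma> j)) ^ m j) * hermite_coeff \<gamma> f" by blast
  define G' where "G' \<sigma> = G (\<sigma> + (m + m))" for \<sigma>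
  have G': "adm G'" unfolding G'_def[abs_def] by (rule adm_shift[OF G])
  have g': "gs_le g (\<lambda>\<sigma>. (9 ^ msize m * K) * G' \<sigma>)" using g unfolding G'_def .
  define h where "h = ladder (- 1) i (ladder 1 i g)"
  have "gs_le h (\<lambda>\<sigma>. 3 * (3 * (9 ^ msize m * K)) * G' (\<sigma> + unit_mi i + unit_mi i))"
    unfolding h_def by (intro gs_le_ladder[OF adm_shift[OF G']] gs_le_ladder[OF G' g']) auto
  moreover have "3 * (3 * (9 ^ msize m * K)) * G' (\<sigma> + unit_mi i + unit_mi i)
      = 9 ^ msize (m + unit_mi i) * K * G (\<sigma> + (m + unit_mi i + (m + unit_mi i)))" for \<sigma>
  proof -
    have "\<sigma> + unit_mi i + unit_mi i + (m + m) = \<sigma> + (m + unit_mi i + (m + unit_mi i))" by (simp only: ac_simps)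
    then show ?thesis unfolding G'_def by (simp only: msize_add msize_unit_mi) simp
  qed
  ultimately have "gs_le h (\<lambda>\<sigma>. 9 ^ msize (m + unit_mi i) * K * G (\<sigma> + (m + unit_mi i + (m + unit_mi i))))" by (simp only:)
  moreover have "hermite_coeff \<gamma> h = of_real (\<Prod>j\<in>UNIV. (2 * real (\<gamma> j)) ^ (m + unit_mi i) j) * hermite_coeff \<gamma> f" for \<gamma>
  proof -
    have "(\<Prod>j\<in>UNIV. (2 * real (\<gamma> j)) ^ (m + unit_mi i) j) = 2 * real (\<gamma> i) * (\<Prod>j\<in>UNIV. (2 * real (\<gamma> j)) ^ m j)"
      by (rule prod_fun_upd_unit[where f = "\<lambda>j. (^) (2 * real (\<gamma> j))"]) simp
    then show ?thesis
      unfolding h_def hermite_coeff_number[OF G' g'] c by (simp only: of_real_mult mult.assoc)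
  qed
  ultimately show ?case by blast
qed

lemma hermite_fun_square_integral:
  "integrable lborel (\<lambda>x. (cmod (hermite_fun \<gamma> x))\<^sup>2)" "integral\<^sup>L lborel (\<lambda>x. (cmod (hermite_fun \<gamma> x))\<^sup>2) = 1"
proof -
  have e: "(\<lambda>x. (cmod (hermite_fun \<gamma> x))\<^sup>2) = (\<lambda>x. \<Prod>j\<in>UNIV. herm (\<gamma> j) (x $ j) * herm (\<gamma> j) (x $ j))"
    unfolding hermite_fun_eq norm_of_real power2_abs by (simp only: power2_eq_square prod.distrib)
  show "integrable lborel (\<lambda>x. (cmod (hermite_fun \<gamma> x))\<^sup>2)"
    unfolding e by (rule integrable_prod_cart(1)[OF integrable_herm_mult])
  show "integral\<^sup>L lborel (\<lambda>x. (cmod (hermite_fun \<gamma> x))\<^sup>2) = 1"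
    unfolding e integrable_prod_cart(2)[OF integrable_herm_mult] by (simp add: herm_orthonormal)
qed

lemma hermite_coeff_hermite_fun: "hermite_coeff \<delta> (hermite_fun \<gamma>) = (if \<gamma> = \<delta> then 1 else 0)"
proof -
  have "hermite_coeff \<delta> (hermite_fun \<gamma>) = integral\<^sup>L lborel (\<lambda>x. complex_of_real (\<Prod>j\<in>UNIV. herm (\<gamma> j) (x $ j) * herm (\<delta> j) (x $ j)))"
    unfolding hermite_coeff_def hermite_fun_eq by (simp only: of_real_mult prod.distrib)
  also have "\<dots> = complex_of_real (\<Prod>j\<in>UNIV. if \<gamma> j = \<delta> j then 1 else 0)"
    by (simp only: integral_complex_of_real integrable_prod_cart(2)[OF integrable_herm_mult] herm_orthonormal)
  also have "(\<Prod>j\<in>UNIV. if \<gamma> j = \<delta> j then 1 else (0::real)) = (if \<gamma> = \<delta> then 1 else 0)"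
    by (auto simp: fun_eq_iff)
  finally show ?thesis by simp
qed

definition decay_const :: "'n::finite itself \<Rightarrow> real" where
  "decay_const _ = (integral\<^sup>L lborel (decay :: real^'n \<Rightarrow> real) + 1) / 2"

lemma decay_const_nonneg: "0 \<le> decay_const TYPE('n::finite)"
  unfolding decay_const_def by (simp add: Bochner_Integration.integral_nonneg decay_pos less_imp_le)

text \<open>The point is uniformity in \<gamma>. By 2ab \<le> a^2 + b^2 and \<open>decay\<close>
  \<le> 1, the integrand is at most K/2 times \<open>decay\<close> + |H_\<gamma>|^2, and the L2 norm
  of H_\<gamma> is 1 for every \<gamma>; this is the 1 inside \<open>decay_const\<close>.\<close>

lemma hermite_coeff_decay_bound:
  fixes f :: "real^'n::finite \<Rightarrow> complex"
  assumes f: "f \<in> borel_measurable borel" "\<And>x. cmod (f x) \<le> K * decay x" and K: "K \<ge> 0"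
  shows "cmod (hermite_coeff \<gamma> f) \<le> K * decay_const TYPE('n)"
proof -
  have "cmod (hermite_coeff \<gamma> f) \<le> integral\<^sup>L lborel (\<lambda>x. K / 2 * (decay x + (cmod (hermite_fun \<gamma> x))\<^sup>2))"
    unfolding hermite_coeff_def
  proof (rule Bochner_Integration.integral_norm_bound_integral)
    have "cmod (f x) \<le> K * 1" for x
      using f(2)[of x] mult_left_mono[OF decay_le_1 K] by (rule order.trans)
    then show "integrable lborel (\<lambda>x. f x * hermite_fun \<gamma> x)" by (rule integrable_mult_hermite_fun[OF f(1)])
    show "integrable lborel (\<lambda>x. K / 2 * (decay x + (cmod (hermite_fun \<gamma> x))\<^sup>2))"
      by (intro integrable_mult_right Bochner_Integration.integrable_add integrable_decay hermite_fun_square_integral(1))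
    fix x
    have "decay x * cmod (hermite_fun \<gamma> x) \<le> ((decay x)\<^sup>2 + (cmod (hermite_fun \<gamma> x))\<^sup>2) / 2"
      using sum_squares_bound[of "decay x" "cmod (hermite_fun \<gamma> x)"] by simp
    also have "(decay x)\<^sup>2 \<le> decay x"
      using decay_le_1[of x] decay_pos[of x] by (simp add: power2_eq_square mult_left_le less_imp_le)
    finally have "decay x * cmod (hermite_fun \<gamma> x) \<le> (decay x + (cmod (hermite_fun \<gamma> x))\<^sup>2) / 2" by simp
    then have "K * (decay x * cmod (hermite_fun \<gamma> x)) \<le> K * ((decay x + (cmod (hermite_fun \<gamma> x))\<^sup>2) / 2)"
      using K by (rule mult_left_mono)
    moreover have "cmod (f x) * cmod (hermite_fun \<gamma> x) \<le> K * decay x * cmod (hermite_fun \<gamma> x)"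
      using f(2)[of x] by (rule mult_right_mono) simp
    ultimately show "norm (f x * hermite_fun \<gamma> x) \<le> K / 2 * (decay x + (cmod (hermite_fun \<gamma> x))\<^sup>2)"
      by (simp add: norm_mult mult.assoc)
  qed
  also have "\<dots> = K * decay_const TYPE('n)"
    using Bochner_Integration.integral_add[OF integrable_decay hermite_fun_square_integral(1)[of \<gamma>]]
    by (simp add: decay_const_def hermite_fun_square_integral)
  finally show ?thesis .
qed

text \<open>The number operators yield only whole powers of \<gamma>, so each \<beta>_j / 2 is
  rounded up to \<open>m j\<close>, and 2m_j \<le> \<beta>_j + 1. The monomials needed for
  \<open>decay\<close> add at most 2 in each coordinate, which gives the shift 3.\<close>

lemma hermite_coeff_bound:
  fixes f :: "real^'n::finite \<Rightarrow> complex"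
  assumes G: "adm G" and f: "gs_le f (\<lambda>\<sigma>. K * G \<sigma>)"
  shows "cmod (hermite_coeff \<gamma> f) * hpow \<gamma> \<beta> \<le> 2 ^ CARD('n) * decay_const TYPE('n) * (K * (9 ^ msize \<beta> * G (\<beta> + (\<lambda>_. 3))))"
proof -
  define m where "m j = (\<beta> j + 1) div 2" for j
  have K: "K \<ge> 0" using gs_le_nonneg[OF f, of 0] adm_pos[OF G, of 0] by (simp add: zero_le_mult_iff)
  obtain g where g: "gs_le g (\<lambda>\<sigma>. 9 ^ msize m * K * G (\<sigma> + (m + m)))"
    and c: "\<And>\<gamma>. hermite_coeff \<gamma> g = of_real (\<Prod>j\<in>UNIV. (2 * real (\<gamma> j)) ^ m j) * hermite_coeff \<gamma> f"
    using gs_le_number_power[OF G f] by blast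
  define L where "L = 9 ^ msize \<beta> * K * G (\<beta> + (\<lambda>_. 3))"
  have L: "L \<ge> 0" unfolding L_def using K adm_pos[OF G] by (simp add: less_imp_le)
  have "cmod (g x) \<le> 2 ^ CARD('n) * L * decay x" for x
  proof (rule decay_bound)
    fix \<alpha> :: "'n \<Rightarrow> nat" assume a: "\<forall>j. \<alpha> j \<le> 2"
    have "\<bar>xpow x \<alpha>\<bar> * cmod (g x) \<le> 9 ^ msize m * K * G (\<alpha> + (m + m))"
      using gs_le_mult_bound[OF g, of x \<alpha>] by (simp add: norm_mult)
    also have "\<dots> \<le> L"
      unfolding L_def
    proof (intro mult_mono)
      show "(9::real) ^ msize m \<le> 9 ^ msize \<beta>"
        unfolding msize_def m_def by (intro power_increasing sum_mono) auto
      have "\<alpha> j + (m j + m j) \<le> \<beta> j + 3" for j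
      proof -
        have "2 * ((\<beta> j + 1) div 2) \<le> \<beta> j + 1" by simp
        then show ?thesis using spec[OF a, of j] by (simp add: m_def)
      qed
      then show "G (\<alpha> + (m + m)) \<le> G (\<beta> + (\<lambda>_. 3))"
        by (intro adm_mono[OF G]) (simp add: le_fun_def)
    qed (use K adm_pos[OF G] in \<open>auto simp: less_imp_le\<close>)
    finally show "\<bar>xpow x \<alpha>\<bar> * cmod (g x) \<le> L" .
  qed
  then have 1: "cmod (hermite_coeff \<gamma> g) \<le> 2 ^ CARD('n) * L * decay_const TYPE('n)"
    using L by (intro hermite_coeff_decay_bound borel_measurable_smooth[OF gs_le_smooth[OF g]]) auto
  have "hpow \<gamma> \<beta> \<le> (\<Prod>j\<in>UNIV. (2 * real (\<gamma> j)) ^ m j)"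
    unfolding hpow_def
  proof (intro prod_mono conjI)
    fix j
    show "sqrt (real (\<gamma> j)) ^ \<beta> j \<le> (2 * real (\<gamma> j)) ^ m j"
    proof (cases "\<gamma> j = 0")
      case True
      then show ?thesis by (cases "\<beta> j = 0") (auto simp: m_def power_0_left)
    next
      case False
      have "sqrt (real (\<gamma> j)) ^ \<beta> j \<le> sqrt (real (\<gamma> j)) ^ (2 * m j)"
        using False by (intro power_increasing) (auto simp: m_def)
      also have "\<dots> = real (\<gamma> j) ^ m j" by (simp add: power_mult)
      also have "\<dots> \<le> (2 * real (\<gamma> j)) ^ m j" by (intro power_mono) auto
      finally show ?thesis .
    qed
  qed auto
  then have "cmod (hermite_coeff \<gamma> f) * hpow \<gamma> \<beta> \<le> cmod (hermite_coeff \<gamma> f) * (\<Prod>j\<in>UNIV. (2 * real (\<gamma> j)) ^ m j)"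
    by (rule mult_left_mono) simp
  also have "\<dots> = cmod (hermite_coeff \<gamma> g)"
  proof -
    have "0 \<le> (\<Prod>j\<in>UNIV. (2 * real (\<gamma> j)) ^ m j)" by (intro prod_nonneg) auto
    then show ?thesis unfolding c norm_mult norm_of_real by simp
  qed
  also note 1
  finally show ?thesis unfolding L_def by (simp only: ac_simps)
qed

section \<open>Bounds on the terms of a Hermite series\<close>

text \<open>Raising \<sigma>_i multiplies the left side by sqrt(\<gamma>_i + \<sigma>_i + 1) \<le>
  sqrt(\<gamma>_i) + sqrt(\<sigma>_i + 1). The first part is one more half power of \<gamma>, so
  \<beta> must be arbitrary in the induction; the second is absorbed by admissibility. The two parts
  account for the factor 2 per step.\<close>

lemma seq_bound_fact:
  assumes G: "adm G" and c: "\<And>\<beta>. r * hpow \<gamma> \<beta> \<le> K * G \<beta>" and r: "0 \<le> r" 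
  shows "r * hpow \<gamma> \<beta> * (\<Prod>j\<in>UNIV. sqrt (fact (\<gamma> j + \<sigma> j) / fact (\<gamma> j))) \<le> K * 2 ^ msize \<sigma> * G (\<beta> + \<sigma>)"
proof (induction \<sigma> arbitrary: \<beta> rule: mi_induct)
  case zero
  then show ?case using c[of \<beta>] by (simp add: msize_def)
next
  case (step \<sigma> i)
  define Q where "Q = (\<Prod>j\<in>UNIV. sqrt (fact (\<gamma> j + \<sigma> j) / fact (\<gamma> j)))"
  have Q: "Q \<ge> 0" unfolding Q_def by (intro prod_nonneg) auto
  have K: "K \<ge> 0"
  proof -
    have "0 \<le> K * G 0" using c[of 0] r by simp
    then show ?thesis using adm_pos[OF G, of 0] by (simp add: zero_le_mult_iff)
  qed
  have e: "(\<Prod>j\<in>UNIV. sqrt (fact (\<gamma> j + (\<sigma> + unit_mi i) j) / fact (\<gamma> j))) = sqrt (real (Suc (\<gamma> i + \<sigma> i))) * Q"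
    unfolding Q_def
    by (rule prod_fun_upd_unit[where f = "\<lambda>j k. sqrt (fact (\<gamma> j + k) / fact (\<gamma> j))"])
       (simp add: real_sqrt_mult[symmetric] del: of_nat_Suc)
  have s: "sqrt (real (Suc (\<gamma> i + \<sigma> i))) \<le> sqrt (real (\<gamma> i)) + sqrt (real (Suc (\<sigma> i)))"
    using sqrt_add_le_add_sqrt[of "real (\<gamma> i)" "real (Suc (\<sigma> i))"] by (simp add: add_ac)
  have e2: "\<beta> + unit_mi i + \<sigma> = \<beta> + (\<sigma> + unit_mi i)" by (simp only: ac_simps)
  have "r * hpow \<gamma> \<beta> * (sqrt (real (Suc (\<gamma> i + \<sigma> i))) * Q) = (r * hpow \<gamma> \<beta> * Q) * sqrt (real (Suc (\<gamma> i + \<sigma> i)))" by simp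
  also have "\<dots> \<le> (r * hpow \<gamma> \<beta> * Q) * (sqrt (real (\<gamma> i)) + sqrt (real (Suc (\<sigma> i))))"
    using s Q r hpow_nonneg[of \<gamma> \<beta>] by (intro mult_left_mono) auto
  also have "\<dots> = r * hpow \<gamma> (\<beta> + unit_mi i) * Q + sqrt (real (Suc (\<sigma> i))) * (r * hpow \<gamma> \<beta> * Q)"
    unfolding hpow_add_unit by (simp add: algebra_simps)
  also have "\<dots> \<le> K * 2 ^ msize \<sigma> * G (\<beta> + (\<sigma> + unit_mi i)) + sqrt (real (Suc (\<sigma> i))) * (K * 2 ^ msize \<sigma> * G (\<beta> + \<sigma>))"
    by (rule add_mono[OF step[of "\<beta> + unit_mi i", folded Q_def, unfolded e2] mult_left_mono[OF step[of \<beta>, folded Q_def]]]) simp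
  also have "sqrt (real (Suc (\<sigma> i))) * (K * 2 ^ msize \<sigma> * G (\<beta> + \<sigma>)) = (K * 2 ^ msize \<sigma>) * (sqrt (real (Suc (\<sigma> i))) * G (\<beta> + \<sigma>))"
    by simp
  also have "\<dots> \<le> (K * 2 ^ msize \<sigma>) * G (\<beta> + (\<sigma> + unit_mi i))"
    unfolding add.assoc[symmetric] using K by (intro mult_left_mono adm_step_le[OF G]) auto
  finally show ?case unfolding e msize_add by (simp del: plus_fun_apply add: algebra_simps)
qed

text \<open>The summable majorant common to all series in the proof. Every estimate of a term
  carries this factor independently of \<alpha>, \<beta> and x.\<close>

definition rho :: "('n::finite \<Rightarrow> nat) \<Rightarrow> real" where
  "rho \<gamma> = (\<Prod>j\<in>UNIV. 1 / (real (\<gamma> j) + 1) ^ 2)"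

lemma rho_pos: "0 < rho \<gamma>"
  unfolding rho_def by (intro prod_pos) auto

text \<open>The four additional factors of the larger factorial are each at least n + 1. Their
  product has square root at least (n + 1)^2, which is divided out to become a factor of
  \<open>rho\<close>.\<close>

lemma herm_bound_le: "herm_bound n s \<le> sqrt 2 ^ Suc s * sqrt (fact (n + (s + 5)) / fact n) * (1 / (real n + 1) ^ 2)"
proof -
  define t where "t = real n + 1"
  have t: "t > 0" unfolding t_def by simp
  have f: "fact (n + (s + 5)) = real (n + s + 5) * (real (n + s + 4) * (real (n + s + 3) * (real (n + s + 2) * fact (n + s + 1))))"
    by (simp add: fact_numeral eval_nat_numeral algebra_simps)
  have "t ^ 4 * fact (n + s + 1) = t * (t * (t * (t * fact (n + s + 1))))" by (simp add: eval_nat_numeral)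
  also have "\<dots> \<le> fact (n + (s + 5))"
    unfolding f by (intro mult_mono) (auto simp: t_def)
  finally have "sqrt (t ^ 4 * fact (n + s + 1) / fact n) \<le> sqrt (fact (n + (s + 5)) / fact n)"
    by (intro real_sqrt_le_mono divide_right_mono) auto
  moreover have "sqrt (t ^ 4 * fact (n + s + 1) / fact n) = t ^ 2 * sqrt (fact (n + s + 1) / fact n)"
  proof -
    have "sqrt (t ^ 4) = t ^ 2" by (rule real_sqrt_unique) (use t in \<open>auto simp: power_mult[symmetric]\<close>)
    then show ?thesis by (simp add: real_sqrt_mult real_sqrt_divide)
  qed
  ultimately have "t ^ 2 * sqrt (fact (n + s + 1) / fact n) \<le> sqrt (fact (n + (s + 5)) / fact n)" by (simp only:)
  then have "sqrt (fact (n + s + 1) / fact n) \<le> sqrt (fact (n + (s + 5)) / fact n) * (1 / t ^ 2)"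
    using t by (simp add: field_simps)
  then have "sqrt 2 ^ Suc s * sqrt (fact (n + s + 1) / fact n) \<le> sqrt 2 ^ Suc s * (sqrt (fact (n + (s + 5)) / fact n) * (1 / t ^ 2))"
    by (rule mult_left_mono) simp
  then show ?thesis unfolding herm_bound_def t_def by (simp only: mult.assoc)
qed

text \<open>Bookkeeping of constants: \<open>herm_bound\<close> contributes sqrt 2 per coordinate
  and per unit of |\<alpha> + \<beta>|, enlarged to 2, and \<open>seq_bound_fact\<close> contributes
  2 per unit of the index shifted by 5. In total this is 2^6 = 64 per coordinate and 2 * 2 = 4 per
  unit.\<close>

lemma hermite_term_bound:
  fixes \<gamma> :: "'n::finite \<Rightarrow> nat"
  assumes G: "adm G" and c: "\<And>\<beta>. r * hpow \<gamma> \<beta> \<le> K * G \<beta>" and r: "0 \<le> r"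
  shows "r * cmod (complex_of_real (xpow x \<alpha>) * pder \<beta> (hermite_fun \<gamma>) x)
    \<le> 64 ^ CARD('n) * rho \<gamma> * (K * (4 ^ msize (\<alpha> + \<beta>) * G (\<alpha> + \<beta> + (\<lambda>_. 5))))"
proof -
  define \<sigma> where "\<sigma> = \<alpha> + \<beta>"
  define F where "F = (\<Prod>j\<in>UNIV. sqrt (fact (\<gamma> j + (\<sigma> + (\<lambda>_. 5)) j) / fact (\<gamma> j)))"
  have K: "K \<ge> 0"
  proof -
    have "0 \<le> K * G 0" using c[of 0] r by simp
    then show ?thesis using adm_pos[OF G, of 0] by (simp add: zero_le_mult_iff)
  qed
  have "cmod (complex_of_real (xpow x \<alpha>) * pder \<beta> (hermite_fun \<gamma>) x) \<le> (\<Prod>j\<in>UNIV. herm_bound (\<gamma> j) (\<alpha> j + \<beta> j))"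
    by (rule hermite_fun_bound)
  also have "\<dots> \<le> (\<Prod>j\<in>UNIV. sqrt 2 ^ Suc (\<sigma> j) * sqrt (fact (\<gamma> j + (\<sigma> j + 5)) / fact (\<gamma> j)) * (1 / (real (\<gamma> j) + 1) ^ 2))"
  proof (intro prod_mono conjI)
    fix j
    show "0 \<le> herm_bound (\<gamma> j) (\<alpha> j + \<beta> j)" by (simp add: herm_bound_def)
    show "herm_bound (\<gamma> j) (\<alpha> j + \<beta> j) \<le> sqrt 2 ^ Suc (\<sigma> j) * sqrt (fact (\<gamma> j + (\<sigma> j + 5)) / fact (\<gamma> j)) * (1 / (real (\<gamma> j) + 1) ^ 2)"
      using herm_bound_le[of "\<gamma> j" "\<sigma> j"] unfolding \<sigma>_def plus_fun_apply .
  qed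
  also have "\<dots> = (\<Prod>j\<in>UNIV. sqrt 2 ^ Suc (\<sigma> j)) * F * rho \<gamma>"
    unfolding F_def rho_def prod.distrib by simp
  also have "(\<Prod>j\<in>UNIV. sqrt 2 ^ Suc (\<sigma> j)) = sqrt 2 ^ CARD('n) * sqrt 2 ^ msize \<sigma>"
    by (simp add: prod.distrib msize_def power_sum)
  finally have 1: "cmod (complex_of_real (xpow x \<alpha>) * pder \<beta> (hermite_fun \<gamma>) x) \<le> sqrt 2 ^ CARD('n) * sqrt 2 ^ msize \<sigma> * F * rho \<gamma>" .
  have 2: "r * F \<le> K * 2 ^ msize (\<sigma> + (\<lambda>_. 5)) * G (\<sigma> + (\<lambda>_. 5))"
    using seq_bound_fact[OF G c r, of 0 "\<sigma> + (\<lambda>_. 5)"] unfolding F_def by simp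
  have m: "msize (\<sigma> + (\<lambda>_. 5)) = msize \<sigma> + 5 * CARD('n)" unfolding msize_add by (simp add: msize_def)
  have "r * cmod (complex_of_real (xpow x \<alpha>) * pder \<beta> (hermite_fun \<gamma>) x) \<le> r * (sqrt 2 ^ CARD('n) * sqrt 2 ^ msize \<sigma> * F * rho \<gamma>)"
    using 1 r by (rule mult_left_mono)
  also have "\<dots> = (r * F) * (sqrt 2 ^ CARD('n) * sqrt 2 ^ msize \<sigma> * rho \<gamma>)" by simp
  also have "\<dots> \<le> (K * 2 ^ msize (\<sigma> + (\<lambda>_. 5)) * G (\<sigma> + (\<lambda>_. 5))) * (2 ^ CARD('n) * 2 ^ msize \<sigma> * rho \<gamma>)"
  proof (rule mult_mono[OF 2])
    have s2: "sqrt 2 \<le> (2::real)" using real_sqrt_le_mono[of 2 4] by simp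
    show "sqrt 2 ^ CARD('n) * sqrt 2 ^ msize \<sigma> * rho \<gamma> \<le> 2 ^ CARD('n) * 2 ^ msize \<sigma> * rho \<gamma>"
      using rho_pos[of \<gamma>] by (intro mult_mono power_mono s2) (auto simp: less_imp_le)
  qed (use K adm_pos[OF G, of "\<sigma> + (\<lambda>_. 5)"] rho_pos[of \<gamma>] in \<open>auto simp: less_imp_le\<close>)
  also have "\<dots> = 64 ^ CARD('n) * rho \<gamma> * (K * (4 ^ msize \<sigma> * G (\<sigma> + (\<lambda>_. 5))))"
  proof -
    have "(64::real) ^ CARD('n) = 2 ^ (5 * CARD('n)) * 2 ^ CARD('n)"
      by (simp add: power_mult power_mult_distrib[symmetric])
    moreover have "(4::real) ^ msize \<sigma> = 2 ^ msize \<sigma> * 2 ^ msize \<sigma>"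
      by (simp add: power_mult_distrib[symmetric])
    ultimately show ?thesis unfolding m power_add by (simp only: ac_simps)
  qed
  finally show ?thesis unfolding \<sigma>_def .
qed

lemma adm_fact_le:
  assumes G: "adm G"
  shows "(\<Prod>j\<in>UNIV. sqrt (fact (\<beta> j))) * G 0 \<le> G \<beta>"
proof (induction \<beta> rule: mi_induct)
  case (step \<beta> i)
  have e: "(\<Prod>j\<in>UNIV. sqrt (fact ((\<beta> + unit_mi i) j))) = sqrt (real (Suc (\<beta> i))) * (\<Prod>j\<in>UNIV. sqrt (fact (\<beta> j)))"
    by (rule prod_fun_upd_unit[where f = "\<lambda>j k. sqrt (fact k)"]) (simp add: real_sqrt_mult[symmetric])
  have "sqrt (real (Suc (\<beta> i))) * ((\<Prod>j\<in>UNIV. sqrt (fact (\<beta> j))) * G 0) \<le> sqrt (real (Suc (\<beta> i))) * G \<beta>"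
    using step by (rule mult_left_mono) simp
  also have "\<dots> \<le> G (\<beta> + unit_mi i)" by (rule adm_step[OF G])
  finally show ?case unfolding e by (simp only: mult.assoc)
qed simp

text \<open>For fixed \<gamma> the exponential series bounds \<gamma>^\<beta> by \<beta>! up to a
  constant, while an admissible weight grows at least like sqrt(\<beta>!). This puts the unit
  sequences, and through them the Hermite functions, into the spaces.\<close>

lemma hpow_le_adm:
  assumes G: "adm G"
  shows "hpow \<gamma> \<beta> \<le> exp (real (msize \<gamma>)) / G 0 * G \<beta>"
proof -
  have "hpow \<gamma> \<beta> \<le> (\<Prod>j\<in>UNIV. exp (real (\<gamma> j)) * sqrt (fact (\<beta> j)))"
    unfolding hpow_def
  proof (intro prod_mono conjI)
    fix j
    have "real (\<gamma> j) ^ \<beta> j \<le> exp (real (\<gamma> j)) * fact (\<beta> j)"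
      using power_div_fact_le_exp[of "real (\<gamma> j)" "\<beta> j"] by (simp add: field_simps)
    also have "\<dots> \<le> (exp (real (\<gamma> j)))\<^sup>2 * fact (\<beta> j)"
      by (intro mult_right_mono) (auto simp: power2_eq_square)
    finally have "sqrt (real (\<gamma> j) ^ \<beta> j) \<le> sqrt ((exp (real (\<gamma> j)))\<^sup>2 * fact (\<beta> j))"
      by (rule real_sqrt_le_mono)
    then show "sqrt (real (\<gamma> j)) ^ \<beta> j \<le> exp (real (\<gamma> j)) * sqrt (fact (\<beta> j))"
      by (simp add: real_sqrt_power real_sqrt_mult)
  qed auto
  also have "\<dots> = exp (real (msize \<gamma>)) * (\<Prod>j\<in>UNIV. sqrt (fact (\<beta> j)))"
    by (simp add: prod.distrib msize_def exp_sum)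
  also have "\<dots> \<le> exp (real (msize \<gamma>)) * (G \<beta> / G 0)"
    using adm_fact_le[OF G, of \<beta>] adm_pos[OF G, of 0] by (intro mult_left_mono) (auto simp: field_simps)
  finally show ?thesis by simp
qed

section \<open>Completeness of the Hermite functions\<close>

text \<open>The function in \<open>dom\<close> majorises every partial sum of the exponential series
  times g, so dominated convergence allows integration term by term.\<close>

lemma integral_exp_mult_eq_0:
  fixes g :: "'a::euclidean_space \<Rightarrow> complex" and q :: "'a \<Rightarrow> real"
  assumes [measurable]: "g \<in> borel_measurable borel" "q \<in> borel_measurable borel"
    and dom: "integrable lborel (\<lambda>x. exp \<bar>q x\<bar> * cmod (g x))"
    and van: "\<And>k. integral\<^sup>L lborel (\<lambda>x. complex_of_real (q x ^ k) * g x) = 0"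
  shows "integral\<^sup>L lborel (\<lambda>x. complex_of_real (exp (q x)) * g x) = 0"
proof -
  have int: "integrable lborel (\<lambda>x. complex_of_real (q x ^ k) * g x)" for k
  proof (rule Bochner_Integration.integrable_bound[OF integrable_mult_right[OF dom, of "fact k"]])
    have "\<bar>q x\<bar> ^ k \<le> fact k * exp \<bar>q x\<bar>" for x
      using power_div_fact_le_exp[of "\<bar>q x\<bar>" k] by (simp add: field_simps)
    from mult_right_mono[OF this norm_ge_zero[of "g _"]]
    show "AE x in lborel. cmod (complex_of_real (q x ^ k) * g x) \<le> norm (fact k * (exp \<bar>q x\<bar> * cmod (g x)))"
      by (auto simp: norm_mult power_abs mult.assoc norm_power)
  qed simp
  define u where "u n x = complex_of_real (\<Sum>k<n. q x ^ k /\<^sub>R fact k) * g x" for n x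
  have ueq: "u n = (\<lambda>x. \<Sum>k<n. complex_of_real (1 / fact k) * (complex_of_real (q x ^ k) * g x))" for n
    by (auto simp: u_def fun_eq_iff sum_distrib_right divide_inverse mult.assoc)
  have iu: "integral\<^sup>L lborel (u n) = 0" for n
    unfolding ueq by (subst Bochner_Integration.integral_sum) (use int van in auto)
  have "(\<lambda>n. integral\<^sup>L lborel (u n)) \<longlonglongrightarrow> integral\<^sup>L lborel (\<lambda>x. complex_of_real (exp (q x)) * g x)"
  proof (rule integral_dominated_convergence[OF _ _ dom])
    show "u n \<in> borel_measurable lborel" for n unfolding u_def by measurable
    show "AE x in lborel. (\<lambda>n. u n x) \<longlonglongrightarrow> complex_of_real (exp (q x)) * g x"
    proof (rule AE_I2)
      fix x
      have "(\<lambda>n. \<Sum>k<n. q x ^ k /\<^sub>R fact k) \<longlonglongrightarrow> exp (q x)"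
        using exp_converges[of "q x"] unfolding sums_def .
      then show "(\<lambda>n. u n x) \<longlonglongrightarrow> complex_of_real (exp (q x)) * g x"
        unfolding u_def by (intro tendsto_intros)
    qed
    show "AE x in lborel. cmod (u n x) \<le> exp \<bar>q x\<bar> * cmod (g x)" for n
    proof (rule AE_I2)
      fix x
      have "\<bar>\<Sum>k<n. q x ^ k /\<^sub>R fact k\<bar> \<le> (\<Sum>k<n. \<bar>q x\<bar> ^ k /\<^sub>R fact k)"
        by (rule order.trans[OF sum_abs]) (simp add: abs_mult power_abs)
      also have "\<dots> \<le> (\<Sum>k. \<bar>q x\<bar> ^ k /\<^sub>R fact k)"
        using summable_exp_generic[of "\<bar>q x\<bar>"] by (intro sum_le_suminf) auto
      also have "\<dots> = exp \<bar>q x\<bar>" by (simp add: exp_def)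
      finally show "cmod (u n x) \<le> exp \<bar>q x\<bar> * cmod (g x)"
        unfolding u_def norm_mult norm_of_real by (rule mult_right_mono) simp
    qed
  qed measurable
  then show ?thesis by (simp add: iu LIMSEQ_const_iff)
qed

lemma gauss_le_decay:
  fixes x :: "real^'n::finite"
  assumes "b > 0"
  shows "exp (- b * (norm x)\<^sup>2) \<le> (1 + 1 / b) ^ CARD('n) * decay x"
proof -
  have "exp (- b * (norm x)\<^sup>2) = (\<Prod>j\<in>UNIV. exp (- b * (x $ j)\<^sup>2))" by (rule exp_norm_power2)
  also have "\<dots> \<le> (\<Prod>j\<in>(UNIV::'n set). (1 + 1 / b) * (1 / (1 + (x $ j)\<^sup>2)))"
  proof (intro prod_mono conjI)
    fix j
    have "1 + (x $ j)\<^sup>2 \<le> (1 + 1 / b) * (1 + b * (x $ j)\<^sup>2)" using assms by (simp add: field_simps)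
    also have "\<dots> \<le> (1 + 1 / b) * exp (b * (x $ j)\<^sup>2)"
      using assms by (intro mult_left_mono exp_ge_add_one_self) auto
    finally show "exp (- b * (x $ j)\<^sup>2) \<le> (1 + 1 / b) * (1 / (1 + (x $ j)\<^sup>2))"
      using one_plus_square_pos[of "x $ j"] by (simp add: exp_minus field_simps)
  qed auto
  also have "\<dots> = (1 + 1 / b) ^ CARD('n) * decay x" by (simp only: prod.distrib prod_constant decay_def)
  finally show ?thesis .
qed

lemma integrable_gauss: "b > 0 \<Longrightarrow> integrable lborel (\<lambda>x::real^'n::finite. exp (- b * (norm x)\<^sup>2))"
  by (rule Bochner_Integration.integrable_bound[OF integrable_mult_right[OF integrable_decay, of "(1 + 1 / b) ^ CARD('n)"]])
     (use gauss_le_decay in \<open>auto intro: order.trans[OF _ abs_ge_self]\<close>)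

lemma polynomial_le_exp_square:
  fixes p :: "'a::euclidean_space \<Rightarrow> real"
  assumes "real_polynomial_function p" "\<epsilon> > 0"
  shows "\<exists>C\<ge>0. \<forall>x. \<bar>p x\<bar> \<le> C * exp (\<epsilon> * (norm x)\<^sup>2)"
  using assms
proof (induction arbitrary: \<epsilon>)
  case (linear f)
  obtain B where B: "B > 0" "\<And>x. norm (f x) \<le> norm x * B" using bounded_linear.pos_bounded[OF linear(1)] by blast
  have "\<bar>f x\<bar> \<le> (B * (1 + 1 / \<epsilon>)) * exp (\<epsilon> * (norm x)\<^sup>2)" for x
  proof -
    have "norm x \<le> 1 + (norm x)\<^sup>2"
      using sum_power2_ge_zero[of "norm x - 1" 0] norm_ge_zero[of x] by (simp add: power2_eq_square algebra_simps del: norm_ge_zero)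
    also have "\<dots> \<le> (1 + 1 / \<epsilon>) * (1 + \<epsilon> * (norm x)\<^sup>2)" using linear(2) by (simp add: field_simps)
    also have "\<dots> \<le> (1 + 1 / \<epsilon>) * exp (\<epsilon> * (norm x)\<^sup>2)"
      using linear(2) by (intro mult_left_mono exp_ge_add_one_self) auto
    finally have "norm x * B \<le> ((1 + 1 / \<epsilon>) * exp (\<epsilon> * (norm x)\<^sup>2)) * B" using B by (intro mult_right_mono) auto
    then show ?thesis using B(2)[of x] by (simp add: mult_ac)
  qed
  then show ?case using B linear(2) by (intro exI[of _ "B * (1 + 1 / \<epsilon>)"]) auto
next
  case (const c)
  have "\<bar>c\<bar> * 1 \<le> \<bar>c\<bar> * exp (\<epsilon> * (norm x)\<^sup>2)" for x :: 'a
    using const by (intro mult_left_mono) auto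
  then show ?case by (intro exI[of _ "\<bar>c\<bar>"]) auto
next
  case (add f g)
  obtain C where C: "C \<ge> 0" "\<And>x. \<bar>f x\<bar> \<le> C * exp (\<epsilon> * (norm x)\<^sup>2)" using add by blast
  obtain D where D: "D \<ge> 0" "\<And>x. \<bar>g x\<bar> \<le> D * exp (\<epsilon> * (norm x)\<^sup>2)" using add by blast
  have "\<bar>f x + g x\<bar> \<le> (C + D) * exp (\<epsilon> * (norm x)\<^sup>2)" for x
    using C(2)[of x] D(2)[of x] by (simp add: distrib_right)
  then show ?case using C D by (intro exI[of _ "C + D"]) auto
next
  case (mult f g)
  \<comment> \<open>Each factor receives half of the exponent; for this the induction leaves
    \<open>\<epsilon>\<close> arbitrary.\<close>
  have "\<epsilon> / 2 > 0" using mult by simp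
  then obtain C D where C: "C \<ge> 0" "\<And>x. \<bar>f x\<bar> \<le> C * exp (\<epsilon> / 2 * (norm x)\<^sup>2)"
    and D: "D \<ge> 0" "\<And>x. \<bar>g x\<bar> \<le> D * exp (\<epsilon> / 2 * (norm x)\<^sup>2)" using mult.IH by metis
  have "\<bar>f x * g x\<bar> \<le> (C * D) * exp (\<epsilon> * (norm x)\<^sup>2)" for x
  proof -
    have "\<bar>f x * g x\<bar> \<le> (C * exp (\<epsilon> / 2 * (norm x)\<^sup>2)) * (D * exp (\<epsilon> / 2 * (norm x)\<^sup>2))"
      unfolding abs_mult using C D by (intro mult_mono) auto
    also have "\<dots> = (C * D) * (exp (\<epsilon> / 2 * (norm x)\<^sup>2) * exp (\<epsilon> / 2 * (norm x)\<^sup>2))" by simp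
    also have "exp (\<epsilon> / 2 * (norm x)\<^sup>2) * exp (\<epsilon> / 2 * (norm x)\<^sup>2) = exp (\<epsilon> * (norm x)\<^sup>2)"
      by (simp add: exp_add[symmetric])
    finally show ?thesis .
  qed
  then show ?case using C D by (intro exI[of _ "C * D"]) auto
qed

lemma integrable_le_gauss:
  fixes v :: "real^'n::finite \<Rightarrow> real"
  assumes "v \<in> borel_measurable borel" "b > 0" "\<And>x. \<bar>v x\<bar> \<le> C * exp (- b * (norm x)\<^sup>2)"
  shows "integrable lborel v"
  by (rule Bochner_Integration.integrable_bound[OF integrable_mult_right[OF integrable_gauss[OF assms(2)], of C]])
     (use assms in \<open>auto intro: order.trans[OF _ abs_ge_self]\<close>)

lemma real_polynomial_function_coord: "real_polynomial_function (\<lambda>x::real^'n::finite. x $ j)"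
  by (intro real_polynomial_function.intros(1) bounded_linear_vec_nth)

lemma real_polynomial_function_norm_square: "real_polynomial_function (\<lambda>x::real^'n::finite. (norm x)\<^sup>2)"
  unfolding norm_power2_eq_sum
  by (intro real_polynomial_function_sum real_polynomial_function_power real_polynomial_function_coord) auto

lemma borel_measurable_polynomial:
  "real_polynomial_function p \<Longrightarrow> p \<in> borel_measurable (borel :: (real^'n::finite) measure)"
  by (rule borel_measurable_continuous_onI[OF continuous_on_polymonial_function])
     (simp add: real_polynomial_function_eq)

text \<open>Testing against all polynomials, not only constants, makes the notion stable: the powers
  of |x|^2 or of a linear form in an exponential series are absorbed into \<open>p\<close>.\<close>

definition gauss_null :: "(real^'n::finite \<Rightarrow> complex) \<Rightarrow> real \<Rightarrow> bool" where
  "gauss_null f a \<longleftrightarrow> (\<forall>p. real_polynomial_function p \<longrightarrow>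
     integral\<^sup>L lborel (\<lambda>x. complex_of_real (p x * exp (- a * (norm x)\<^sup>2)) * f x) = 0)"

text \<open>The exponential series of the extra Gaussian factor converges in the mean only while
  the exponent is less than doubled, so large exponents are reached by iteration.\<close>
lemma gauss_null_step:
  fixes f :: "real^'n::finite \<Rightarrow> complex"
  assumes f: "f \<in> borel_measurable borel" "\<And>x. cmod (f x) \<le> K" and a: "a > 0" and Z: "gauss_null f a"
  shows "gauss_null f (3 / 2 * a)"
  unfolding gauss_null_def
proof (intro allI impI)
  fix p :: "real^'n \<Rightarrow> real" assume p: "real_polynomial_function p"
  note [measurable] = f(1) borel_measurable_polynomial[OF p]
  have K: "K \<ge> 0" using f(2)[of undefined] norm_ge_zero order.trans by blast
  \<comment> \<open>The budget of exponents: a/4 goes to the polynomial and a/2 to the exponential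
    of |q|, which leaves a/4 of the Gaussian for integrability.\<close>
  obtain C where C: "C \<ge> 0" "\<And>x. \<bar>p x\<bar> \<le> C * exp (a / 4 * (norm x)\<^sup>2)"
    using polynomial_le_exp_square[OF p, of "a / 4"] a by auto
  define q where "q x = - (a / 2) * (norm x)\<^sup>2" for x :: "real^'n"
  define g where "g x = complex_of_real (p x * exp (- a * (norm x)\<^sup>2)) * f x" for x
  have q: "real_polynomial_function q"
    unfolding q_def by (intro real_polynomial_function.intros(4) real_polynomial_function.intros(2) real_polynomial_function_norm_square)
  have "integral\<^sup>L lborel (\<lambda>x. complex_of_real (exp (q x)) * g x) = 0"
  proof (rule integral_exp_mult_eq_0)
    show "g \<in> borel_measurable borel" "q \<in> borel_measurable borel" unfolding g_def q_def by measurable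
    show "integrable lborel (\<lambda>x. exp \<bar>q x\<bar> * cmod (g x))"
    proof (rule integrable_le_gauss)
      show "(\<lambda>x. exp \<bar>q x\<bar> * cmod (g x)) \<in> borel_measurable borel" unfolding g_def q_def by measurable
      show "\<bar>exp \<bar>q x\<bar> * cmod (g x)\<bar> \<le> (C * K) * exp (- (a / 4) * (norm x)\<^sup>2)" for x
      proof -
        have "\<bar>exp \<bar>q x\<bar> * cmod (g x)\<bar> = (\<bar>p x\<bar> * cmod (f x)) * (exp \<bar>q x\<bar> * exp (- a * (norm x)\<^sup>2))"
          by (simp add: g_def norm_mult abs_mult)
        also have "\<dots> \<le> ((C * exp (a / 4 * (norm x)\<^sup>2)) * K) * (exp \<bar>q x\<bar> * exp (- a * (norm x)\<^sup>2))"
          using C f(2) K by (intro mult_right_mono mult_mono) auto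
        also have "\<dots> = (C * K) * exp (a / 4 * (norm x)\<^sup>2 + \<bar>q x\<bar> + - a * (norm x)\<^sup>2)"
          by (simp only: exp_add ac_simps)
        also have "a / 4 * (norm x)\<^sup>2 + \<bar>q x\<bar> + - a * (norm x)\<^sup>2 = - (a / 4) * (norm x)\<^sup>2"
          using a by (simp add: q_def abs_mult)
        finally show ?thesis .
      qed
    qed (use a in auto)
    fix k
    have "real_polynomial_function (\<lambda>x. q x ^ k * p x)"
      by (intro real_polynomial_function.intros(4) real_polynomial_function_power q p)
    then have "integral\<^sup>L lborel (\<lambda>x. complex_of_real (q x ^ k * p x * exp (- a * (norm x)\<^sup>2)) * f x) = 0"
      using Z unfolding gauss_null_def by blast
    then show "integral\<^sup>L lborel (\<lambda>x. complex_of_real (q x ^ k) * g x) = 0"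
      unfolding g_def by (simp only: of_real_mult mult.assoc)
  qed
  moreover have "complex_of_real (exp (q x)) * g x = complex_of_real (p x * exp (- (3 / 2 * a) * (norm x)\<^sup>2)) * f x" for x
  proof -
    have e: "exp (q x) * exp (- a * (norm x)\<^sup>2) = exp (- (3 / 2 * a) * (norm x)\<^sup>2)"
      unfolding q_def exp_add[symmetric] by (simp add: algebra_simps)
    have "complex_of_real (exp (q x)) * g x = complex_of_real (p x * (exp (q x) * exp (- a * (norm x)\<^sup>2))) * f x"
      unfolding g_def by (simp only: of_real_mult ac_simps)
    then show ?thesis unfolding e .
  qed
  ultimately show "integral\<^sup>L lborel (\<lambda>x. complex_of_real (p x * exp (- (3 / 2 * a) * (norm x)\<^sup>2)) * f x) = 0" by simp
qed

text \<open>Expanding the square, the translated Gaussian is a constant times exp(2a x.y) times the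
  centred one, and the middle factor is expanded in a series. Its exponent is linear in x, so for
  every y half of the Gaussian outweighs it.\<close>

lemma gauss_null_translate:
  fixes f :: "real^'n::finite \<Rightarrow> complex"
  assumes f: "f \<in> borel_measurable borel" "\<And>x. cmod (f x) \<le> K" and a: "a > 0" and Z: "gauss_null f a"
  shows "integral\<^sup>L lborel (\<lambda>x. complex_of_real (exp (- a * (norm (x - y))\<^sup>2)) * f x) = 0"
proof -
  note [measurable] = f(1)
  have K: "K \<ge> 0" using f(2)[of undefined] norm_ge_zero order.trans by blast
  define q where "q x = 2 * a * (x \<bullet> y)" for x
  define g where "g x = complex_of_real (exp (- a * (norm x)\<^sup>2)) * f x" for x
  have q: "real_polynomial_function q"
    unfolding q_def by (intro real_polynomial_function.intros(4) real_polynomial_function.intros(2) real_polynomial_function.intros(1) bounded_linear_inner_left)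
  have "integral\<^sup>L lborel (\<lambda>x. complex_of_real (exp (q x)) * g x) = 0"
  proof (rule integral_exp_mult_eq_0)
    show "g \<in> borel_measurable borel" "q \<in> borel_measurable borel" unfolding g_def q_def by measurable
    show "integrable lborel (\<lambda>x. exp \<bar>q x\<bar> * cmod (g x))"
    proof (rule integrable_le_gauss)
      show "(\<lambda>x. exp \<bar>q x\<bar> * cmod (g x)) \<in> borel_measurable borel" unfolding g_def q_def by measurable
      show "\<bar>exp \<bar>q x\<bar> * cmod (g x)\<bar> \<le> (K * exp (2 * a * (norm y)\<^sup>2)) * exp (- (a / 2) * (norm x)\<^sup>2)" for x
      proof -
        have "\<bar>q x\<bar> \<le> 2 * a * (norm x * norm y)"
          unfolding q_def using a Cauchy_Schwarz_ineq2[of x y] by (simp add: abs_mult)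
        also have "2 * (norm x * norm y) \<le> (norm x)\<^sup>2 / 2 + 2 * (norm y)\<^sup>2"
          using sum_power2_ge_zero[of "norm x - 2 * norm y" 0] by (simp add: power2_eq_square algebra_simps)
        then have "2 * a * (norm x * norm y) \<le> a * ((norm x)\<^sup>2 / 2 + 2 * (norm y)\<^sup>2)"
          using a mult_left_mono[of "2 * (norm x * norm y)" _ a] by (simp add: mult_ac)
        finally have qb: "\<bar>q x\<bar> \<le> a * ((norm x)\<^sup>2 / 2 + 2 * (norm y)\<^sup>2)" .
        have "\<bar>exp \<bar>q x\<bar> * cmod (g x)\<bar> = cmod (f x) * exp (\<bar>q x\<bar> - a * (norm x)\<^sup>2)"
        proof -
          have "exp \<bar>q x\<bar> * exp (- a * (norm x)\<^sup>2) = exp (\<bar>q x\<bar> - a * (norm x)\<^sup>2)"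
            by (simp add: exp_add[symmetric])
          then show ?thesis by (simp add: g_def norm_mult abs_mult)
        qed
        also have "\<dots> \<le> K * exp (2 * a * (norm y)\<^sup>2 + - (a / 2) * (norm x)\<^sup>2)"
          using f(2) K qb by (intro mult_mono) (auto simp: algebra_simps)
        also have "\<dots> = (K * exp (2 * a * (norm y)\<^sup>2)) * exp (- (a / 2) * (norm x)\<^sup>2)"
          by (simp only: exp_add mult.assoc)
        finally show ?thesis .
      qed
    qed (use a in auto)
    fix k
    have "real_polynomial_function (\<lambda>x. q x ^ k)"
      by (intro real_polynomial_function_power q)
    then have "integral\<^sup>L lborel (\<lambda>x. complex_of_real (q x ^ k * exp (- a * (norm x)\<^sup>2)) * f x) = 0"
      using Z unfolding gauss_null_def by blast
    then show "integral\<^sup>L lborel (\<lambda>x. complex_of_real (q x ^ k) * g x) = 0"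
      unfolding g_def by (simp only: of_real_mult mult.assoc)
  qed
  moreover have "complex_of_real (exp (- a * (norm (x - y))\<^sup>2)) * f x
      = complex_of_real (exp (- a * (norm y)\<^sup>2)) * (complex_of_real (exp (q x)) * g x)" for x
  proof -
    have "- a * (norm (x - y))\<^sup>2 = - a * (norm y)\<^sup>2 + (q x + - a * (norm x)\<^sup>2)"
      unfolding q_def power2_norm_eq_inner by (simp add: inner_diff inner_commute algebra_simps)
    then have "exp (- a * (norm (x - y))\<^sup>2) = exp (- a * (norm y)\<^sup>2) * (exp (q x) * exp (- a * (norm x)\<^sup>2))"
      by (simp only: exp_add)
    then show ?thesis unfolding g_def by (simp only: of_real_mult mult.assoc)
  qed
  ultimately show ?thesis by simp
qed

lemma integral_affine:
  fixes h :: "'a::euclidean_space \<Rightarrow> complex"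
  assumes "h \<in> borel_measurable borel" "c > 0"
  shows "integral\<^sup>L lborel h = c ^ DIM('a) *\<^sub>R integral\<^sup>L lborel (\<lambda>u. h (t + c *\<^sub>R u))"
proof -
  have L: "lborel = density (distr lborel borel (\<lambda>x. t + c *\<^sub>R x)) (\<lambda>_. ennreal (c ^ DIM('a)))"
    using lborel_affine[of c t] assms(2) by (simp add: ennreal_power)
  have "integral\<^sup>L lborel h = integral\<^sup>L (density (distr lborel borel (\<lambda>x. t + c *\<^sub>R x)) (\<lambda>_. ennreal (c ^ DIM('a)))) h"
    using L by simp
  also have "\<dots> = integral\<^sup>L (distr lborel borel (\<lambda>x. t + c *\<^sub>R x)) (\<lambda>x. c ^ DIM('a) *\<^sub>R h x)"
    by (rule integral_density) (use assms in auto)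
  also have "\<dots> = integral\<^sup>L lborel (\<lambda>u. c ^ DIM('a) *\<^sub>R h (t + c *\<^sub>R u))"
    by (rule integral_distr) (use assms in auto)
  finally show ?thesis by simp
qed

text \<open>The substitution x = y + u / sqrt(a_n) keeps the Gaussian fixed and moves the
  concentration into f. As a_n grows, continuity and boundedness of f make the vanishing integrals
  converge to f(y) times the integral of exp(-|u|^2), which is positive.\<close>

lemma gauss_null_imp_zero:
  fixes f :: "real^'n::finite \<Rightarrow> complex"
  assumes cont: "continuous_on UNIV f" and bd: "\<And>x. cmod (f x) \<le> K" and Z: "gauss_null f (1 / 2)"
  shows "f y = 0"
proof -
  have m[measurable]: "f \<in> borel_measurable borel" by (rule borel_measurable_continuous_onI[OF cont])
  define a :: "nat \<Rightarrow> real" where "a n = (3 / 2) ^ n * (1 / 2)" for n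
  have a: "a n > 0" for n unfolding a_def by simp
  have Za: "gauss_null f (a n)" for n
  proof (induction n)
    case (Suc n)
    have "a (Suc n) = 3 / 2 * a n" by (simp add: a_def)
    then show ?case using gauss_null_step[OF m bd a Suc] by (simp only:)
  qed (use Z in \<open>simp add: a_def\<close>)
  have 0: "integral\<^sup>L lborel (\<lambda>u. complex_of_real (exp (- (norm u)\<^sup>2)) * f (y + (1 / sqrt (a n)) *\<^sub>R u)) = 0" for n
  proof -
    have s: "sqrt (a n) > 0" using a by simp
    have "0 = integral\<^sup>L lborel (\<lambda>x. complex_of_real (exp (- a n * (norm (x - y))\<^sup>2)) * f x)"
      using gauss_null_translate[OF m bd a Za] by simp
    also have "\<dots> = (1 / sqrt (a n)) ^ DIM(real^'n) *\<^sub>R integral\<^sup>L lborel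
        (\<lambda>u. complex_of_real (exp (- a n * (norm (y + (1 / sqrt (a n)) *\<^sub>R u - y))\<^sup>2)) * f (y + (1 / sqrt (a n)) *\<^sub>R u))"
      by (rule integral_affine) (use s in \<open>measurable, simp\<close>)
    also have "\<dots> = (1 / sqrt (a n)) ^ DIM(real^'n) *\<^sub>R integral\<^sup>L lborel
        (\<lambda>u. complex_of_real (exp (- (norm u)\<^sup>2)) * f (y + (1 / sqrt (a n)) *\<^sub>R u))"
    proof -
      have "- a n * (norm (y + (1 / sqrt (a n)) *\<^sub>R u - y))\<^sup>2 = - (norm u)\<^sup>2" for u
        using a[of n] by (simp add: power_mult_distrib power_divide)
      then show ?thesis by simp
    qed
    finally show ?thesis using s by simp
  qed
  have dom: "integrable lborel (\<lambda>u::real^'n. K * exp (- 1 * (norm u)\<^sup>2))"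
    by (intro integrable_mult_right integrable_gauss) simp
  have "(\<lambda>n. integral\<^sup>L lborel (\<lambda>u. complex_of_real (exp (- (norm u)\<^sup>2)) * f (y + (1 / sqrt (a n)) *\<^sub>R u)))
     \<longlonglongrightarrow> integral\<^sup>L lborel (\<lambda>u::real^'n. complex_of_real (exp (- (norm u)\<^sup>2)) * f y)"
  proof (rule integral_dominated_convergence[OF _ _ dom])
    show "AE u in lborel. cmod (complex_of_real (exp (- (norm u)\<^sup>2)) * f (y + (1 / sqrt (a n)) *\<^sub>R u)) \<le> K * exp (- 1 * (norm u)\<^sup>2)" for n
      using bd by (auto simp: norm_mult mult.commute[of K] intro!: mult_left_mono)
    have inv: "(\<lambda>n. 1 / sqrt (a n)) \<longlonglongrightarrow> 0"
    proof -
      have "1 / a n = 2 * (2 / 3) ^ n" for n by (simp add: a_def power_divide)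
      then have e: "1 / sqrt (a n) = sqrt (2 * (2 / 3) ^ n)" for n by (metis real_sqrt_divide real_sqrt_one)
      have "(\<lambda>n. sqrt (2 * (2 / 3) ^ n)) \<longlonglongrightarrow> sqrt (2 * 0)"
        by (intro tendsto_intros LIMSEQ_realpow_zero) auto
      then show ?thesis unfolding e by simp
    qed
    show "AE u in lborel. (\<lambda>n. complex_of_real (exp (- (norm u)\<^sup>2)) * f (y + (1 / sqrt (a n)) *\<^sub>R u))
       \<longlonglongrightarrow> complex_of_real (exp (- (norm u)\<^sup>2)) * f y"
    proof (rule AE_I2)
      fix u :: "real^'n"
      have "(\<lambda>n. y + (1 / sqrt (a n)) *\<^sub>R u) \<longlonglongrightarrow> y + 0 *\<^sub>R u" by (intro tendsto_intros inv)
      then have "(\<lambda>n. f (y + (1 / sqrt (a n)) *\<^sub>R u)) \<longlonglongrightarrow> f (y + 0 *\<^sub>R u)"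
        using cont by (intro continuous_on_tendsto_compose[OF cont]) auto
      then show "(\<lambda>n. complex_of_real (exp (- (norm u)\<^sup>2)) * f (y + (1 / sqrt (a n)) *\<^sub>R u))
       \<longlonglongrightarrow> complex_of_real (exp (- (norm u)\<^sup>2)) * f y" by (intro tendsto_intros) simp
    qed
  qed measurable
  then have "integral\<^sup>L lborel (\<lambda>u::real^'n. complex_of_real (exp (- (norm u)\<^sup>2)) * f y) = 0"
    unfolding 0 by (simp add: LIMSEQ_const_iff)
  then have "complex_of_real (integral\<^sup>L lborel (\<lambda>u::real^'n. exp (- (norm u)\<^sup>2))) * f y = 0"
    by simp
  moreover have "integral\<^sup>L lborel (\<lambda>u::real^'n. exp (- (norm u)\<^sup>2)) = sqrt pi ^ CARD('n)"
  proof -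
    have i: "integrable lborel (\<lambda>x::real. exp (- x\<^sup>2))" "integral\<^sup>L lborel (\<lambda>x::real. exp (- x\<^sup>2)) = sqrt pi"
      using integral_gauss by (auto simp: has_bochner_integral_iff)
    have "integral\<^sup>L lborel (\<lambda>u::real^'n. exp (- (norm u)\<^sup>2)) = integral\<^sup>L lborel (\<lambda>u::real^'n. \<Prod>j\<in>UNIV. exp (- (u $ j)\<^sup>2))"
      using exp_norm_power2[of "-1", where 'n = 'n] by simp
    also have "\<dots> = (\<Prod>j\<in>(UNIV::'n set). sqrt pi)"
      using integrable_prod_cart(2)[of "\<lambda>j::'n. \<lambda>x. exp (- x\<^sup>2)", OF i(1)] by (simp add: i(2))
    finally show ?thesis by simp
  qed
  ultimately show ?thesis by simp
qed

text \<open>Integrability belongs to the notion because multiplication by coordinates destroys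
  boundedness of g; in this form no growth condition has to be carried through the polynomial
  induction.\<close>

definition herm_null :: "(real^'n::finite \<Rightarrow> complex) \<Rightarrow> bool" where
  "herm_null g \<longleftrightarrow> (\<forall>\<gamma>. integrable lborel (\<lambda>x. g x * hermite_fun \<gamma> x) \<and> integral\<^sup>L lborel (\<lambda>x. g x * hermite_fun \<gamma> x) = 0)"

lemma herm_null_zero: "herm_null (\<lambda>x. 0)"
  by (simp add: herm_null_def)

lemma herm_null_add: "herm_null g \<Longrightarrow> herm_null h \<Longrightarrow> herm_null (\<lambda>x. g x + h x)"
  by (simp add: herm_null_def distrib_right)

lemma herm_null_scale: "herm_null g \<Longrightarrow> herm_null (\<lambda>x. c * g x)"
  by (simp add: herm_null_def mult.assoc)

text \<open>The factor x_i is moved to the Hermite function, where half the sum of the two ladder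
  relations writes it as a combination of the neighbouring indices.\<close>

lemma herm_null_coord:
  assumes "herm_null g"
  shows "herm_null (\<lambda>x. complex_of_real (x $ i) * g x)"
  unfolding herm_null_def
proof (intro allI)
  fix \<gamma>
  define A where "A = complex_of_real (sqrt (2 * real (\<gamma> i))) / 2"
  define B where "B = complex_of_real (sqrt (2 * real (Suc (\<gamma> i)))) / 2"
  have e: "complex_of_real (x $ i) * g x * hermite_fun \<gamma> x = A * (g x * hermite_fun (\<gamma> - unit_mi i) x) + B * (g x * hermite_fun (\<gamma> + unit_mi i) x)" for x
  proof -
    have "2 * (complex_of_real (x $ i) * hermite_fun \<gamma> x) = 2 * A * hermite_fun (\<gamma> - unit_mi i) x + 2 * B * hermite_fun (\<gamma> + unit_mi i) x"
      using arg_cong2[of _ _ _ _ "(+)", OF hermite_fun_ladder(1)[of x i \<gamma>] hermite_fun_ladder(2)[of x i \<gamma>]]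
      unfolding A_def B_def by (simp add: mult.commute)
    then have "complex_of_real (x $ i) * hermite_fun \<gamma> x = A * hermite_fun (\<gamma> - unit_mi i) x + B * hermite_fun (\<gamma> + unit_mi i) x"
      by (simp only: mult.assoc distrib_left[symmetric] mult_cancel_left) simp
    then have "g x * (complex_of_real (x $ i) * hermite_fun \<gamma> x) = g x * (A * hermite_fun (\<gamma> - unit_mi i) x + B * hermite_fun (\<gamma> + unit_mi i) x)"
      by simp
    then show ?thesis by (simp only: distrib_left ac_simps)
  qed
  show "integrable lborel (\<lambda>x. complex_of_real (x $ i) * g x * hermite_fun \<gamma> x) \<and>
    integral\<^sup>L lborel (\<lambda>x. complex_of_real (x $ i) * g x * hermite_fun \<gamma> x) = 0"
    unfolding e using assms unfolding herm_null_def by simp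
qed

lemma herm_null_polynomial:
  fixes p :: "real^'n::finite \<Rightarrow> real"
  assumes "real_polynomial_function p" "herm_null g"
  shows "herm_null (\<lambda>x. complex_of_real (p x) * g x)"
  using assms
proof (induction arbitrary: g)
  case (linear p)
  interpret bounded_linear p by (rule linear(1))
  have p: "p x = (\<Sum>j\<in>UNIV. x $ j * p (axis j 1))" for x
  proof -
    have "x = (\<Sum>j\<in>UNIV. x $ j *\<^sub>R axis j 1)" using basis_expansion[of x] by (simp add: scalar_mult_eq_scaleR)
    then have "p x = p (\<Sum>j\<in>UNIV. x $ j *\<^sub>R axis j 1)" by simp
    then show ?thesis by (simp add: sum scaleR)
  qed
  have "herm_null (\<lambda>x. \<Sum>j\<in>A. complex_of_real (p (axis j 1)) * (complex_of_real (x $ j) * g x))" if "finite A" for A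
    using that
  proof induction
    case empty
    then show ?case by (simp add: herm_null_zero)
  next
    case (insert a A)
    show ?case unfolding sum.insert[OF insert.hyps]
      by (intro herm_null_add herm_null_scale herm_null_coord linear.prems insert.IH)
  qed
  moreover have "(\<lambda>x. complex_of_real (p x) * g x) = (\<lambda>x. \<Sum>j\<in>UNIV. complex_of_real (p (axis j 1)) * (complex_of_real (x $ j) * g x))"
    by (rule ext, subst p) (simp add: sum_distrib_right mult.assoc mult.left_commute)
  ultimately show ?case by simp
next
  case (const c)
  then show ?case by (rule herm_null_scale)
next
  case (add p q)
  show ?case unfolding of_real_add distrib_right by (intro herm_null_add add.IH add.prems)
next
  case (mult p q)
  show ?case unfolding of_real_mult mult.assoc by (intro mult.IH mult.prems)
qed

lemma hermite_complete:
  fixes f :: "real^'n::finite \<Rightarrow> complex"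
  assumes cont: "continuous_on UNIV f" and bd: "\<And>x. cmod (f x) \<le> K" and null: "\<And>\<gamma>. hermite_coeff \<gamma> f = 0"
  shows "f y = 0"
proof (rule gauss_null_imp_zero[OF cont bd])
  have m: "f \<in> borel_measurable borel" by (rule borel_measurable_continuous_onI[OF cont])
  have "herm_null f"
    unfolding herm_null_def using integrable_mult_hermite_fun[OF m bd] null by (simp add: hermite_coeff_def)
  show "gauss_null f (1 / 2)"
    unfolding gauss_null_def
  proof (intro allI impI)
    fix p :: "real^'n \<Rightarrow> real" assume "real_polynomial_function p"
    from herm_null_polynomial[OF this \<open>herm_null f\<close>]
    have 0: "integral\<^sup>L lborel (\<lambda>x. complex_of_real (p x) * f x * hermite_fun 0 x) = 0" by (simp add: herm_null_def)
    \<comment> \<open>The Hermite function of index 0 is a multiple of exp(-|x|^2/2), which explains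
      the starting exponent 1/2.\<close>
    have h: "hermite_fun 0 x = complex_of_real (1 / herm_norm 0 ^ CARD('n)) * complex_of_real (exp (- (1 / 2) * (norm x)\<^sup>2))" for x :: "real^'n"
    proof -
      have "(\<Prod>j\<in>UNIV. herm ((0 :: 'n \<Rightarrow> nat) j) (x $ j)) = exp (- (1 / 2) * (norm x)\<^sup>2) / herm_norm 0 ^ CARD('n)"
        unfolding exp_norm_power2 by (simp add: herm_def prod_dividef)
      then show ?thesis unfolding hermite_fun_eq by (simp add: field_simps)
    qed
    have "complex_of_real (1 / herm_norm 0 ^ CARD('n)) * integral\<^sup>L lborel (\<lambda>x. complex_of_real (p x * exp (- (1 / 2) * (norm x)\<^sup>2)) * f x) = 0"
      using 0 unfolding h by (simp add: mult_ac)
    then show "integral\<^sup>L lborel (\<lambda>x. complex_of_real (p x * exp (- (1 / 2) * (norm x)\<^sup>2)) * f x) = 0"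
      using herm_norm_pos[of 0] by simp
  qed
qed

section \<open>Convergence of Hermite series\<close>

lemma rho_nonneg: "0 \<le> rho \<gamma>"
  using rho_pos[of \<gamma>] by simp

lemma rho_summable: "(rho :: ('n::finite \<Rightarrow> nat) \<Rightarrow> real) summable_on UNIV"
proof -
  define B where "B = (\<Sum>k. 1 / (real k + 1) ^ 2)"
  have sm: "summable (\<lambda>k. 1 / (real k + 1) ^ 2)"
    using inverse_squares_sums by (simp add: sums_iff add.commute)
  have le: "(\<Sum>k\<in>{..m}. 1 / (real k + 1) ^ 2) \<le> B" for m
    unfolding B_def using sm by (intro sum_le_suminf) auto
  show ?thesis
  proof (rule nonneg_bdd_above_summable_on)
    show "bdd_above (sum rho ` {F :: ('n \<Rightarrow> nat) set. F \<subseteq> UNIV \<and> finite F})"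
    proof (rule bdd_aboveI2)
      fix F :: "('n \<Rightarrow> nat) set" assume "F \<in> {F. F \<subseteq> UNIV \<and> finite F}"
      then have F: "finite F" by simp
      \<comment> \<open>A crude componentwise upper bound of all members of F. It places F inside a
        box, over which the sum of the product \<open>rho\<close> factors into one-variable
        sums.\<close>
      define \<tau> where "\<tau> j = (\<Sum>\<gamma>\<in>F. \<gamma> j)" for j
      have "F \<subseteq> {..\<tau>}" using F by (auto simp: le_fun_def \<tau>_def intro!: member_le_sum)
      then have "sum rho F \<le> sum rho {..\<tau>}"
        by (intro sum_mono2 finite_atMost_mi rho_nonneg)
      also have "\<dots> = (\<Prod>j\<in>UNIV. \<Sum>k\<in>{..\<tau> j}. 1 / (real k + 1) ^ 2)"
        unfolding atMost_mi_eq_PiE rho_def by (subst prod_sum_PiE) auto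
      also have "\<dots> \<le> (\<Prod>j\<in>(UNIV::'n set). B)"
        by (intro prod_mono conjI le sum_nonneg) auto
      finally show "sum rho F \<le> (\<Prod>j\<in>(UNIV::'n set). B)" .
    qed
  qed (rule rho_nonneg)
qed

text \<open>The sum of \<open>rho\<close> over the complement of F. Every rate of convergence of
  Hermite series below is a multiple of this number.\<close>

definition rho_tail :: "('n::finite \<Rightarrow> nat) set \<Rightarrow> real" where
  "rho_tail F = infsum rho (UNIV :: ('n \<Rightarrow> nat) set) - sum rho F"

lemma rho_tail_tendsto: "((rho_tail :: ('n::finite \<Rightarrow> nat) set \<Rightarrow> real) \<longlongrightarrow> 0) (finite_subsets_at_top UNIV)"
proof -
  have "(sum rho \<longlongrightarrow> infsum rho (UNIV :: ('n \<Rightarrow> nat) set)) (finite_subsets_at_top (UNIV :: ('n \<Rightarrow> nat) set))"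
    using has_sum_infsum[OF rho_summable] unfolding has_sum_def .
  then have "((\<lambda>F. infsum rho (UNIV :: ('n \<Rightarrow> nat) set) - sum rho F) \<longlongrightarrow> infsum rho (UNIV :: ('n \<Rightarrow> nat) set) - infsum rho (UNIV :: ('n \<Rightarrow> nat) set)) (finite_subsets_at_top (UNIV :: ('n \<Rightarrow> nat) set))"
    by (intro tendsto_intros)
  then show ?thesis by (simp add: rho_tail_def[abs_def])
qed

lemma rho_tail_nonneg: "finite F \<Longrightarrow> 0 \<le> rho_tail F"
  unfolding rho_tail_def by (simp add: finite_sum_le_infsum[OF rho_summable] rho_nonneg)

lemma summable_on_rho_bound:
  fixes f :: "('n::finite \<Rightarrow> nat) \<Rightarrow> complex"
  assumes "\<And>\<gamma>. norm (f \<gamma>) \<le> C * rho \<gamma>"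
  shows "f summable_on A"
proof -
  have "(\<lambda>\<gamma>. C * rho \<gamma>) summable_on A"
    by (rule summable_on_cmult_right[OF summable_on_subset_banach[OF rho_summable]]) simp
  then have "(\<lambda>\<gamma>. norm (f \<gamma>)) summable_on A"
    using assms by (rule Infinite_Sum.abs_summable_on_comparison_test')
  then show ?thesis by (rule abs_summable_summable)
qed

lemma infsum_tail_bound:
  fixes f :: "('n::finite \<Rightarrow> nat) \<Rightarrow> complex"
  assumes bd: "\<And>\<gamma>. norm (f \<gamma>) \<le> C * rho \<gamma>" and F: "finite F"
  shows "norm (infsum f UNIV - sum f F) \<le> C * rho_tail F"
proof -
  have "infsum f (F \<union> - F) = infsum f F + infsum f (- F)"
    by (rule infsum_Un_disjoint) (auto intro: summable_on_rho_bound[OF bd])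
  then have 1: "infsum f UNIV - sum f F = infsum f (- F)" using F by (simp add: Compl_partition)
  have s: "rho summable_on A" for A by (rule summable_on_subset_banach[OF rho_summable]) simp
  have "infsum rho (F \<union> - F) = infsum rho F + infsum rho (- F)"
    by (rule infsum_Un_disjoint) (auto intro: s)
  then have 2: "rho_tail F = infsum rho (- F)" using F by (simp add: Compl_partition rho_tail_def)
  have sC: "(\<lambda>\<gamma>. C * rho \<gamma>) summable_on - F" by (rule summable_on_cmult_right[OF s])
  have a: "(\<lambda>\<gamma>. norm (f \<gamma>)) summable_on - F"
    using sC bd by (rule Infinite_Sum.abs_summable_on_comparison_test')
  have "norm (infsum f (- F)) \<le> infsum (\<lambda>\<gamma>. norm (f \<gamma>)) (- F)" using a by (rule norm_infsum_bound)
  also have "\<dots> \<le> infsum (\<lambda>\<gamma>. C * rho \<gamma>) (- F)" using a sC bd by (rule infsum_mono)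
  also have "\<dots> = C * infsum rho (- F)" by (rule infsum_cmult_right') 
  finally show ?thesis unfolding 1 2 .
qed

text \<open>An enumeration turns unordered sums over multi-indices into series over the naturals,
  the form in which \<open>has_derivative_series\<close> differentiates term by term.\<close>

lemma ex_bij_mi: "\<exists>e :: nat \<Rightarrow> ('n::finite \<Rightarrow> nat). bij e"
proof -
  have "inj (\<lambda>k::nat. \<lambda>_::'n. k)" by (auto simp: inj_on_def fun_eq_iff)
  then have "infinite (UNIV :: ('n \<Rightarrow> nat) set)" using range_inj_infinite infinite_super subset_UNIV by metis
  then have "bij_betw (from_nat_into (UNIV :: ('n \<Rightarrow> nat) set)) UNIV UNIV" 
    by (intro bij_betw_from_nat_into) (simp_all add: countableI_type)
  then show ?thesis by blast
qed

definition hseries :: "(('n::finite \<Rightarrow> nat) \<Rightarrow> complex) \<Rightarrow> real^'n \<Rightarrow> complex" where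
  "hseries c x = (\<Sum>\<^sub>\<infinity>\<gamma>. c \<gamma> * hermite_fun \<gamma> x)"

text \<open>For each \<beta> the majorant is independent of x. The Weierstrass test then makes every
  termwise derivative continuous, and uniform convergence of the next derivatives along an axis
  permits differentiation under the sum.\<close>

lemma partials_family_hseries:
  fixes c :: "('n::finite \<Rightarrow> nat) \<Rightarrow> complex"
  assumes "\<And>\<beta>. \<exists>C. \<forall>\<gamma> x. cmod (c \<gamma> * pder \<beta> (hermite_fun \<gamma>) x) \<le> C * rho \<gamma>"
  shows "partials_family (hseries c) (\<lambda>\<beta> x. \<Sum>\<^sub>\<infinity>\<gamma>. c \<gamma> * pder \<beta> (hermite_fun \<gamma>) x)"
  unfolding partials_family_def
proof (intro conjI allI)
  show "(\<lambda>x. \<Sum>\<^sub>\<infinity>\<gamma>. c \<gamma> * pder 0 (hermite_fun \<gamma>) x) = hseries c"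
    by (simp add: hseries_def fun_eq_iff pder_0[OF smooth_hermite_fun])
next
  fix \<beta> :: "'n \<Rightarrow> nat"
  obtain C where C: "\<And>\<gamma> x. cmod (c \<gamma> * pder \<beta> (hermite_fun \<gamma>) x) \<le> C * rho \<gamma>" using assms by blast
  show "continuous_on UNIV (\<lambda>x. \<Sum>\<^sub>\<infinity>\<gamma>. c \<gamma> * pder \<beta> (hermite_fun \<gamma>) x)"
  proof (rule uniform_limit_theorem)
    show "uniform_limit UNIV (\<lambda>F x. \<Sum>\<gamma>\<in>F. c \<gamma> * pder \<beta> (hermite_fun \<gamma>) x) (\<lambda>x. \<Sum>\<^sub>\<infinity>\<gamma>. c \<gamma> * pder \<beta> (hermite_fun \<gamma>) x) (finite_subsets_at_top UNIV)"
      by (rule Weierstrass_m_test_general[OF C summable_on_cmult_right[OF rho_summable]])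
    show "\<forall>\<^sub>F F in finite_subsets_at_top UNIV. continuous_on UNIV (\<lambda>x. \<Sum>\<gamma>\<in>F. c \<gamma> * pder \<beta> (hermite_fun \<gamma>) x)"
      by (intro always_eventually allI continuous_intros continuous_on_pder smooth_hermite_fun)
  qed simp
  fix i and x :: "real^'n"
  obtain C' where C': "\<And>\<gamma> x. cmod (c \<gamma> * pder (\<beta> + unit_mi i) (hermite_fun \<gamma>) x) \<le> C' * rho \<gamma>" using assms by blast
  obtain e :: "nat \<Rightarrow> ('n \<Rightarrow> nat)" where e: "bij e" using ex_bij_mi by blast
  have inj: "inj_on e A" for A using e by (auto simp: bij_def inj_on_def)
  define f where "f n t = c (e n) * pder \<beta> (hermite_fun (e n)) (x + t *\<^sub>R axis i 1)" for n t
  define b where "b n t = c (e n) * pder (\<beta> + unit_mi i) (hermite_fun (e n)) (x + t *\<^sub>R axis i 1)" for n t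
  define g' where "g' t = (\<Sum>\<^sub>\<infinity>\<gamma>. c \<gamma> * pder (\<beta> + unit_mi i) (hermite_fun \<gamma>) (x + t *\<^sub>R axis i 1))" for t
  have sums: "(\<lambda>n. u (e n)) sums infsum u UNIV" if "u summable_on UNIV" for u :: "('n \<Rightarrow> nat) \<Rightarrow> 'c::{comm_monoid_add,t2_space}"
  proof (rule has_sum_imp_sums)
    have "(u has_sum infsum u UNIV) UNIV" using that by (rule has_sum_infsum)
    then show "((\<lambda>n. u (e n)) has_sum infsum u UNIV) UNIV"
      using has_sum_reindex_bij_betw[OF e, of u] by simp
  qed
  have fs: "(\<lambda>n. f n t) sums (\<Sum>\<^sub>\<infinity>\<gamma>. c \<gamma> * pder \<beta> (hermite_fun \<gamma>) (x + t *\<^sub>R axis i 1))" for t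
    unfolding f_def by (rule sums[of "\<lambda>\<gamma>. c \<gamma> * pder \<beta> (hermite_fun \<gamma>) (x + t *\<^sub>R axis i 1)"]) (rule summable_on_rho_bound[OF C])
  have tail: "(\<lambda>n. rho_tail (e ` {..<n})) \<longlonglongrightarrow> 0"
  proof -
    have "(\<lambda>n. \<Sum>k<n. rho (e k)) \<longlonglongrightarrow> infsum rho (UNIV :: ('n \<Rightarrow> nat) set)"
      using sums[OF rho_summable] unfolding sums_def .
    then have "(\<lambda>n. infsum rho (UNIV :: ('n \<Rightarrow> nat) set) - (\<Sum>k<n. rho (e k))) \<longlonglongrightarrow> infsum rho (UNIV :: ('n \<Rightarrow> nat) set) - infsum rho (UNIV :: ('n \<Rightarrow> nat) set)" by (intro tendsto_intros)
    then show ?thesis by (simp add: rho_tail_def sum.reindex[OF inj])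
  qed
  have "\<exists>g. \<forall>t\<in>UNIV. (\<lambda>n. f n t) sums g t \<and> (g has_derivative (\<lambda>h. h *\<^sub>R g' t)) (at t within UNIV)"
  proof (rule has_derivative_series[where f' = "\<lambda>n t h. h *\<^sub>R b n t"])
    fix n t
    have "((\<lambda>t. pder \<beta> (hermite_fun (e n)) (x + t *\<^sub>R axis i 1)) has_vector_derivative pder (\<beta> + unit_mi i) (hermite_fun (e n)) (x + t *\<^sub>R axis i 1)) (at t)"
      by (rule directional_derivative_at[OF pder_has_vector_derivative[OF smooth_hermite_fun]])
    from has_vector_derivative_mult_right[OF this, of "c (e n)"]
    show "(f n has_derivative (\<lambda>h. h *\<^sub>R b n t)) (at t within UNIV)"
      unfolding has_vector_derivative_def f_def b_def by simp
  next
    fix \<epsilon> :: real assume \<epsilon>: "\<epsilon> > 0"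
    \<comment> \<open>The remainder of the differentiated series after n terms is bounded by this
      quantity simultaneously for all t.\<close>
    have "(\<lambda>n. C' * rho_tail (e ` {..<n})) \<longlonglongrightarrow> C' * 0" by (intro tendsto_intros tail)
    then have "\<forall>\<^sub>F n in sequentially. C' * rho_tail (e ` {..<n}) < \<epsilon>" using \<epsilon> order_tendstoD(2) by fastforce
    then show "\<forall>\<^sub>F n in sequentially. \<forall>t\<in>UNIV. \<forall>h. norm ((\<Sum>k<n. h *\<^sub>R b k t) - h *\<^sub>R g' t) \<le> \<epsilon> * norm h"
    proof eventually_elim
      case (elim n)
      show ?case
      proof (intro ballI allI)
        fix t h
        have "norm (g' t - (\<Sum>\<gamma>\<in>e ` {..<n}. c \<gamma> * pder (\<beta> + unit_mi i) (hermite_fun \<gamma>) (x + t *\<^sub>R axis i 1))) \<le> C' * rho_tail (e ` {..<n})"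
          unfolding g'_def by (rule infsum_tail_bound[OF C']) simp
        then have "norm (g' t - (\<Sum>k<n. b k t)) \<le> \<epsilon>"
          using elim by (simp add: sum.reindex[OF inj] b_def del: plus_fun_apply)
        then have "\<bar>h\<bar> * norm ((\<Sum>k<n. b k t) - g' t) \<le> \<bar>h\<bar> * \<epsilon>"
          by (intro mult_left_mono) (auto simp: norm_minus_commute)
        then show "norm ((\<Sum>k<n. h *\<^sub>R b k t) - h *\<^sub>R g' t) \<le> \<epsilon> * norm h"
          by (simp add: scaleR_sum_right[symmetric] scaleR_diff_right[symmetric] mult.commute)
      qed
    qed
  qed (use fs[of 0] in auto)
  then obtain g where g: "\<And>t. (\<lambda>n. f n t) sums g t" "\<And>t. (g has_derivative (\<lambda>h. h *\<^sub>R g' t)) (at t)" by auto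
  have "g t = (\<Sum>\<^sub>\<infinity>\<gamma>. c \<gamma> * pder \<beta> (hermite_fun \<gamma>) (x + t *\<^sub>R axis i 1))" for t
    using sums_unique2[OF g(1) fs] .
  then have "g = (\<lambda>t. \<Sum>\<^sub>\<infinity>\<gamma>. c \<gamma> * pder \<beta> (hermite_fun \<gamma>) (x + t *\<^sub>R axis i 1))" by (rule ext)
  moreover have "(g has_vector_derivative g' 0) (at 0)"
    unfolding has_vector_derivative_def by (rule g(2))
  moreover have "g' 0 = (\<Sum>\<^sub>\<infinity>\<gamma>. c \<gamma> * pder (\<beta> + unit_mi i) (hermite_fun \<gamma>) x)" by (simp add: g'_def del: plus_fun_apply)
  ultimately show "((\<lambda>t. \<Sum>\<^sub>\<infinity>\<gamma>. c \<gamma> * pder \<beta> (hermite_fun \<gamma>) (x + t *\<^sub>R axis i 1)) has_vector_derivative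
            (\<Sum>\<^sub>\<infinity>\<gamma>. c \<gamma> * pder (\<beta> + unit_mi i) (hermite_fun \<gamma>) x)) (at 0)" by simp
qed

lemma partials_family_hermite_sum:
  fixes c :: "('n::finite \<Rightarrow> nat) \<Rightarrow> complex"
  shows "partials_family (\<lambda>x. \<Sum>\<gamma>\<in>F. c \<gamma> * hermite_fun \<gamma> x) (\<lambda>\<beta> x. \<Sum>\<gamma>\<in>F. c \<gamma> * pder \<beta> (hermite_fun \<gamma>) x)"
  unfolding partials_family_def
  by (auto simp: pder_0[OF smooth_hermite_fun] intro!: continuous_intros continuous_on_pder[OF smooth_hermite_fun]
      has_vector_derivative_sum has_vector_derivative_mult_right pder_has_vector_derivative[OF smooth_hermite_fun])

lemma hermite_coeff_lincomb:
  assumes "f \<in> borel_measurable borel" "\<And>x. cmod (f x) \<le> K" "g \<in> borel_measurable borel" "\<And>x. cmod (g x) \<le> L"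
  shows "hermite_coeff \<gamma> (\<lambda>x. a * f x + b * g x) = a * hermite_coeff \<gamma> f + b * hermite_coeff \<gamma> g"
  unfolding hermite_coeff_def
  using integrable_mult_hermite_fun[OF assms(1,2), of \<gamma>] integrable_mult_hermite_fun[OF assms(3,4), of \<gamma>]
  by (simp add: distrib_right mult.assoc)

definition hermite_L1 :: "('n::finite \<Rightarrow> nat) \<Rightarrow> real" where
  "hermite_L1 \<gamma> = integral\<^sup>L lborel (\<lambda>x. cmod (hermite_fun \<gamma> x))"

lemma hermite_L1_nonneg: "0 \<le> hermite_L1 \<gamma>"
  unfolding hermite_L1_def by (simp add: Bochner_Integration.integral_nonneg)

lemma hermite_coeff_sup_bound:
  assumes "f \<in> borel_measurable borel" "\<And>x. cmod (f x) \<le> K"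
  shows "cmod (hermite_coeff \<gamma> f) \<le> K * hermite_L1 \<gamma>"
proof -
  have i: "integrable lborel (hermite_fun \<gamma>)" using integrable_mult_hermite_fun[of "\<lambda>_. 1" 1 \<gamma>] by simp
  have "cmod (hermite_coeff \<gamma> f) \<le> integral\<^sup>L lborel (\<lambda>x. K * cmod (hermite_fun \<gamma> x))"
    unfolding hermite_coeff_def
    by (rule Bochner_Integration.integral_norm_bound_integral[OF integrable_mult_hermite_fun[OF assms]])
       (use i assms(2) in \<open>auto simp: norm_mult intro!: mult_right_mono\<close>)
  then show ?thesis by (simp add: hermite_L1_def)
qed

lemma hermite_coeff_sum:
  assumes "finite F"
  shows "hermite_coeff \<delta> (\<lambda>x. \<Sum>\<gamma>\<in>F. c \<gamma> * hermite_fun \<gamma> x) = (if \<delta> \<in> F then c \<delta> else 0)"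
proof -
  have i: "integrable lborel (\<lambda>x. hermite_fun \<gamma> x * hermite_fun \<delta> x)" for \<gamma>
  proof -
    obtain C where C: "C \<ge> 0" "\<And>x. cmod (hermite_fun \<gamma> x) \<le> C * decay x" using hermite_fun_decay by blast
    have "cmod (hermite_fun \<gamma> x) \<le> C * 1" for x
      using C(2)[of x] mult_left_mono[OF decay_le_1 C(1)] by (rule order.trans)
    then show ?thesis by (rule integrable_mult_hermite_fun[OF borel_measurable_smooth[OF smooth_hermite_fun]])
  qed
  have "hermite_coeff \<delta> (\<lambda>x. \<Sum>\<gamma>\<in>F. c \<gamma> * hermite_fun \<gamma> x) = (\<Sum>\<gamma>\<in>F. c \<gamma> * hermite_coeff \<delta> (hermite_fun \<gamma>))"
    unfolding hermite_coeff_def sum_distrib_right mult.assoc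
    by (subst Bochner_Integration.integral_sum) (use i in auto)
  also have "\<dots> = (if \<delta> \<in> F then c \<delta> else 0)"
    unfolding hermite_coeff_hermite_fun using assms by (simp add: if_distrib cong: if_cong)
  finally show ?thesis .
qed

text \<open>Since \<open>rho\<close> does not depend on \<alpha> and \<beta>, the remainder after a
  finite set F is small for all of them at once, hence in a single weighted norm. The empty set F
  bounds the sum of the series itself.\<close>

lemma hseries_estimate:
  fixes c :: "('n::finite \<Rightarrow> nat) \<Rightarrow> complex"
  assumes bd: "\<And>\<alpha> \<beta> \<gamma> x. cmod (complex_of_real (xpow x \<alpha>) * (c \<gamma> * pder \<beta> (hermite_fun \<gamma>) x)) \<le> v (\<alpha> + \<beta>) * rho \<gamma>"
    and F: "finite F"
  shows "gs_le (\<lambda>x. (\<Sum>\<gamma>\<in>F. c \<gamma> * hermite_fun \<gamma> x) - hseries c x) (\<lambda>\<sigma>. v \<sigma> * rho_tail F)"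
proof -
  have P: "partials_family (hseries c) (\<lambda>\<beta> x. \<Sum>\<^sub>\<infinity>\<gamma>. c \<gamma> * pder \<beta> (hermite_fun \<gamma>) x)"
  proof (rule partials_family_hseries)
    fix \<beta> show "\<exists>C. \<forall>\<gamma> x. cmod (c \<gamma> * pder \<beta> (hermite_fun \<gamma>) x) \<le> C * rho \<gamma>"
      using bd[of _ 0 _ \<beta>] by (intro exI[of _ "v \<beta>"]) simp
  qed
  have eq: "(\<lambda>x. (\<Sum>\<gamma>\<in>F. c \<gamma> * hermite_fun \<gamma> x) - hseries c x) = (\<lambda>x. 1 * (\<Sum>\<gamma>\<in>F. c \<gamma> * hermite_fun \<gamma> x) + (- 1) * hseries c x)"
    by simp
  note sm = partials_family_smooth[OF partials_family_hermite_sum] partials_family_smooth[OF P]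
  show ?thesis
    unfolding gs_le_def eq
  proof (intro conjI allI)
    show "smooth (\<lambda>x. 1 * (\<Sum>\<gamma>\<in>F. c \<gamma> * hermite_fun \<gamma> x) + (- 1) * hseries c x)" by (rule smooth_lincomb[OF sm])
    fix \<alpha> \<beta> :: "'n \<Rightarrow> nat" and x
    define u where "u \<gamma> = complex_of_real (xpow x \<alpha>) * (c \<gamma> * pder \<beta> (hermite_fun \<gamma>) x)" for \<gamma>
    have "complex_of_real (xpow x \<alpha>) * pder \<beta> (\<lambda>x. 1 * (\<Sum>\<gamma>\<in>F. c \<gamma> * hermite_fun \<gamma> x) + (- 1) * hseries c x) x
       = complex_of_real (xpow x \<alpha>) * ((\<Sum>\<gamma>\<in>F. c \<gamma> * pder \<beta> (hermite_fun \<gamma>) x) - (\<Sum>\<^sub>\<infinity>\<gamma>. c \<gamma> * pder \<beta> (hermite_fun \<gamma>) x))"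
      unfolding pder_lincomb[OF sm] pder_eq[OF P] pder_eq[OF partials_family_hermite_sum] by simp
    also have "\<dots> = sum u F - infsum u UNIV"
      unfolding u_def sum_distrib_left[symmetric] infsum_cmult_right' by (simp add: right_diff_distrib)
    also have "cmod \<dots> \<le> v (\<alpha> + \<beta>) * rho_tail F"
      using infsum_tail_bound[of u "v (\<alpha> + \<beta>)" F] bd F unfolding u_def by (simp add: norm_minus_commute del: plus_fun_apply)
    finally show "cmod (complex_of_real (xpow x \<alpha>) * pder \<beta> (\<lambda>x. 1 * (\<Sum>\<gamma>\<in>F. c \<gamma> * hermite_fun \<gamma> x) + (- 1) * hseries c x) x)
       \<le> v (\<alpha> + \<beta>) * rho_tail F" .
  qed
qed

lemma gs_le_uminus: "gs_le f w \<Longrightarrow> gs_le (\<lambda>x. - f x) w"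
proof -
  assume f: "gs_le f w"
  have e: "(\<lambda>x. - f x) = (\<lambda>x. (- 1) * f x + 0 * f x)" by simp
  show ?thesis unfolding gs_le_def e using gs_le_smooth[OF f] gs_leD[OF f]
    by (simp only: smooth_lincomb pder_lincomb) simp
qed

lemma gs_le_hseries:
  fixes c :: "('n::finite \<Rightarrow> nat) \<Rightarrow> complex"
  assumes bd: "\<And>\<alpha> \<beta> \<gamma> x. cmod (complex_of_real (xpow x \<alpha>) * (c \<gamma> * pder \<beta> (hermite_fun \<gamma>) x)) \<le> v (\<alpha> + \<beta>) * rho \<gamma>"
  shows "gs_le (hseries c) (\<lambda>\<sigma>. v \<sigma> * rho_tail ({} :: ('n \<Rightarrow> nat) set))"
  using gs_le_uminus[OF hseries_estimate[OF bd, of "{}"]] by simp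

text \<open>A coefficient functional is continuous for the sup norm, with constant
  \<open>hermite_L1\<close>. On partial sums containing \<delta> it has the value
  \<open>c \<delta>\<close>, and the remainder tends to 0 uniformly.\<close>

lemma hermite_coeff_hseries:
  fixes c :: "('n::finite \<Rightarrow> nat) \<Rightarrow> complex"
  assumes bd: "\<And>\<alpha> \<beta> \<gamma> x. cmod (complex_of_real (xpow x \<alpha>) * (c \<gamma> * pder \<beta> (hermite_fun \<gamma>) x)) \<le> v (\<alpha> + \<beta>) * rho \<gamma>"
  shows "hermite_coeff \<delta> (hseries c) = c \<delta>"
proof -
  let ?h = "hseries c"
  define S where "S F x = (\<Sum>\<gamma>\<in>F. c \<gamma> * hermite_fun \<gamma> x)" for F x
  have h: "gs_le ?h (\<lambda>\<sigma>. v \<sigma> * rho_tail ({} :: ('n \<Rightarrow> nat) set))" by (rule gs_le_hseries[OF bd])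
  have hm: "?h \<in> borel_measurable borel" by (rule borel_measurable_smooth[OF gs_le_smooth[OF h]])
  have le: "cmod (c \<delta> - hermite_coeff \<delta> ?h) \<le> (v 0 * hermite_L1 \<delta>) * rho_tail F" if F: "finite F" "\<delta> \<in> F" for F
  proof -
    define r where "r x = S F x - ?h x" for x
    have r: "gs_le r (\<lambda>\<sigma>. v \<sigma> * rho_tail F)" unfolding r_def S_def by (rule hseries_estimate[OF bd F(1)])
    have rm: "r \<in> borel_measurable borel" by (rule borel_measurable_smooth[OF gs_le_smooth[OF r]])
    have "S F = (\<lambda>x. 1 * r x + 1 * ?h x)" by (simp add: r_def fun_eq_iff)
    then have "hermite_coeff \<delta> (S F) = 1 * hermite_coeff \<delta> r + 1 * hermite_coeff \<delta> ?h"
      using hermite_coeff_lincomb[OF rm gs_le_bound[OF r] hm gs_le_bound[OF h], of \<delta> 1 1] by simp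
    moreover have "hermite_coeff \<delta> (S F) = c \<delta>" unfolding S_def using hermite_coeff_sum[OF F(1), of \<delta> c] F(2) by simp
    ultimately have "c \<delta> - hermite_coeff \<delta> ?h = hermite_coeff \<delta> r" by simp
    then show ?thesis using hermite_coeff_sup_bound[OF rm gs_le_bound[OF r], of \<delta>] by (simp add: mult_ac)
  qed
  have "((\<lambda>F. (v 0 * hermite_L1 \<delta>) * rho_tail F) \<longlongrightarrow> (v 0 * hermite_L1 \<delta>) * 0) (finite_subsets_at_top (UNIV :: ('n \<Rightarrow> nat) set))"
    by (intro tendsto_intros rho_tail_tendsto)
  moreover have "\<forall>\<^sub>F F in finite_subsets_at_top (UNIV :: ('n \<Rightarrow> nat) set). cmod (c \<delta> - hermite_coeff \<delta> ?h) \<le> (v 0 * hermite_L1 \<delta>) * rho_tail F"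
    unfolding eventually_finite_subsets_at_top by (rule exI[of _ "{\<delta>}"]) (use le in auto)
  ultimately have "cmod (c \<delta> - hermite_coeff \<delta> ?h) \<le> (v 0 * hermite_L1 \<delta>) * 0"
    by (rule tendsto_lowerbound) simp
  then show ?thesis by simp
qed

section \<open>Inductive and projective limit topologies\<close>

definition lin_space :: "('a \<Rightarrow> complex) set \<Rightarrow> bool" where
  "lin_space X \<longleftrightarrow> (\<forall>u\<in>X. \<forall>v\<in>X. \<forall>a b. (\<lambda>x. a * u x + b * v x) \<in> X)"

lemma lin_spaceD: "lin_space X \<Longrightarrow> u \<in> X \<Longrightarrow> v \<in> X \<Longrightarrow> (\<lambda>x. a * u x + b * v x) \<in> X"
  by (simp add: lin_space_def)

lemma lin_space_add: "lin_space X \<Longrightarrow> u \<in> X \<Longrightarrow> v \<in> X \<Longrightarrow> (\<lambda>x. u x + v x) \<in> X"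
  using lin_spaceD[of X u v 1 1] by simp

lemma lin_space_diff: "lin_space X \<Longrightarrow> u \<in> X \<Longrightarrow> v \<in> X \<Longrightarrow> (\<lambda>x. u x - v x) \<in> X"
  using lin_spaceD[of X u v 1 "- 1"] by simp

lemma lin_space_scale: "lin_space X \<Longrightarrow> u \<in> X \<Longrightarrow> (\<lambda>x. a * u x) \<in> X"
  using lin_spaceD[of X u u a 0] by simp

lemma lin_space_sum:
  assumes X: "lin_space X" "u \<in> X" and e: "\<And>i. i \<in> F \<Longrightarrow> e i \<in> X"
  shows "(\<lambda>x. \<Sum>i\<in>F. c i * e i x) \<in> X"
  using e
proof (induction F rule: infinite_finite_induct)
  case (insert i F)
  then show ?case using lin_spaceD[OF X(1), of "e i" "\<lambda>x. \<Sum>i\<in>F. c i * e i x" "c i" 1] by simp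
qed (use lin_space_scale[OF X, of 0] in simp_all)

definition linear_on :: "('a \<Rightarrow> complex) set \<Rightarrow> (('a \<Rightarrow> complex) \<Rightarrow> ('b \<Rightarrow> complex)) \<Rightarrow> bool" where
  "linear_on X T \<longleftrightarrow> (\<forall>f\<in>X. \<forall>g\<in>X. \<forall>a b. T (\<lambda>x. a * f x + b * g x) = (\<lambda>y. a * T f y + b * T g y))"

lemma linear_onD:
  "linear_on X T \<Longrightarrow> f \<in> X \<Longrightarrow> g \<in> X \<Longrightarrow> T (\<lambda>x. a * f x + b * g x) = (\<lambda>y. a * T f y + b * T g y)"
  by (simp add: linear_on_def)

lemma linear_on_add: "linear_on X T \<Longrightarrow> f \<in> X \<Longrightarrow> g \<in> X \<Longrightarrow> T (\<lambda>x. f x + g x) = (\<lambda>y. T f y + T g y)"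
  using linear_onD[of X T f g 1 1] by simp

lemma linear_on_diff: "linear_on X T \<Longrightarrow> f \<in> X \<Longrightarrow> g \<in> X \<Longrightarrow> T (\<lambda>x. f x - g x) = (\<lambda>y. T f y - T g y)"
  using linear_onD[of X T f g 1 "- 1"] by simp

lemma linear_on_inverse:
  assumes T: "linear_on X T" and X: "lin_space X" and R: "\<And>c. c \<in> Y \<Longrightarrow> R c \<in> X"
    and inv: "\<And>f. f \<in> X \<Longrightarrow> R (T f) = f" "\<And>c. c \<in> Y \<Longrightarrow> T (R c) = c"
  shows "linear_on Y R"
  unfolding linear_on_def
proof (intro ballI allI)
  fix c d a b assume c: "c \<in> Y" and d: "d \<in> Y"
  have "T (\<lambda>x. a * R c x + b * R d x) = (\<lambda>y. a * c y + b * d y)"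
    using linear_onD[OF T R[OF c] R[OF d]] inv(2)[OF c] inv(2)[OF d] by simp
  then show "R (\<lambda>y. a * c y + b * d y) = (\<lambda>x. a * R c x + b * R d x)"
    using inv(1)[OF lin_spaceD[OF X R[OF c] R[OF d], of a b]] by simp
qed

definition ind_nhd :: "('a \<Rightarrow> complex) set \<Rightarrow> 'i set \<Rightarrow> ('i \<Rightarrow> ('a \<Rightarrow> complex) \<Rightarrow> ereal) \<Rightarrow> ('a \<Rightarrow> complex) set \<Rightarrow> bool" where
  "ind_nhd X I N V \<longleftrightarrow> V \<subseteq> X \<and> abs_convex V \<and> (\<forall>i\<in>I. \<exists>\<epsilon>>0. \<forall>g\<in>X. N i g < ereal \<epsilon> \<longrightarrow> g \<in> V)"

lemma ind_nhd_Int: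
  assumes "ind_nhd X I N V" "ind_nhd X I N W"
  shows "ind_nhd X I N (V \<inter> W)"
  unfolding ind_nhd_def
proof (intro conjI ballI)
  show "abs_convex (V \<inter> W)" using assms by (auto simp: ind_nhd_def abs_convex_def)
  fix i assume "i \<in> I"
  then obtain \<epsilon> \<delta> where "\<epsilon> > 0" "\<delta> > 0" and ed: "\<And>g. g \<in> X \<Longrightarrow> N i g < ereal \<epsilon> \<Longrightarrow> g \<in> V" "\<And>g. g \<in> X \<Longrightarrow> N i g < ereal \<delta> \<Longrightarrow> g \<in> W"
    using assms unfolding ind_nhd_def by meson
  then have "min \<epsilon> \<delta> > 0" by simp
  moreover have "g \<in> V \<inter> W" if "g \<in> X" "N i g < ereal (min \<epsilon> \<delta>)" for g
  proof -
    have "ereal (min \<epsilon> \<delta>) \<le> ereal \<epsilon>" "ereal (min \<epsilon> \<delta>) \<le> ereal \<delta>" by auto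
    then show ?thesis using ed that by (meson IntI less_le_trans)
  qed
  ultimately show "\<exists>\<epsilon>>0. \<forall>g\<in>X. N i g < ereal \<epsilon> \<longrightarrow> g \<in> V \<inter> W" by blast
qed (use assms in \<open>auto simp: ind_nhd_def\<close>)

text \<open>\<open>topology\<close> returns the described open sets only after the predicate has
  been shown to be closed under intersections and unions; \<open>ind_nhd_Int\<close> supplies the
  intersections.\<close>

lemma openin_ind_top:
  "openin (ind_top X I N) U \<longleftrightarrow> U \<subseteq> X \<and> (\<forall>f\<in>U. \<exists>V. ind_nhd X I N V \<and> (\<lambda>g x. f x + g x) ` V \<subseteq> U)"
proof -
  let ?P = "\<lambda>U. U \<subseteq> X \<and> (\<forall>f\<in>U. \<exists>V. ind_nhd X I N V \<and> (\<lambda>g x. f x + g x) ` V \<subseteq> U)"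
  have "istopology ?P"
    unfolding istopology_def
  proof (intro conjI allI impI)
    fix S T assume S: "?P S" and T: "?P T"
    show "S \<inter> T \<subseteq> X" using S by blast
    show "\<forall>f\<in>S \<inter> T. \<exists>V. ind_nhd X I N V \<and> (\<lambda>g x. f x + g x) ` V \<subseteq> S \<inter> T"
    proof
      fix f assume f: "f \<in> S \<inter> T"
      then obtain V where V: "ind_nhd X I N V" "(\<lambda>g x. f x + g x) ` V \<subseteq> S" using S by blast
      obtain W where W: "ind_nhd X I N W" "(\<lambda>g x. f x + g x) ` W \<subseteq> T" using f T by blast
      have "(\<lambda>g x. f x + g x) ` (V \<inter> W) \<subseteq> S \<inter> T" using V(2) W(2) by blast
      then show "\<exists>V. ind_nhd X I N V \<and> (\<lambda>g x. f x + g x) ` V \<subseteq> S \<inter> T" using ind_nhd_Int[OF V(1) W(1)] by blast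
    qed
  next
    fix \<K> assume K: "\<forall>K\<in>\<K>. ?P K"
    then show "\<Union>\<K> \<subseteq> X" by blast
    show "\<forall>f\<in>\<Union>\<K>. \<exists>V. ind_nhd X I N V \<and> (\<lambda>g x. f x + g x) ` V \<subseteq> \<Union>\<K>"
    proof
      fix f assume "f \<in> \<Union>\<K>"
      then obtain U where U: "U \<in> \<K>" "f \<in> U" by blast
      then obtain V where V: "ind_nhd X I N V" "(\<lambda>g x. f x + g x) ` V \<subseteq> U" using K by blast
      then show "\<exists>V. ind_nhd X I N V \<and> (\<lambda>g x. f x + g x) ` V \<subseteq> \<Union>\<K>" using U(1) by blast
    qed
  qed
  moreover have "ind_top X I N = topology ?P"
    unfolding ind_top_def ind_nhd_def by (simp only: conj_assoc)
  ultimately show ?thesis by (simp add: topology_inverse')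
qed

lemma topspace_ind_top:
  assumes X: "lin_space X"
  shows "topspace (ind_top X I N) = X"
proof -
  have "ind_nhd X I N X"
    unfolding ind_nhd_def abs_convex_def using lin_spaceD[OF X] by (auto intro: exI[of _ 1])
  then have "openin (ind_top X I N) X"
    unfolding openin_ind_top using lin_space_add[OF X] by blast
  moreover have "U \<subseteq> X" if "openin (ind_top X I N) U" for U using that by (simp add: openin_ind_top)
  ultimately show ?thesis by (meson openin_subset openin_topspace subset_antisym)
qed

lemma openin_proj_top:
  "openin (proj_top X I N) U \<longleftrightarrow> U \<subseteq> X \<and> (\<forall>f\<in>U. \<exists>F \<epsilon>. finite F \<and> F \<subseteq> I \<and> \<epsilon> > 0 \<and>
      {g\<in>X. \<forall>i\<in>F. N i (\<lambda>x. g x - f x) < ereal \<epsilon>} \<subseteq> U)"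
proof -
  let ?Q = "\<lambda>U f. \<exists>F \<epsilon>. finite F \<and> F \<subseteq> I \<and> \<epsilon> > 0 \<and> {g\<in>X. \<forall>i\<in>F. N i (\<lambda>x. g x - f x) < ereal \<epsilon>} \<subseteq> U"
  let ?P = "\<lambda>U. U \<subseteq> X \<and> (\<forall>f\<in>U. ?Q U f)"
  have "istopology ?P"
    unfolding istopology_def
  proof (intro conjI allI impI)
    fix S T assume S: "?P S" and T: "?P T"
    show "S \<inter> T \<subseteq> X" using S by blast
    show "\<forall>f\<in>S \<inter> T. ?Q (S \<inter> T) f"
    proof
      fix f assume f: "f \<in> S \<inter> T"
      then obtain F \<epsilon> where F: "finite F" "F \<subseteq> I" "\<epsilon> > 0" "{g\<in>X. \<forall>i\<in>F. N i (\<lambda>x. g x - f x) < ereal \<epsilon>} \<subseteq> S"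
        using S by blast
      obtain G \<delta> where G: "finite G" "G \<subseteq> I" "\<delta> > 0" "{g\<in>X. \<forall>i\<in>G. N i (\<lambda>x. g x - f x) < ereal \<delta>} \<subseteq> T"
        using f T by blast
      have m: "ereal (min \<epsilon> \<delta>) \<le> ereal \<epsilon>" "ereal (min \<epsilon> \<delta>) \<le> ereal \<delta>" by auto
      have "{g\<in>X. \<forall>i\<in>F \<union> G. N i (\<lambda>x. g x - f x) < ereal (min \<epsilon> \<delta>)} \<subseteq> S \<inter> T"
      proof
        fix g assume g: "g \<in> {g\<in>X. \<forall>i\<in>F \<union> G. N i (\<lambda>x. g x - f x) < ereal (min \<epsilon> \<delta>)}"
        then have "g \<in> {g\<in>X. \<forall>i\<in>F. N i (\<lambda>x. g x - f x) < ereal \<epsilon>}" using less_le_trans[OF _ m(1)] by blast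
        moreover have "g \<in> {g\<in>X. \<forall>i\<in>G. N i (\<lambda>x. g x - f x) < ereal \<delta>}" using g less_le_trans[OF _ m(2)] by blast
        ultimately show "g \<in> S \<inter> T" using F(4) G(4) by blast
      qed
      moreover have "finite (F \<union> G)" "F \<union> G \<subseteq> I" "min \<epsilon> \<delta> > 0" using F G by auto
      ultimately show "?Q (S \<inter> T) f" by blast
    qed
  next
    fix \<K> assume K: "\<forall>K\<in>\<K>. ?P K"
    then show "\<Union>\<K> \<subseteq> X" by blast
    show "\<forall>f\<in>\<Union>\<K>. ?Q (\<Union>\<K>) f"
    proof
      fix f assume "f \<in> \<Union>\<K>"
      then obtain U where U: "U \<in> \<K>" "f \<in> U" by blast
      then have "?Q U f" using K by blast
      then obtain F \<epsilon> where F: "finite F" "F \<subseteq> I" "\<epsilon> > 0" "{g\<in>X. \<forall>i\<in>F. N i (\<lambda>x. g x - f x) < ereal \<epsilon>} \<subseteq> U"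
        by blast
      then have "{g\<in>X. \<forall>i\<in>F. N i (\<lambda>x. g x - f x) < ereal \<epsilon>} \<subseteq> \<Union>\<K>" using U(1) by blast
      then show "?Q (\<Union>\<K>) f" using F by blast
    qed
  qed
  then show ?thesis unfolding proj_top_def by (simp only: topology_inverse')
qed

lemma topspace_proj_top: "topspace (proj_top X I N) = X"
proof -
  have "openin (proj_top X I N) X"
    unfolding openin_proj_top by (auto intro!: exI[of _ "{}"] exI[of _ 1])
  moreover have "U \<subseteq> X" if "openin (proj_top X I N) U" for U using that by (simp add: openin_proj_top)
  ultimately show ?thesis by (meson openin_subset openin_topspace subset_antisym)
qed

text \<open>By linearity the preimage of an absolutely convex set is absolutely convex, so it
  suffices that every source step is mapped boundedly into some target step. The bound is phrased
  with real K because the norm of one step may be infinite on members of another.\<close>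

lemma continuous_map_ind_top:
  assumes X: "lin_space X" and Y: "lin_space Y" and TY: "\<And>f. f \<in> X \<Longrightarrow> T f \<in> Y" and T: "linear_on X T"
    and bd: "\<And>i. i \<in> I \<Longrightarrow> \<exists>j\<in>J. \<exists>C>0. \<forall>f\<in>X. \<forall>K\<ge>0. N i f \<le> ereal K \<longrightarrow> P j (T f) \<le> ereal (C * K)"
  shows "continuous_map (ind_top X I N) (ind_top Y J P) T"
  unfolding continuous_map_def topspace_ind_top[OF X] topspace_ind_top[OF Y]
proof (intro conjI allI impI)
  show "T \<in> X \<rightarrow> Y" using TY by blast
  fix U assume U: "openin (ind_top Y J P) U"
  show "openin (ind_top X I N) {x \<in> X. T x \<in> U}"
    unfolding openin_ind_top
  proof (intro conjI ballI)
    fix f assume "f \<in> {x \<in> X. T x \<in> U}"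
    then have f: "f \<in> X" "T f \<in> U" by auto
    obtain V where V: "ind_nhd Y J P V" "(\<lambda>g x. T f x + g x) ` V \<subseteq> U" using U f(2) unfolding openin_ind_top by blast
    define W where "W = {g \<in> X. T g \<in> V}"
    have "ind_nhd X I N W"
      unfolding ind_nhd_def
    proof (intro conjI ballI)
      show "abs_convex W"
        unfolding abs_convex_def
      proof (intro ballI allI impI)
        fix u v and a b :: complex assume u: "u \<in> W" and v: "v \<in> W" and ab: "cmod a + cmod b \<le> 1"
        have "(\<lambda>y. a * T u y + b * T v y) \<in> V" using V(1) u v ab unfolding ind_nhd_def abs_convex_def W_def by blast
        then show "(\<lambda>x. a * u x + b * v x) \<in> W"
          using u v lin_spaceD[OF X, of u v a b] linear_onD[OF T, of u v a b] by (simp add: W_def)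
      qed
      fix i assume "i \<in> I"
      then obtain j C where j: "j \<in> J" "C > 0" and C: "\<And>f K. f \<in> X \<Longrightarrow> K \<ge> 0 \<Longrightarrow> N i f \<le> ereal K \<Longrightarrow> P j (T f) \<le> ereal (C * K)"
        using bd by meson
      obtain \<epsilon> where \<epsilon>: "\<epsilon> > 0" "\<And>g. g \<in> Y \<Longrightarrow> P j g < ereal \<epsilon> \<Longrightarrow> g \<in> V" using V(1) j(1) unfolding ind_nhd_def by meson
      \<comment> \<open>The hypothesis transfers only weak inequalities; half of the radius restores
        a strict one. The same halving occurs in the other continuity lemmas.\<close>
      have "g \<in> W" if g: "g \<in> X" "N i g < ereal (\<epsilon> / (2 * C))" for g
      proof -
        have "P j (T g) \<le> ereal (C * (\<epsilon> / (2 * C)))" by (rule C[OF g(1)]) (use g(2) \<epsilon>(1) j in auto)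
        also have "\<dots> < ereal \<epsilon>" using \<epsilon>(1) j by simp
        finally show ?thesis using \<epsilon>(2)[OF TY[OF g(1)]] g(1) by (simp add: W_def)
      qed
      moreover have "\<epsilon> / (2 * C) > 0" using \<epsilon> j by simp
      ultimately show "\<exists>\<epsilon>>0. \<forall>g\<in>X. N i g < ereal \<epsilon> \<longrightarrow> g \<in> W" by blast
    qed (auto simp: W_def)
    moreover have "(\<lambda>g x. f x + g x) ` W \<subseteq> {x \<in> X. T x \<in> U}"
      using V(2) f lin_space_add[OF X] linear_on_add[OF T] by (auto simp: W_def)
    ultimately show "\<exists>V. ind_nhd X I N V \<and> (\<lambda>g x. f x + g x) ` V \<subseteq> {x \<in> X. T x \<in> U}" by blast
  qed auto
qed

text \<open>Here the target norm is given first and a source norm has to dominate it. A basic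
  neighbourhood involves finitely many target norms, whose dominating source norms are collected by
  induction on that finite set.\<close>

lemma continuous_map_proj_top:
  assumes X: "lin_space X" and TY: "\<And>f. f \<in> X \<Longrightarrow> T f \<in> Y" and T: "linear_on X T"
    and bd: "\<And>j. j \<in> J \<Longrightarrow> \<exists>i\<in>I. \<exists>C>0. \<forall>f\<in>X. \<forall>K\<ge>0. N i f \<le> ereal K \<longrightarrow> P j (T f) \<le> ereal (C * K)"
  shows "continuous_map (proj_top X I N) (proj_top Y J P) T"
  unfolding continuous_map_def topspace_proj_top
proof (intro conjI allI impI)
  show "T \<in> X \<rightarrow> Y" using TY by blast
  have fin: "\<exists>F' \<epsilon>'. finite F' \<and> F' \<subseteq> I \<and> \<epsilon>' > 0 \<and> (\<forall>g\<in>X. (\<forall>i\<in>F'. N i g < ereal \<epsilon>') \<longrightarrow> (\<forall>j\<in>F. P j (T g) < ereal \<epsilon>))"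
    if "finite F" "F \<subseteq> J" "\<epsilon> > 0" for F \<epsilon>
    using that
  proof (induction F rule: finite_induct)
    case empty
    then show ?case by (intro exI[of _ "{}"] exI[of _ 1]) auto
  next
    case (insert j F)
    then obtain F' \<epsilon>' where F': "finite F'" "F' \<subseteq> I" "\<epsilon>' > 0" "\<And>g. g \<in> X \<Longrightarrow> (\<forall>i\<in>F'. N i g < ereal \<epsilon>') \<Longrightarrow> (\<forall>j\<in>F. P j (T g) < ereal \<epsilon>)"
      by auto
    obtain i C where i: "i \<in> I" "C > 0" and C: "\<And>f K. f \<in> X \<Longrightarrow> K \<ge> 0 \<Longrightarrow> N i f \<le> ereal K \<Longrightarrow> P j (T f) \<le> ereal (C * K)"
      using bd[of j] insert.prems by auto
    define \<delta> where "\<delta> = min \<epsilon>' (\<epsilon> / (2 * C))"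
    have d: "\<delta> > 0" "ereal \<delta> \<le> ereal \<epsilon>'" "ereal \<delta> \<le> ereal (\<epsilon> / (2 * C))" using F'(3) i(2) insert.prems unfolding \<delta>_def by auto
    have "\<forall>k\<in>insert j F. P k (T g) < ereal \<epsilon>" if g: "g \<in> X" "\<forall>i\<in>insert i F'. N i g < ereal \<delta>" for g
    proof -
      have "\<forall>k\<in>F. P k (T g) < ereal \<epsilon>" using F'(4)[OF g(1)] g(2) less_le_trans[OF _ d(2)] by blast
      moreover have "P j (T g) < ereal \<epsilon>"
      proof -
        have "N i g \<le> ereal (\<epsilon> / (2 * C))" using g(2) d(3) by (meson insertI1 less_imp_le less_le_trans)
        then have "P j (T g) \<le> ereal (C * (\<epsilon> / (2 * C)))" by (intro C[OF g(1)]) (use i(2) insert.prems in auto)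
        also have "\<dots> < ereal \<epsilon>" using i insert.prems by simp
        finally show ?thesis .
      qed
      ultimately show ?thesis by blast
    qed
    then show ?case using F'(1,2) i(1) d(1) by (intro exI[of _ "insert i F'"] exI[of _ \<delta>]) auto
  qed
  fix U assume U: "openin (proj_top Y J P) U"
  show "openin (proj_top X I N) {x \<in> X. T x \<in> U}"
    unfolding openin_proj_top
  proof (intro conjI ballI)
    fix f assume "f \<in> {x \<in> X. T x \<in> U}"
    then have f: "f \<in> X" "T f \<in> U" by auto
    obtain F \<epsilon> where F: "finite F" "F \<subseteq> J" "\<epsilon> > 0" "{g\<in>Y. \<forall>i\<in>F. P i (\<lambda>x. g x - T f x) < ereal \<epsilon>} \<subseteq> U"
      using U f(2) unfolding openin_proj_top by blast
    obtain F' \<epsilon>' where F': "finite F'" "F' \<subseteq> I" "\<epsilon>' > 0" "\<And>g. g \<in> X \<Longrightarrow> (\<forall>i\<in>F'. N i g < ereal \<epsilon>') \<Longrightarrow> (\<forall>j\<in>F. P j (T g) < ereal \<epsilon>)"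
      using fin[OF F(1-3)] by blast
    have "{g\<in>X. \<forall>i\<in>F'. N i (\<lambda>x. g x - f x) < ereal \<epsilon>'} \<subseteq> {x \<in> X. T x \<in> U}"
    proof
      fix g assume g: "g \<in> {g\<in>X. \<forall>i\<in>F'. N i (\<lambda>x. g x - f x) < ereal \<epsilon>'}"
      then have "\<forall>j\<in>F. P j (T (\<lambda>x. g x - f x)) < ereal \<epsilon>"
        using F'(4)[OF lin_space_diff[OF X, of g f]] f(1) by blast
      then have "T g \<in> U" using F(4) TY g f(1) linear_on_diff[OF T, of g f] by auto
      then show "g \<in> {x \<in> X. T x \<in> U}" using g by blast
    qed
    then show "\<exists>F \<epsilon>. finite F \<and> F \<subseteq> I \<and> \<epsilon> > 0 \<and> {g\<in>X. \<forall>i\<in>F. N i (\<lambda>x. g x - f x) < ereal \<epsilon>} \<subseteq> {x \<in> X. T x \<in> U}"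
      using F'(1-3) by blast
  qed auto
qed

lemma continuous_functional_ind_top:
  assumes X: "lin_space X" and L: "\<And>f g a b. f \<in> X \<Longrightarrow> g \<in> X \<Longrightarrow> L (\<lambda>x. a * f x + b * g x) = a * L f + b * L g"
    and bd: "\<And>i. i \<in> I \<Longrightarrow> \<exists>C>0. \<forall>f\<in>X. \<forall>K\<ge>0. N i f \<le> ereal K \<longrightarrow> cmod (L f) \<le> C * K"
  shows "continuous_map (ind_top X I N) euclidean L"
  unfolding continuous_map_def topspace_ind_top[OF X]
proof (intro conjI allI impI)
  fix U :: "complex set" assume "openin euclidean U"
  then have U: "open U" by simp
  show "openin (ind_top X I N) {x \<in> X. L x \<in> U}"
    unfolding openin_ind_top
  proof (intro conjI ballI)
    fix f assume "f \<in> {x \<in> X. L x \<in> U}"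
    then have f: "f \<in> X" "L f \<in> U" by auto
    obtain r where r: "r > 0" "ball (L f) r \<subseteq> U" using U f(2) open_contains_ball by blast
    define W where "W = {g \<in> X. cmod (L g) < r}"
    have "ind_nhd X I N W"
      unfolding ind_nhd_def
    proof (intro conjI ballI)
      show "abs_convex W"
        unfolding abs_convex_def
      proof (intro ballI allI impI)
        fix u v and a b :: complex assume u: "u \<in> W" and v: "v \<in> W" and ab: "cmod a + cmod b \<le> 1"
        define m where "m = max (cmod (L u)) (cmod (L v))"
        have m: "0 \<le> m" "m < r" using u v norm_ge_zero[of "L u"] by (auto simp: m_def W_def le_max_iff_disj)
        have "cmod (a * L u + b * L v) \<le> cmod a * cmod (L u) + cmod b * cmod (L v)"
          using norm_triangle_ineq[of "a * L u" "b * L v"] by (simp add: norm_mult)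
        also have "\<dots> \<le> cmod a * m + cmod b * m" by (intro add_mono mult_left_mono) (auto simp: m_def)
        also have "\<dots> = (cmod a + cmod b) * m" by (simp add: distrib_right)
        also have "\<dots> \<le> 1 * m" using ab m by (intro mult_right_mono) auto
        finally show "(\<lambda>x. a * u x + b * v x) \<in> W"
          using u v m lin_spaceD[OF X, of u v a b] L[of u v a b] by (simp add: W_def)
      qed
      fix i assume "i \<in> I"
      then obtain C where C0: "C > 0" and C: "\<And>f K. f \<in> X \<Longrightarrow> K \<ge> 0 \<Longrightarrow> N i f \<le> ereal K \<Longrightarrow> cmod (L f) \<le> C * K"
        using bd by meson
      have "g \<in> W" if g: "g \<in> X" "N i g < ereal (r / (2 * C))" for g
      proof -
        have "cmod (L g) \<le> C * (r / (2 * C))" by (rule C[OF g(1)]) (use g(2) r(1) C0 in auto)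
        also have "\<dots> < r" using r(1) C0 by simp
        finally show ?thesis using g(1) by (simp add: W_def)
      qed
      moreover have "r / (2 * C) > 0" using r C0 by simp
      ultimately show "\<exists>\<epsilon>>0. \<forall>g\<in>X. N i g < ereal \<epsilon> \<longrightarrow> g \<in> W" by blast
    qed (auto simp: W_def)
    moreover have "(\<lambda>g x. f x + g x) ` W \<subseteq> {x \<in> X. L x \<in> U}"
    proof (clarsimp simp: W_def lin_space_add[OF X f(1)])
      fix g assume g: "g \<in> X" "cmod (L g) < r"
      have "L (\<lambda>x. f x + g x) = L f + L g" using L[OF f(1) g(1), of 1 1] by simp
      then show "L (\<lambda>x. f x + g x) \<in> U" using r(2) g(2) by (auto simp: dist_norm subset_iff)
    qed
    ultimately show "\<exists>V. ind_nhd X I N V \<and> (\<lambda>g x. f x + g x) ` V \<subseteq> {x \<in> X. L x \<in> U}" by blast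
  qed auto
qed auto

lemma continuous_functional_proj_top:
  assumes X: "lin_space X" and L: "\<And>f g a b. f \<in> X \<Longrightarrow> g \<in> X \<Longrightarrow> L (\<lambda>x. a * f x + b * g x) = a * L f + b * L g"
    and i: "i \<in> I" and C0: "C > 0" and C: "\<And>f K. f \<in> X \<Longrightarrow> K \<ge> 0 \<Longrightarrow> N i f \<le> ereal K \<Longrightarrow> cmod (L f) \<le> C * K"
  shows "continuous_map (proj_top X I N) euclidean L"
  unfolding continuous_map_def topspace_proj_top
proof (intro conjI allI impI)
  fix U :: "complex set" assume "openin euclidean U"
  then have U: "open U" by simp
  show "openin (proj_top X I N) {x \<in> X. L x \<in> U}"
    unfolding openin_proj_top
  proof (intro conjI ballI)
    fix f assume "f \<in> {x \<in> X. L x \<in> U}"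
    then have f: "f \<in> X" "L f \<in> U" by auto
    obtain r where r: "r > 0" "ball (L f) r \<subseteq> U" using U f(2) open_contains_ball by blast
    have "{g\<in>X. \<forall>k\<in>{i}. N k (\<lambda>x. g x - f x) < ereal (r / (2 * C))} \<subseteq> {x \<in> X. L x \<in> U}"
    proof clarsimp
      fix g assume g: "g \<in> X" "N i (\<lambda>x. g x - f x) < ereal (r / (2 * C))"
      have "cmod (L (\<lambda>x. g x - f x)) \<le> C * (r / (2 * C))"
        by (rule C[OF lin_space_diff[OF X g(1) f(1)]]) (use g(2) r(1) C0 in auto)
      also have "\<dots> < r" using r(1) C0 by simp
      also have "L (\<lambda>x. g x - f x) = L g - L f" using L[OF g(1) f(1), of 1 "- 1"] by simp
      finally show "L g \<in> U" using r(2) by (auto simp: dist_norm subset_iff norm_minus_commute)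
    qed
    moreover have "r / (2 * C) > 0" using r C0 by simp
    ultimately show "\<exists>F \<epsilon>. finite F \<and> F \<subseteq> I \<and> \<epsilon> > 0 \<and> {g\<in>X. \<forall>i\<in>F. N i (\<lambda>x. g x - f x) < ereal \<epsilon>} \<subseteq> {x \<in> X. L x \<in> U}"
      using i by (intro exI[of _ "{i}"] exI[of _ "r / (2 * C)"]) auto
  qed auto
qed auto

text \<open>Every 0-neighbourhood of the limit contains a ball of each step, so convergence in the
  norm of one step is enough.\<close>

lemma limitin_ind_top:
  assumes X: "lin_space X" and f: "f \<in> X" and S: "\<forall>\<^sub>F F in \<F>. S F \<in> X" and i: "i \<in> I"
    and bd: "\<forall>\<^sub>F F in \<F>. N i (\<lambda>x. S F x - f x) \<le> ereal (t F)" and t: "(t \<longlongrightarrow> 0) \<F>"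
  shows "limitin (ind_top X I N) S f \<F>"
  unfolding limitin_def topspace_ind_top[OF X]
proof (intro conjI allI impI f)
  fix U assume "openin (ind_top X I N) U \<and> f \<in> U"
  then obtain V where V: "ind_nhd X I N V" "(\<lambda>g x. f x + g x) ` V \<subseteq> U" unfolding openin_ind_top by blast
  obtain \<epsilon> where \<epsilon>: "\<epsilon> > 0" "\<And>g. g \<in> X \<Longrightarrow> N i g < ereal \<epsilon> \<Longrightarrow> g \<in> V" using V(1) i unfolding ind_nhd_def by meson
  have "\<forall>\<^sub>F F in \<F>. t F < \<epsilon>" using t \<epsilon>(1) by (rule order_tendstoD)
  then show "\<forall>\<^sub>F F in \<F>. S F \<in> U" using S bd
  proof eventually_elim
    case (elim F)
    have "N i (\<lambda>x. S F x - f x) < ereal \<epsilon>" by (rule le_less_trans[OF elim(3)]) (use elim(1) in simp)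
    then have "(\<lambda>x. S F x - f x) \<in> V" by (rule \<epsilon>(2)[OF lin_space_diff[OF X elim(2) f]])
    then have "(\<lambda>x. f x + (S F x - f x)) \<in> U" using V(2) by blast
    then show ?case by simp
  qed
qed

lemma limitin_proj_top:
  assumes f: "f \<in> X" and S: "\<forall>\<^sub>F F in \<F>. S F \<in> X"
    and bd: "\<And>i. i \<in> I \<Longrightarrow> \<exists>t. (t \<longlongrightarrow> 0) \<F> \<and> (\<forall>\<^sub>F F in \<F>. N i (\<lambda>x. S F x - f x) \<le> ereal (t F))"
  shows "limitin (proj_top X I N) S f \<F>"
  unfolding limitin_def topspace_proj_top
proof (intro conjI allI impI f)
  fix U assume "openin (proj_top X I N) U \<and> f \<in> U"
  then obtain G \<epsilon> where G: "finite G" "G \<subseteq> I" "\<epsilon> > 0" "{g\<in>X. \<forall>i\<in>G. N i (\<lambda>x. g x - f x) < ereal \<epsilon>} \<subseteq> U"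
    unfolding openin_proj_top by blast
  have "\<forall>\<^sub>F F in \<F>. N i (\<lambda>x. S F x - f x) < ereal \<epsilon>" if iG: "i \<in> G" for i
  proof -
    obtain t where t: "(t \<longlongrightarrow> 0) \<F>" "\<forall>\<^sub>F F in \<F>. N i (\<lambda>x. S F x - f x) \<le> ereal (t F)" using bd[OF subsetD[OF G(2) iG]] by blast
    have "\<forall>\<^sub>F F in \<F>. t F < \<epsilon>" using t(1) G(3) by (rule order_tendstoD)
    then show ?thesis using t(2)
    proof eventually_elim
      case (elim F)
      show ?case by (rule le_less_trans[OF elim(2)]) (use elim(1) in simp)
    qed
  qed
  then have "\<forall>\<^sub>F F in \<F>. \<forall>i\<in>G. N i (\<lambda>x. S F x - f x) < ereal \<epsilon>" using G(1) by (simp add: eventually_ball_finite)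
  then show "\<forall>\<^sub>F F in \<F>. S F \<in> U" using S
    by eventually_elim (use G(4) in blast)
qed

text \<open>Homogeneity gives p(0) = 0 and p(-f) = p(f), so subadditivity reads 0 \<le> 2
  p(f).\<close>

lemma cont_seminorm_nonneg:
  assumes p: "cont_seminorm Z p" and f: "f \<in> topspace Z" and m: "(\<lambda>x. - 1 * f x) \<in> topspace Z"
  shows "0 \<le> p f"
proof -
  have "p (\<lambda>x. 0 * f x) = cmod 0 * p f" "p (\<lambda>x. - 1 * f x) = cmod (- 1) * p f"
    using p f unfolding cont_seminorm_def by blast+
  moreover have "\<forall>f\<in>topspace Z. \<forall>g\<in>topspace Z. p (\<lambda>x. f x + g x) \<le> p f + p g"
    using p unfolding cont_seminorm_def by blast
  from bspec[OF bspec[OF this f] m] have "p (\<lambda>x. f x + - 1 * f x) \<le> p f + p (\<lambda>x. - 1 * f x)" .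
  ultimately show ?thesis by simp
qed

text \<open>A continuous seminorm is below 1 on a neighbourhood of 0; scaling turns this into a norm bound.\<close>
lemma seminorm_scaling:
  assumes p: "cont_seminorm Z p" and X: "topspace Z = X" "lin_space X"
    and small: "\<And>f. f \<in> X \<Longrightarrow> (\<And>i. i \<in> F \<Longrightarrow> N i f < ereal \<epsilon>) \<Longrightarrow> p f < 1" and \<epsilon>: "\<epsilon> > 0"
    and N: "\<And>i f a K. i \<in> F \<Longrightarrow> f \<in> X \<Longrightarrow> K \<ge> 0 \<Longrightarrow> N i f \<le> ereal K \<Longrightarrow> N i (\<lambda>x. a * f x) \<le> ereal (cmod a * K)"
    and f: "f \<in> X" "K \<ge> 0" "\<And>i. i \<in> F \<Longrightarrow> N i f \<le> ereal K"
  shows "p f \<le> 2 / \<epsilon> * K"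
proof -
  have hom: "p (\<lambda>x. complex_of_real a * f x) = a * p f" if "a \<ge> 0" for a
    using p f(1) that X(1) unfolding cont_seminorm_def by simp
  have sm: "a * p f < 1" if a: "a \<ge> 0" "a * K < \<epsilon>" for a
  proof -
    have "p (\<lambda>x. complex_of_real a * f x) < 1"
    proof (rule small[OF lin_space_scale[OF X(2) f(1)]])
      fix i assume i: "i \<in> F"
      have "N i (\<lambda>x. complex_of_real a * f x) \<le> ereal (cmod (complex_of_real a) * K)"
        by (rule N[OF i f(1) f(2) f(3)[OF i]])
      also have "\<dots> < ereal \<epsilon>" using a by simp
      finally show "N i (\<lambda>x. complex_of_real a * f x) < ereal \<epsilon>" .
    qed
    then show ?thesis using hom[OF a(1)] by simp
  qed
  show ?thesis
  proof (cases "K = 0")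
    case True
    show ?thesis
    proof (rule ccontr)
      assume "\<not> ?thesis"
      then have "p f > 0" using True by simp
      \<comment> \<open>With K = 0 every nonnegative multiple of f lies in the unit ball of p, and
        the multiple 1 / p f would give 1 < 1.\<close>
      then show False using sm[of "1 / p f"] True \<epsilon> by simp
    qed
  next
    case False
    then have K: "K > 0" using f(2) by simp
    have "\<epsilon> / (2 * K) * p f < 1" using sm[of "\<epsilon> / (2 * K)"] K \<epsilon> by simp
    then show ?thesis using K \<epsilon> by (simp add: field_simps)
  qed
qed

lemma cont_seminorm_open_ball:
  assumes "cont_seminorm Z p"
  shows "openin Z {f \<in> topspace Z. p f < 1}"
proof -
  have "continuous_map Z euclideanreal p" using assms by (simp add: cont_seminorm_def)
  then have "openin Z {f \<in> topspace Z. p f \<in> {..<1}}" by (rule openin_continuous_map_preimage) simp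
  then show ?thesis by simp
qed

lemma cont_seminorm_ind_bound:
  assumes p: "cont_seminorm (ind_top X I N) p" and X: "lin_space X" and i: "i \<in> I"
    and N: "\<And>f a K. f \<in> X \<Longrightarrow> K \<ge> 0 \<Longrightarrow> N i f \<le> ereal K \<Longrightarrow> N i (\<lambda>x. a * f x) \<le> ereal (cmod a * K)"
  shows "\<exists>C\<ge>0. \<forall>f\<in>X. \<forall>K\<ge>0. N i f \<le> ereal K \<longrightarrow> p f \<le> C * K"
\<comment> \<open>\<open>lin_space\<close> admits the empty set; as soon as X has an element, its
  multiple by 0 is the zero function in X.\<close>
proof (cases "X = {}")
  case False
  then obtain u where u: "u \<in> X" by blast
  have z: "(\<lambda>x. 0) \<in> X" using lin_space_scale[OF X u, of 0] by simp
  have "p (\<lambda>x. 0 * u x) = cmod 0 * p u" using p u unfolding cont_seminorm_def topspace_ind_top[OF X] by blast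
  then have "p (\<lambda>x. 0) < 1" by simp
  then have z1: "(\<lambda>x. 0) \<in> {f \<in> X. p f < 1}" using z by simp
  have "openin (ind_top X I N) {f \<in> X. p f < 1}" using cont_seminorm_open_ball[OF p] unfolding topspace_ind_top[OF X] .
  then have "\<forall>f\<in>{f \<in> X. p f < 1}. \<exists>V. ind_nhd X I N V \<and> (\<lambda>g x. f x + g x) ` V \<subseteq> {f \<in> X. p f < 1}"
    unfolding openin_ind_top by (rule conjunct2)
  from bspec[OF this z1] obtain V where V: "ind_nhd X I N V" "(\<lambda>g x. 0 + g x) ` V \<subseteq> {f \<in> X. p f < 1}" by auto
  obtain \<epsilon> where \<epsilon>: "\<epsilon> > 0" "\<And>g. g \<in> X \<Longrightarrow> N i g < ereal \<epsilon> \<Longrightarrow> g \<in> V" using V(1) i unfolding ind_nhd_def by meson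
  have sm: "p g < 1" if "g \<in> X" "\<And>k. k \<in> {i} \<Longrightarrow> N k g < ereal \<epsilon>" for g
    using \<epsilon>(2)[OF that(1)] that(2)[of i] V(2) by (auto simp: image_subset_iff)
  have "p f \<le> 2 / \<epsilon> * K" if "f \<in> X" "K \<ge> 0" "N i f \<le> ereal K" for f K
  proof (rule seminorm_scaling[where F = "{i}" and N = N, OF p topspace_ind_top[OF X] X _ \<epsilon>(1) _ that(1,2)])
    show "p g < 1" if "g \<in> X" "\<And>k. k \<in> {i} \<Longrightarrow> N k g < ereal \<epsilon>" for g using sm that by blast
  qed (use N that(3) in auto)
  then show ?thesis using \<epsilon>(1) by (intro exI[of _ "2 / \<epsilon>"]) auto
qed (auto intro: exI[of _ 0])

lemma cont_seminorm_proj_bound: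
  assumes p: "cont_seminorm (proj_top X I N) p" and X: "lin_space X"
    and N: "\<And>i f a K. i \<in> I \<Longrightarrow> f \<in> X \<Longrightarrow> K \<ge> 0 \<Longrightarrow> N i f \<le> ereal K \<Longrightarrow> N i (\<lambda>x. a * f x) \<le> ereal (cmod a * K)"
  shows "\<exists>C\<ge>0. \<exists>F. finite F \<and> F \<subseteq> I \<and> (\<forall>f\<in>X. \<forall>K\<ge>0. (\<forall>i\<in>F. N i f \<le> ereal K) \<longrightarrow> p f \<le> C * K)"
proof (cases "X = {}")
  case False
  then obtain u where u: "u \<in> X" by blast
  have z: "(\<lambda>x. 0) \<in> X" using lin_space_scale[OF X u, of 0] by simp
  have "p (\<lambda>x. 0 * u x) = cmod 0 * p u" using p u unfolding cont_seminorm_def topspace_proj_top by blast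
  then have "p (\<lambda>x. 0) < 1" by simp
  then have z1: "(\<lambda>x. 0) \<in> {f \<in> X. p f < 1}" using z by simp
  have "openin (proj_top X I N) {f \<in> X. p f < 1}" using cont_seminorm_open_ball[OF p] unfolding topspace_proj_top .
  then have "\<forall>f\<in>{f \<in> X. p f < 1}. \<exists>F \<epsilon>. finite F \<and> F \<subseteq> I \<and> \<epsilon> > 0 \<and>
      {g\<in>X. \<forall>i\<in>F. N i (\<lambda>x. g x - f x) < ereal \<epsilon>} \<subseteq> {f \<in> X. p f < 1}"
    unfolding openin_proj_top by (rule conjunct2)
  from bspec[OF this z1] obtain F \<epsilon> where F: "finite F" "F \<subseteq> I" "\<epsilon> > 0"
    "{g\<in>X. \<forall>i\<in>F. N i (\<lambda>x. g x - 0) < ereal \<epsilon>} \<subseteq> {f \<in> X. p f < 1}" by auto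
  have sm: "p g < 1" if "g \<in> X" "\<And>i. i \<in> F \<Longrightarrow> N i g < ereal \<epsilon>" for g
    using F(4) that by auto
  have "p f \<le> 2 / \<epsilon> * K" if "f \<in> X" "K \<ge> 0" "\<forall>i\<in>F. N i f \<le> ereal K" for f K
  proof (rule seminorm_scaling[where F = F and N = N, OF p topspace_proj_top X _ F(3) _ that(1,2)])
    show "p g < 1" if "g \<in> X" "\<And>i. i \<in> F \<Longrightarrow> N i g < ereal \<epsilon>" for g using sm that by blast
  qed (use N that(3) F(2) in auto)
  then show ?thesis using F(1-3) by (intro exI[of _ "2 / \<epsilon>"] conjI exI[of _ F]) auto
qed (auto intro: exI[of _ 0])

text \<open>Uniqueness comes from biorthogonality: along the finite sums of any expansion the
  continuous functional \<open>\<xi> i\<close> is eventually the constant \<open>c i\<close>, which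
  must be its value at f. This also identifies the definite description
  \<open>basis_coeff\<close>.\<close>

lemma abs_schauder_basisI:
  fixes e :: "'i \<Rightarrow> 'a \<Rightarrow> complex" and \<xi> :: "'i \<Rightarrow> ('a \<Rightarrow> complex) \<Rightarrow> complex"
  assumes e: "\<And>i. e i \<in> topspace Z"
    and cont: "\<And>i. continuous_map Z euclidean (\<xi> i)"
    and biorth: "\<And>i c F. finite F \<Longrightarrow> \<xi> i (\<lambda>x. \<Sum>j\<in>F. c j * e j x) = (if i \<in> F then c i else 0)"
    and ex: "\<And>f. f \<in> topspace Z \<Longrightarrow> expands Z e (\<lambda>i. \<xi> i f) f"
    and sm: "\<And>p f. cont_seminorm Z p \<Longrightarrow> f \<in> topspace Z \<Longrightarrow> (\<lambda>i. cmod (\<xi> i f) * p (e i)) summable_on UNIV"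
  shows "abs_schauder_basis Z e"
proof -
  have uniq: "c = (\<lambda>i. \<xi> i f)" if "expands Z e c f" for c f
  proof
    fix i
    define S where "S F x = (\<Sum>j\<in>F. c j * e j x)" for F x
    have "limitin Z S f (finite_subsets_at_top UNIV)" using that unfolding expands_def S_def .
    from continuous_map_limit[OF cont[of i] this]
    have "((\<lambda>F. \<xi> i (S F)) \<longlongrightarrow> \<xi> i f) (finite_subsets_at_top UNIV)" by (simp add: o_def)
    moreover have "((\<lambda>F. \<xi> i (S F)) \<longlongrightarrow> c i) (finite_subsets_at_top UNIV)"
    proof (rule tendsto_eventually)
      show "\<forall>\<^sub>F F in finite_subsets_at_top UNIV. \<xi> i (S F) = c i"
        unfolding eventually_finite_subsets_at_top S_def by (rule exI[of _ "{i}"]) (auto simp: biorth)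
    qed
    ultimately show "c i = \<xi> i f" using tendsto_unique[OF finite_subsets_at_top_neq_bot] by blast
  qed
  have bc: "basis_coeff Z e f = (\<lambda>i. \<xi> i f)" if "f \<in> topspace Z" for f
    unfolding basis_coeff_def using ex[OF that] uniq by (rule the_equality)
  show ?thesis
    unfolding abs_schauder_basis_def
  proof (intro conjI allI ballI impI e)
    show "\<exists>!c. expands Z e c f" if "f \<in> topspace Z" for f using ex[OF that] uniq by blast
    show "continuous_map Z euclidean (\<lambda>f. basis_coeff Z e f i)" for i
      by (rule continuous_map_eq[OF cont[of i]]) (simp add: bc)
    show "(\<lambda>i. cmod (basis_coeff Z e f i) * p (e i)) summable_on UNIV" if "cont_seminorm Z p" "f \<in> topspace Z" for p f
      using sm[OF that] bc[OF that(2)] by simp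
  qed
qed

lemma top_lin_isoI:
  assumes "continuous_map Z W T" "continuous_map W Z R" "\<And>f. f \<in> topspace Z \<Longrightarrow> R (T f) = f"
    "\<And>c. c \<in> topspace W \<Longrightarrow> T (R c) = c" "linear_on (topspace Z) T"
  shows "top_lin_iso Z W T"
proof -
  have "homeomorphic_maps Z W T R" unfolding homeomorphic_maps_def using assms by blast
  then show ?thesis unfolding top_lin_iso_def homeomorphic_map_maps using assms(5) unfolding linear_on_def by blast
qed

section \<open>The norms as pointwise bounds\<close>

lemma ereal_mult_le_iff: "r > 0 \<Longrightarrow> a * ereal r \<le> ereal K \<longleftrightarrow> a \<le> ereal (K / r)"
  by (cases a) (auto simp: field_simps)

lemma gs_norm_le_iff:
  assumes "\<And>\<sigma>. 0 < Ms \<sigma>" "h > 0"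
  shows "gs_norm Ms h f \<le> ereal K \<longleftrightarrow>
    (\<forall>\<alpha> \<beta> x. cmod (complex_of_real (xpow x \<alpha>) * pder \<beta> f x) \<le> K * (h ^ msize (\<alpha> + \<beta>) * Ms (\<alpha> + \<beta>)))"
proof -
  have key: "sup_norm g * ereal (1 / (h ^ msize \<sigma> * Ms \<sigma>)) \<le> ereal K \<longleftrightarrow> (\<forall>x. cmod (g x) \<le> K * (h ^ msize \<sigma> * Ms \<sigma>))" for g :: "real^'a \<Rightarrow> complex" and \<sigma>
    using assms by (subst ereal_mult_le_iff) (auto simp: sup_norm_def SUP_le_iff)
  show ?thesis unfolding gs_norm_def SUP_le_iff key ball_UNIV ..
qed

lemma eexp_mono: "a \<le> b \<Longrightarrow> eexp a \<le> eexp b"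
  by (cases a; cases b) (auto simp: eexp_def)

text \<open>Exponentiating the associated weight at \<gamma>^(1/2)/h turns the supremum of
  logarithms into the supremum over \<beta> of \<gamma>^(\<beta>/2) / (h^|\<beta>| M_\<beta>). A
  norm bound thus splits into one real inequality for each \<gamma> and \<beta>, parallel to
  \<open>gs_norm_le_iff\<close>.\<close>

lemma lam_norm_le_iff:
  fixes c :: "('n::finite \<Rightarrow> nat) \<Rightarrow> complex"
  assumes M: "\<And>\<sigma>. 0 < Ms \<sigma>" and h: "h > 0" and K: "K \<ge> 0"
  shows "lam_norm Ms h c \<le> ereal K \<longleftrightarrow> (\<forall>\<gamma> \<beta>. cmod (c \<gamma>) * hpow \<gamma> \<beta> \<le> K * (h ^ msize \<beta> * Ms \<beta>))"
proof -
  have key: "ereal (cmod (c \<gamma>)) * eexp (assoc_weight Ms (\<chi> j. sqrt (real (\<gamma> j)) / h)) \<le> ereal K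
      \<longleftrightarrow> (\<forall>\<beta>. cmod (c \<gamma>) * hpow \<gamma> \<beta> \<le> K * (h ^ msize \<beta> * Ms \<beta>))" (is "?L \<longleftrightarrow> ?R") for \<gamma>
  proof -
    define t :: "real^'n" where "t = (\<chi> j. sqrt (real (\<gamma> j)) / h)"
    define A where "A = {\<beta> :: 'n \<Rightarrow> nat. \<forall>j. t $ j = 0 \<longrightarrow> \<beta> j = 0}"
    define q where "q \<beta> = \<bar>xpow t \<beta>\<bar> / Ms \<beta>" for \<beta>
    have tj: "t $ j = 0 \<longleftrightarrow> \<gamma> j = 0" for j using h by (simp add: t_def)
    have x: "\<bar>xpow t \<beta>\<bar> = hpow \<gamma> \<beta> / h ^ msize \<beta>" for \<beta>
      unfolding xpow_def hpow_def t_def using h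
      by (simp add: abs_prod power_divide power_abs prod_dividef msize_def power_sum)
    have qeq: "q \<beta> = hpow \<gamma> \<beta> / (h ^ msize \<beta> * Ms \<beta>)" for \<beta> unfolding q_def x by simp
    have hp: "h ^ msize \<beta> * Ms \<beta> > 0" for \<beta> using h M by simp
    have qpos: "q \<beta> > 0" if "\<beta> \<in> A" for \<beta>
    proof -
      have "sqrt (real (\<gamma> j)) ^ \<beta> j > 0" for j
        using that tj by (cases "\<gamma> j = 0") (auto simp: A_def)
      then have "hpow \<gamma> \<beta> > 0" unfolding hpow_def by (intro prod_pos) auto
      then show ?thesis unfolding qeq using hp by simp
    qed
    \<comment> \<open>The supremum leaves out the exponents for which the logarithm would have
      argument 0. For these the half power vanishes, and the inequality claimed for all \<beta>
      reduces to K \<ge> 0.\<close>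
    have q0: "hpow \<gamma> \<beta> = 0" if "\<beta> \<notin> A" for \<beta>
    proof -
      obtain j where "\<gamma> j = 0" "\<beta> j \<noteq> 0" using \<open>\<beta> \<notin> A\<close> tj by (auto simp: A_def)
      then have "sqrt (real (\<gamma> j)) ^ \<beta> j = 0" by simp
      then show ?thesis unfolding hpow_def by (intro prod_zero bexI[of _ j]) auto
    qed
    have aw: "assoc_weight Ms t = (SUP \<beta>\<in>A. ereal (ln (q \<beta>)))" unfolding assoc_weight_def A_def q_def ..
    show ?thesis
    proof (cases "c \<gamma> = 0")
      \<comment> \<open>The exponential of the weight may be infinite; the convention that 0 times
        infinity is 0 in the extended reals makes the product vanish.\<close>
      case True
      have "0 \<le> K * (h ^ msize \<beta> * Ms \<beta>)" for \<beta> by (rule mult_nonneg_nonneg[OF K less_imp_le[OF hp]])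
      moreover have z: "ereal (cmod (c \<gamma>)) * eexp (assoc_weight Ms (\<chi> j. sqrt (real (\<gamma> j)) / h)) = 0"
        unfolding True norm_zero zero_ereal_def[symmetric] by (rule ereal_zero_mult)
      ultimately show ?thesis unfolding z using True K by simp
    next
      case False
      then have c: "cmod (c \<gamma>) > 0" by simp
      show ?thesis
      proof
        assume L: ?L
        show ?R
        proof
          fix \<beta>
          show "cmod (c \<gamma>) * hpow \<gamma> \<beta> \<le> K * (h ^ msize \<beta> * Ms \<beta>)"
          proof (cases "\<beta> \<in> A")
            case True
            have "ereal (ln (q \<beta>)) \<le> assoc_weight Ms t" unfolding aw using True by (rule SUP_upper)
            then have "eexp (ereal (ln (q \<beta>))) \<le> eexp (assoc_weight Ms t)" by (rule eexp_mono)
            then have "ereal (q \<beta>) \<le> eexp (assoc_weight Ms t)" using qpos[OF True] by (simp add: eexp_def)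
            then have "ereal (cmod (c \<gamma>)) * ereal (q \<beta>) \<le> ereal (cmod (c \<gamma>)) * eexp (assoc_weight Ms t)"
              by (rule ereal_mult_left_mono) simp
            also have "\<dots> \<le> ereal K" using L unfolding t_def .
            finally have "cmod (c \<gamma>) * q \<beta> \<le> K" by simp
            then show ?thesis unfolding qeq using hp[of \<beta>] by (simp add: pos_divide_le_eq)
          next
            case False
            then show ?thesis using q0[OF False] mult_nonneg_nonneg[OF K less_imp_le[OF hp[of \<beta>]]] by simp
          qed
        qed
      next
        assume R: ?R
        have "cmod (c \<gamma>) \<le> K * Ms 0" using R[rule_format, of 0] by simp
        then have "0 < K * Ms 0" using c by linarith
        then have Kp: "K > 0" using M[of 0] by (simp add: zero_less_mult_iff)
        have "assoc_weight Ms t \<le> ereal (ln (K / cmod (c \<gamma>)))"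
          unfolding aw
        proof (rule SUP_least)
          fix \<beta> assume b: "\<beta> \<in> A"
          have "cmod (c \<gamma>) * q \<beta> \<le> K" using R[rule_format, of \<beta>] hp[of \<beta>] unfolding qeq by (simp add: pos_divide_le_eq)
          then have "q \<beta> \<le> K / cmod (c \<gamma>)" using c by (simp add: field_simps)
          then show "ereal (ln (q \<beta>)) \<le> ereal (ln (K / cmod (c \<gamma>)))" using qpos[OF b] by simp
        qed
        then have "eexp (assoc_weight Ms t) \<le> eexp (ereal (ln (K / cmod (c \<gamma>))))" by (rule eexp_mono)
        also have "\<dots> = ereal (K / cmod (c \<gamma>))" using Kp c by (simp add: eexp_def)
        finally have "ereal (cmod (c \<gamma>)) * eexp (assoc_weight Ms t) \<le> ereal (cmod (c \<gamma>)) * ereal (K / cmod (c \<gamma>))"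
          by (rule ereal_mult_left_mono) simp
        then show ?L using c unfolding t_def by simp
      qed
    qed
  qed
  show ?thesis unfolding lam_norm_def SUP_le_iff key ball_UNIV ..
qed

lemma ereal_finite_iff: "(a :: ereal) < \<infinity> \<longleftrightarrow> (\<exists>K\<ge>0. a \<le> ereal K)"
proof (cases a)
  case (real r)
  then show ?thesis by (auto intro!: exI[of _ "max r 0"])
qed (auto intro: exI[of _ 0])

definition wmat :: "(real \<Rightarrow> ('n::finite \<Rightarrow> nat) \<Rightarrow> real) \<Rightarrow> real \<Rightarrow> real \<Rightarrow> ('n \<Rightarrow> nat) \<Rightarrow> real" where
  "wmat M l h \<sigma> = h ^ msize \<sigma> * M l \<sigma>"

definition lam_le :: "(('n::finite \<Rightarrow> nat) \<Rightarrow> complex) \<Rightarrow> (('n \<Rightarrow> nat) \<Rightarrow> real) \<Rightarrow> bool" where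
  "lam_le c w \<longleftrightarrow> (\<forall>\<gamma> \<beta>. cmod (c \<gamma>) * hpow \<gamma> \<beta> \<le> w \<beta>)"

lemma weight_matrix_pos: "weight_matrix M \<Longrightarrow> l > 0 \<Longrightarrow> 0 < M l \<sigma>"
  by (simp add: weight_matrix_def)

lemma wmat_pos: "weight_matrix M \<Longrightarrow> l > 0 \<Longrightarrow> h > 0 \<Longrightarrow> 0 < wmat M l h \<sigma>"
  by (simp add: wmat_def weight_matrix_pos)

lemma wmat_0: "weight_matrix M \<Longrightarrow> l > 0 \<Longrightarrow> wmat M l h 0 = 1"
  by (simp add: wmat_def weight_matrix_def)

lemma wmat_mono:
  assumes "weight_matrix M" "0 < l" "l \<le> l'" "0 < h" "h \<le> h'"
  shows "wmat M l h \<sigma> \<le> wmat M l' h' \<sigma>"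
proof -
  have "M l \<sigma> \<le> M l' \<sigma>" using assms by (simp add: weight_matrix_def)
  moreover have "0 < M l \<sigma>" using assms by (simp add: weight_matrix_pos)
  ultimately show ?thesis unfolding wmat_def using assms by (intro mult_mono power_mono) auto
qed

lemma gs_norm_le: "weight_matrix M \<Longrightarrow> l > 0 \<Longrightarrow> h > 0 \<Longrightarrow> smooth f \<Longrightarrow>
    gs_norm (M l) h f \<le> ereal K \<longleftrightarrow> gs_le f (\<lambda>\<sigma>. K * wmat M l h \<sigma>)"
  unfolding gs_le_def wmat_def using gs_norm_le_iff[of "M l" h f K] by (simp add: weight_matrix_pos)

lemma lam_norm_le: "weight_matrix M \<Longrightarrow> l > 0 \<Longrightarrow> h > 0 \<Longrightarrow> K \<ge> 0 \<Longrightarrow>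
    lam_norm (M l) h c \<le> ereal K \<longleftrightarrow> lam_le c (\<lambda>\<sigma>. K * wmat M l h \<sigma>)"
  unfolding lam_le_def wmat_def using lam_norm_le_iff[of "M l" h K c] by (simp add: weight_matrix_pos)

lemma S_Roumieu_iff:
  assumes "weight_matrix M"
  shows "f \<in> S_Roumieu M \<longleftrightarrow> (\<exists>l>0. \<exists>h>0. \<exists>K\<ge>0. gs_le f (\<lambda>\<sigma>. K * wmat M l h \<sigma>))" (is "_ = ?R")
proof
  assume "f \<in> S_Roumieu M"
  then have sm: "smooth f" and "\<exists>l>0. \<exists>h>0. \<exists>K\<ge>0. gs_norm (M l) h f \<le> ereal K"
    unfolding S_Roumieu_def ereal_finite_iff by auto
  then obtain l h K where lhK: "l > 0" "h > 0" "K \<ge> 0" "gs_norm (M l) h f \<le> ereal K" by auto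
  then have "gs_le f (\<lambda>\<sigma>. K * wmat M l h \<sigma>)" using gs_norm_le[OF assms lhK(1,2) sm, of K] by simp
  then show ?R using lhK(1-3) by auto
next
  assume ?R
  then obtain l h K where lhK: "l > 0" "h > 0" "K \<ge> 0" "gs_le f (\<lambda>\<sigma>. K * wmat M l h \<sigma>)" by auto
  then have "gs_norm (M l) h f \<le> ereal K" using gs_norm_le[OF assms lhK(1,2) gs_le_smooth[OF lhK(4)], of K] by simp
  then show "f \<in> S_Roumieu M" unfolding S_Roumieu_def ereal_finite_iff using lhK gs_le_smooth[OF lhK(4)] by auto
qed

lemma S_Beurling_iff:
  assumes "weight_matrix M"
  shows "f \<in> S_Beurling M \<longleftrightarrow> (\<forall>l>0. \<forall>h>0. \<exists>K\<ge>0. gs_le f (\<lambda>\<sigma>. K * wmat M l h \<sigma>))" (is "_ = ?R")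
proof
  assume "f \<in> S_Beurling M"
  then have sm: "smooth f" and N: "\<forall>l>0. \<forall>h>0. \<exists>K\<ge>0. gs_norm (M l) h f \<le> ereal K"
    unfolding S_Beurling_def ereal_finite_iff by auto
  show ?R
  proof (intro allI impI)
    fix l h :: real assume lh: "l > 0" "h > 0"
    then obtain K where "K \<ge> 0" "gs_norm (M l) h f \<le> ereal K" using N by auto
    then show "\<exists>K\<ge>0. gs_le f (\<lambda>\<sigma>. K * wmat M l h \<sigma>)" using gs_norm_le[OF assms lh sm, of K] by auto
  qed
next
  assume R: ?R
  have sm: "smooth f" using R[rule_format, of 1 1] gs_le_smooth[of f] by auto
  have "gs_norm (M l) h f < \<infinity>" if lh: "l > 0" "h > 0" for l h
  proof -
    obtain K where "K \<ge> 0" "gs_le f (\<lambda>\<sigma>. K * wmat M l h \<sigma>)" using R lh by auto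
    then show ?thesis unfolding ereal_finite_iff using gs_norm_le[OF assms lh sm, of K] by auto
  qed
  then show "f \<in> S_Beurling M" unfolding S_Beurling_def using sm by auto
qed

lemma Lam_Roumieu_iff:
  assumes "weight_matrix M"
  shows "c \<in> Lam_Roumieu M \<longleftrightarrow> (\<exists>l>0. \<exists>h>0. \<exists>K\<ge>0. lam_le c (\<lambda>\<sigma>. K * wmat M l h \<sigma>))"
  unfolding Lam_Roumieu_def ereal_finite_iff mem_Collect_eq
  by (simp only: lam_norm_le[OF assms] cong: conj_cong)

lemma Lam_Beurling_iff:
  assumes "weight_matrix M"
  shows "c \<in> Lam_Beurling M \<longleftrightarrow> (\<forall>l>0. \<forall>h>0. \<exists>K\<ge>0. lam_le c (\<lambda>\<sigma>. K * wmat M l h \<sigma>))"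
  unfolding Lam_Beurling_def ereal_finite_iff mem_Collect_eq
  by (simp only: lam_norm_le[OF assms] cong: conj_cong imp_cong)

lemma gs_le_mono:
  assumes "gs_le f w" "\<And>\<sigma>. w \<sigma> \<le> w' \<sigma>"
  shows "gs_le f w'"
  unfolding gs_le_def using gs_le_smooth[OF assms(1)] order.trans[OF gs_leD[OF assms(1)] assms(2)] by blast

lemma lam_le_mono:
  assumes "lam_le c w" "\<And>\<sigma>. w \<sigma> \<le> w' \<sigma>"
  shows "lam_le c w'"
  unfolding lam_le_def using assms(1) order.trans[OF _ assms(2)] unfolding lam_le_def by blast

lemma gs_le_wmat_mono:
  assumes "gs_le f (\<lambda>\<sigma>. K * wmat M l h \<sigma>)" "weight_matrix M" "0 < l" "l \<le> l'" "0 < h" "h \<le> h'" "0 \<le> K" "K \<le> K'"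
  shows "gs_le f (\<lambda>\<sigma>. K' * wmat M l' h' \<sigma>)"
proof (rule gs_le_mono[OF assms(1)])
  show "K * wmat M l h \<sigma> \<le> K' * wmat M l' h' \<sigma>" for \<sigma>
    using wmat_mono[OF assms(2-6)] wmat_pos[OF assms(2,3,5), of \<sigma>] assms by (intro mult_mono) auto
qed

lemma lam_le_wmat_mono:
  assumes "lam_le f (\<lambda>\<sigma>. K * wmat M l h \<sigma>)" "weight_matrix M" "0 < l" "l \<le> l'" "0 < h" "h \<le> h'" "0 \<le> K" "K \<le> K'"
  shows "lam_le f (\<lambda>\<sigma>. K' * wmat M l' h' \<sigma>)"
proof (rule lam_le_mono[OF assms(1)])
  show "K * wmat M l h \<sigma> \<le> K' * wmat M l' h' \<sigma>" for \<sigma>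
    using wmat_mono[OF assms(2-6)] wmat_pos[OF assms(2,3,5), of \<sigma>] assms by (intro mult_mono) auto
qed

lemma gs_le_lincomb:
  assumes u: "gs_le u (\<lambda>\<sigma>. K * w \<sigma>)" and v: "gs_le v (\<lambda>\<sigma>. L * w \<sigma>)"
  shows "gs_le (\<lambda>x. a * u x + b * v x) (\<lambda>\<sigma>. (cmod a * K + cmod b * L) * w \<sigma>)"
  unfolding gs_le_def
proof (intro conjI allI)
  note sm = gs_le_smooth[OF u] gs_le_smooth[OF v]
  show "smooth (\<lambda>x. a * u x + b * v x)" by (rule smooth_lincomb[OF sm])
  fix \<alpha> \<beta> :: "'a \<Rightarrow> nat" and x
  define X where "X = complex_of_real (xpow x \<alpha>)"
  have "X * pder \<beta> (\<lambda>x. a * u x + b * v x) x = a * (X * pder \<beta> u x) + b * (X * pder \<beta> v x)"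
    unfolding pder_lincomb[OF sm] by (simp only: distrib_left mult.left_commute)
  also have "cmod \<dots> \<le> cmod a * cmod (X * pder \<beta> u x) + cmod b * cmod (X * pder \<beta> v x)"
    using norm_triangle_ineq[of "a * (X * pder \<beta> u x)" "b * (X * pder \<beta> v x)"] by (simp only: norm_mult[of a] norm_mult[of b])
  also have "\<dots> \<le> cmod a * (K * w (\<alpha> + \<beta>)) + cmod b * (L * w (\<alpha> + \<beta>))"
    unfolding X_def by (intro add_mono mult_left_mono gs_leD[OF u] gs_leD[OF v]) auto
  also have "\<dots> = (cmod a * K + cmod b * L) * w (\<alpha> + \<beta>)" by (simp only: distrib_right mult.assoc)
  finally show "cmod (complex_of_real (xpow x \<alpha>) * pder \<beta> (\<lambda>x. a * u x + b * v x) x) \<le> (cmod a * K + cmod b * L) * w (\<alpha> + \<beta>)"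
    unfolding X_def .
qed

lemma gs_le_scale:
  assumes "gs_le u (\<lambda>\<sigma>. K * w \<sigma>)"
  shows "gs_le (\<lambda>x. a * u x) (\<lambda>\<sigma>. (cmod a * K) * w \<sigma>)"
  using gs_le_lincomb[OF assms assms, of a 0] by simp

lemma lam_le_lincomb:
  assumes u: "lam_le u (\<lambda>\<sigma>. K * w \<sigma>)" and v: "lam_le v (\<lambda>\<sigma>. L * w \<sigma>)"
  shows "lam_le (\<lambda>x. a * u x + b * v x) (\<lambda>\<sigma>. (cmod a * K + cmod b * L) * w \<sigma>)"
  unfolding lam_le_def
proof (intro allI)
  fix \<gamma> \<beta>
  have "cmod (a * u \<gamma> + b * v \<gamma>) * hpow \<gamma> \<beta> \<le> (cmod a * cmod (u \<gamma>) + cmod b * cmod (v \<gamma>)) * hpow \<gamma> \<beta>"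
    using norm_triangle_ineq[of "a * u \<gamma>" "b * v \<gamma>"] hpow_nonneg by (intro mult_right_mono) (auto simp: norm_mult)
  also have "\<dots> = cmod a * (cmod (u \<gamma>) * hpow \<gamma> \<beta>) + cmod b * (cmod (v \<gamma>) * hpow \<gamma> \<beta>)" by (simp add: algebra_simps)
  also have "\<dots> \<le> cmod a * (K * w \<beta>) + cmod b * (L * w \<beta>)"
    using u v unfolding lam_le_def by (intro add_mono mult_left_mono) auto
  also have "\<dots> = (cmod a * K + cmod b * L) * w \<beta>" by (simp add: algebra_simps)
  finally show "cmod (a * u \<gamma> + b * v \<gamma>) * hpow \<gamma> \<beta> \<le> (cmod a * K + cmod b * L) * w \<beta>" .
qed

text \<open>Two members may satisfy bounds with different parameters; monotonicity of
  \<open>wmat\<close> in both of them moves the bounds to the common pair of maxima.\<close>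

lemma lin_space_S_Roumieu:
  assumes M: "weight_matrix M"
  shows "lin_space (S_Roumieu M)"
  unfolding lin_space_def
proof (intro ballI allI)
  fix u v a b assume "u \<in> S_Roumieu M" "v \<in> S_Roumieu M"
  then obtain l h K l' h' K' where u: "l > 0" "h > 0" "K \<ge> 0" "gs_le u (\<lambda>\<sigma>. K * wmat M l h \<sigma>)"
    and v: "l' > 0" "h' > 0" "K' \<ge> 0" "gs_le v (\<lambda>\<sigma>. K' * wmat M l' h' \<sigma>)"
    unfolding S_Roumieu_iff[OF M] by blast
  have "gs_le u (\<lambda>\<sigma>. K * wmat M (max l l') (max h h') \<sigma>)" "gs_le v (\<lambda>\<sigma>. K' * wmat M (max l l') (max h h') \<sigma>)"
    by (rule gs_le_wmat_mono[OF u(4) M]; use u in simp) (rule gs_le_wmat_mono[OF v(4) M]; use v in simp)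
  from gs_le_lincomb[OF this, of a b]
  show "(\<lambda>x. a * u x + b * v x) \<in> S_Roumieu M"
    unfolding S_Roumieu_iff[OF M] using u v
    by (intro exI[of _ "max l l'"] exI[of _ "max h h'"] exI[of _ "cmod a * K + cmod b * K'"] conjI) auto
qed

lemma lin_space_Lam_Roumieu:
  assumes M: "weight_matrix M"
  shows "lin_space (Lam_Roumieu M)"
  unfolding lin_space_def
proof (intro ballI allI)
  fix u v a b assume "u \<in> Lam_Roumieu M" "v \<in> Lam_Roumieu M"
  then obtain l h K l' h' K' where u: "l > 0" "h > 0" "K \<ge> 0" "lam_le u (\<lambda>\<sigma>. K * wmat M l h \<sigma>)"
    and v: "l' > 0" "h' > 0" "K' \<ge> 0" "lam_le v (\<lambda>\<sigma>. K' * wmat M l' h' \<sigma>)"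
    unfolding Lam_Roumieu_iff[OF M] by blast
  have "lam_le u (\<lambda>\<sigma>. K * wmat M (max l l') (max h h') \<sigma>)" "lam_le v (\<lambda>\<sigma>. K' * wmat M (max l l') (max h h') \<sigma>)"
    by (rule lam_le_wmat_mono[OF u(4) M]; use u in simp) (rule lam_le_wmat_mono[OF v(4) M]; use v in simp)
  from lam_le_lincomb[OF this, of a b]
  show "(\<lambda>x. a * u x + b * v x) \<in> Lam_Roumieu M"
    unfolding Lam_Roumieu_iff[OF M] using u v
    by (intro exI[of _ "max l l'"] exI[of _ "max h h'"] exI[of _ "cmod a * K + cmod b * K'"] conjI) auto
qed

lemma lin_space_S_Beurling:
  assumes M: "weight_matrix M"
  shows "lin_space (S_Beurling M)"
  unfolding lin_space_def S_Beurling_iff[OF M]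
proof (intro ballI allI impI)
  fix u v a b and l h :: real assume uv: "u \<in> S_Beurling M" "v \<in> S_Beurling M" and lh: "l > 0" "h > 0"
  obtain K K' where u: "K \<ge> 0" "gs_le u (\<lambda>\<sigma>. K * wmat M l h \<sigma>)" and v: "K' \<ge> 0" "gs_le v (\<lambda>\<sigma>. K' * wmat M l h \<sigma>)"
    using uv lh unfolding S_Beurling_iff[OF M] by blast
  then show "\<exists>K\<ge>0. gs_le (\<lambda>x. a * u x + b * v x) (\<lambda>\<sigma>. K * wmat M l h \<sigma>)"
    by (intro exI[of _ "cmod a * K + cmod b * K'"] conjI gs_le_lincomb) auto
qed

lemma lin_space_Lam_Beurling:
  assumes M: "weight_matrix M"
  shows "lin_space (Lam_Beurling M)"
  unfolding lin_space_def Lam_Beurling_iff[OF M]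
proof (intro ballI allI impI)
  fix u v a b and l h :: real assume uv: "u \<in> Lam_Beurling M" "v \<in> Lam_Beurling M" and lh: "l > 0" "h > 0"
  obtain K K' where u: "K \<ge> 0" "lam_le u (\<lambda>\<sigma>. K * wmat M l h \<sigma>)" and v: "K' \<ge> 0" "lam_le v (\<lambda>\<sigma>. K' * wmat M l h \<sigma>)"
    using uv lh unfolding Lam_Beurling_iff[OF M] by blast
  then show "\<exists>K\<ge>0. lam_le (\<lambda>x. a * u x + b * v x) (\<lambda>\<sigma>. K * wmat M l h \<sigma>)"
    by (intro exI[of _ "cmod a * K + cmod b * K'"] conjI lam_le_lincomb) auto
qed

section \<open>Domination between weights\<close>

text \<open>The base 9 and the shift 5 are what is lost in \<open>hermite_coeff_bound\<close> and \<open>hermite_term_bound\<close>.\<close>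
definition dominated :: "(('n::finite \<Rightarrow> nat) \<Rightarrow> real) \<Rightarrow> (('n \<Rightarrow> nat) \<Rightarrow> real) \<Rightarrow> bool" where
  "dominated w w' \<longleftrightarrow> (\<exists>G C. adm G \<and> C > 0 \<and> (\<forall>\<sigma>. w \<sigma> \<le> G \<sigma>) \<and>
     (\<forall>\<sigma>. 9 ^ msize \<sigma> * G (\<sigma> + (\<lambda>_. 5)) \<le> C * w' \<sigma>))"

text \<open>With E = H(C + h) the mixed condition bounds the hull by a multiple of E^|\<sigma>| M_k,
  and the shift condition trades the index \<sigma> + 5 under M_k for \<sigma> under M_k' at the
  cost of A^|\<sigma>|. With the base 9 from the definition the new radius is 9 E A.\<close>

lemma dominatedI:
  fixes M :: "real \<Rightarrow> ('n::finite \<Rightarrow> nat) \<Rightarrow> real"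
  assumes M: "weight_matrix M" "l > 0" and pos: "h > 0" "H > 0" "C > 0" "A > 0" "B > 0" "D > 0"
    and one: "\<And>\<alpha> \<beta>. mhalfpow \<alpha> * M l \<beta> \<le> B * C ^ msize \<alpha> * H ^ msize (\<alpha> + \<beta>) * M k (\<alpha> + \<beta>)"
    and two: "\<And>\<sigma>. M k (\<sigma> + (\<lambda>_. 5)) \<le> D * A ^ msize \<sigma> * M k' \<sigma>"
  shows "dominated (wmat M l h) (wmat M k' (9 * (H * (C + h)) * A))"
proof -
  define E where "E = H * (C + h)"
  define G where "G = adm_hull (wmat M l h)"
  have E: "E > 0" unfolding E_def using pos by simp
  have w: "0 < wmat M l h \<sigma>" for \<sigma> by (rule wmat_pos[OF M pos(1)])
  have G: "adm G" unfolding G_def by (rule adm_adm_hull[OF w])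
  have Gle: "G \<sigma> \<le> B * E ^ msize \<sigma> * M k \<sigma>" for \<sigma>
    unfolding G_def E_def wmat_def[abs_def] by (rule adm_hull_le[OF one pos(1)])
  have "9 ^ msize \<sigma> * G (\<sigma> + (\<lambda>_. 5)) \<le> (B * E ^ (5 * CARD('n)) * D) * wmat M k' (9 * E * A) \<sigma>" for \<sigma>
  proof -
    have m: "msize (\<sigma> + (\<lambda>_. 5)) = msize \<sigma> + 5 * CARD('n)" unfolding msize_add by (simp add: msize_def)
    have "G (\<sigma> + (\<lambda>_. 5)) \<le> B * E ^ msize (\<sigma> + (\<lambda>_. 5)) * M k (\<sigma> + (\<lambda>_. 5))" by (rule Gle)
    also have "\<dots> \<le> B * E ^ msize (\<sigma> + (\<lambda>_. 5)) * (D * A ^ msize \<sigma> * M k' \<sigma>)"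
      using pos E by (intro mult_left_mono two) auto
    finally have "9 ^ msize \<sigma> * G (\<sigma> + (\<lambda>_. 5)) \<le> 9 ^ msize \<sigma> * (B * E ^ msize (\<sigma> + (\<lambda>_. 5)) * (D * A ^ msize \<sigma> * M k' \<sigma>))"
      by (rule mult_left_mono) simp
    also have "\<dots> = (B * E ^ (5 * CARD('n)) * D) * wmat M k' (9 * E * A) \<sigma>"
      unfolding m power_add wmat_def power_mult_distrib by (simp only: ac_simps)
    finally show ?thesis .
  qed
  moreover have "B * E ^ (5 * CARD('n)) * D > 0" using pos E by simp
  ultimately show ?thesis
    unfolding dominated_def E_def[symmetric] using G adm_hull_ge[of "wmat M l h", OF w] unfolding G_def[symmetric] by blast
qed

lemma condR2_iterate:
  assumes R2: "condR2 M" and M: "weight_matrix M"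
  shows "\<forall>l>0. \<exists>k\<ge>l. \<exists>A>0. \<exists>B>0. \<forall>\<sigma>. M l (\<sigma> + \<mu>) \<le> B * A ^ msize \<sigma> * M k \<sigma>"
proof (induction \<mu> rule: mi_induct)
  case zero
  show ?case
  proof (intro allI impI)
    fix l :: real assume "l > 0"
    show "\<exists>k\<ge>l. \<exists>A>0. \<exists>B>0. \<forall>\<sigma>. M l (\<sigma> + 0) \<le> B * A ^ msize \<sigma> * M k \<sigma>"
      by (intro exI[of _ l] exI[of _ 1] conjI) (simp_all del: plus_fun_apply)
  qed
next
  case (step \<mu> i)
  show ?case
  proof (intro allI impI)
    fix l :: real assume l: "l > 0"
    obtain k A where k: "k \<ge> l" "A \<ge> 1" and 1: "\<And>\<alpha> j. M l (\<alpha> + unit_mi j) \<le> A ^ (msize \<alpha> + 1) * M k \<alpha>"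
      using R2 l unfolding condR2_def by meson
    obtain k' A' B where k': "k' \<ge> k" "A' > 0" "B > 0" and 2: "\<And>\<sigma>. M k (\<sigma> + \<mu>) \<le> B * A' ^ msize \<sigma> * M k' \<sigma>"
      using step k l by (meson less_le_trans)
    have "M l (\<sigma> + (\<mu> + unit_mi i)) \<le> (A ^ (msize \<mu> + 1) * B) * (A * A') ^ msize \<sigma> * M k' \<sigma>" for \<sigma>
    proof -
      have "M l (\<sigma> + \<mu> + unit_mi i) \<le> A ^ (msize (\<sigma> + \<mu>) + 1) * M k (\<sigma> + \<mu>)" by (rule 1)
      also have "\<dots> \<le> A ^ (msize (\<sigma> + \<mu>) + 1) * (B * A' ^ msize \<sigma> * M k' \<sigma>)"
        using k by (intro mult_left_mono 2) auto
      also have "\<dots> = (A ^ (msize \<mu> + 1) * B) * (A * A') ^ msize \<sigma> * M k' \<sigma>"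
        unfolding msize_add power_add power_mult_distrib by (simp only: ac_simps)
      finally show ?thesis by (simp only: add.assoc)
    qed
    then show "\<exists>k\<ge>l. \<exists>A>0. \<exists>B>0. \<forall>\<sigma>. M l (\<sigma> + (\<mu> + unit_mi i)) \<le> B * A ^ msize \<sigma> * M k \<sigma>"
      using k k' by (intro exI[of _ k'] exI[of _ "A * A'"] exI[of _ "A ^ (msize \<mu> + 1) * B"] conjI) auto
  qed
qed

text \<open>Composition runs opposite to the Roumieu case because new indices lie below old ones:
  the induction hypothesis is applied at the given l first, and the condition at the index it
  returns.\<close>

lemma condB2_iterate:
  assumes B2: "condB2 M" and M: "weight_matrix M"
  shows "\<forall>l>0. \<exists>k>0. \<exists>A>0. \<exists>B>0. \<forall>\<sigma>. M k (\<sigma> + \<mu>) \<le> B * A ^ msize \<sigma> * M l \<sigma>"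
proof (induction \<mu> rule: mi_induct)
  case zero
  show ?case
  proof (intro allI impI)
    fix l :: real assume "l > 0"
    then show "\<exists>k>0. \<exists>A>0. \<exists>B>0. \<forall>\<sigma>. M k (\<sigma> + 0) \<le> B * A ^ msize \<sigma> * M l \<sigma>"
      by (intro exI[of _ l] exI[of _ 1] conjI) (simp_all del: plus_fun_apply)
  qed
next
  case (step \<mu> i)
  show ?case
  proof (intro allI impI)
    fix l :: real assume l: "l > 0"
    obtain k A' B where k: "k > 0" "A' > 0" "B > 0" and 1: "\<And>\<sigma>. M k (\<sigma> + \<mu>) \<le> B * A' ^ msize \<sigma> * M l \<sigma>"
      using step l by meson
    obtain k' A where k': "k' > 0" "A \<ge> 1" and 2: "\<And>\<alpha> j. M k' (\<alpha> + unit_mi j) \<le> A ^ (msize \<alpha> + 1) * M k \<alpha>"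
      using B2 k unfolding condB2_def by meson
    have "M k' (\<sigma> + (\<mu> + unit_mi i)) \<le> (A ^ (msize \<mu> + 1) * B) * (A * A') ^ msize \<sigma> * M l \<sigma>" for \<sigma>
    proof -
      have "M k' (\<sigma> + \<mu> + unit_mi i) \<le> A ^ (msize (\<sigma> + \<mu>) + 1) * M k (\<sigma> + \<mu>)" by (rule 2)
      also have "\<dots> \<le> A ^ (msize (\<sigma> + \<mu>) + 1) * (B * A' ^ msize \<sigma> * M l \<sigma>)"
        using k' by (intro mult_left_mono 1) auto
      also have "\<dots> = (A ^ (msize \<mu> + 1) * B) * (A * A') ^ msize \<sigma> * M l \<sigma>"
        unfolding msize_add power_add power_mult_distrib by (simp only: ac_simps)
      finally show ?thesis by (simp only: add.assoc)
    qed
    then show "\<exists>k>0. \<exists>A>0. \<exists>B>0. \<forall>\<sigma>. M k (\<sigma> + (\<mu> + unit_mi i)) \<le> B * A ^ msize \<sigma> * M l \<sigma>"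
      using k k' by (intro exI[of _ k'] exI[of _ "A * A'"] exI[of _ "A ^ (msize \<mu> + 1) * B"] conjI) auto
  qed
qed

lemma dominated_Roumieu:
  assumes M: "weight_matrix M" and R: "condR1 M" "condR2 M" and l: "l > 0" and h: "h > 0"
  shows "\<exists>k>0. \<exists>h'>0. dominated (wmat M l h) (wmat M k h')"
proof -
  obtain k B C H where k: "k \<ge> l" "B > 0" "C > 0" "H > 0"
    and 1: "\<And>\<alpha> \<beta>. mhalfpow \<alpha> * M l \<beta> \<le> B * C ^ msize \<alpha> * H ^ msize (\<alpha> + \<beta>) * M k (\<alpha> + \<beta>)"
    using R(1) l unfolding condR1_def by meson
  have k0: "k > 0" using k l by linarith
  obtain k' A D where k': "k' \<ge> k" "A > 0" "D > 0" and 2: "\<And>\<sigma>. M k (\<sigma> + (\<lambda>_. 5)) \<le> D * A ^ msize \<sigma> * M k' \<sigma>"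
    using condR2_iterate[OF R(2) M, of "\<lambda>_. 5"] k0 by meson
  have "dominated (wmat M l h) (wmat M k' (9 * (H * (C + h)) * A))"
    by (rule dominatedI[OF M l h k(4,3) k'(2) k(2) k'(3) 1 2])
  moreover have "k' > 0" "9 * (H * (C + h)) * A > 0" using k k' k0 h by auto
  ultimately show ?thesis by blast
qed

lemma dominated_Beurling:
  assumes M: "weight_matrix M" and B: "condB1 M" "condB2 M" and k: "k > 0" and h': "h' > 0"
  shows "\<exists>l>0. \<exists>h>0. dominated (wmat M l h) (wmat M k h')"
proof -
  obtain k1 A D where k1: "k1 > 0" "A > 0" "D > 0" and 2: "\<And>\<sigma>. M k1 (\<sigma> + (\<lambda>_. 5)) \<le> D * A ^ msize \<sigma> * M k \<sigma>"
    using condB2_iterate[OF B(2) M, of "\<lambda>_. 5"] k by meson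
  obtain l H where l: "l > 0" "H > 0" and ex: "\<And>C. C > 0 \<Longrightarrow> \<exists>B>0. \<forall>\<alpha> \<beta>.
      mhalfpow \<alpha> * M l \<beta> \<le> B * C ^ msize \<alpha> * H ^ msize (\<alpha> + \<beta>) * M k1 (\<alpha> + \<beta>)"
    using B(1)[unfolded condB1_def, rule_format, OF k1(1)] by auto
  \<comment> \<open>(B1) fixes H before C is chosen, so C may depend on H. Taking C also as the
    radius of the smaller weight, the radius produced by \<open>dominatedI\<close> is 9 H (C + C) A,
    and 18 = 9 * 2 makes it equal to the prescribed h'.\<close>
  define C where "C = h' / (18 * A * H)"
  have C: "C > 0" unfolding C_def using h' k1 l by simp
  obtain B where Bp: "B > 0" and 1: "\<And>\<alpha> \<beta>. mhalfpow \<alpha> * M l \<beta> \<le> B * C ^ msize \<alpha> * H ^ msize (\<alpha> + \<beta>) * M k1 (\<alpha> + \<beta>)"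
    using ex[OF C] by blast
  have "dominated (wmat M l C) (wmat M k (9 * (H * (C + C)) * A))"
    by (rule dominatedI[OF M l(1) C l(2) C k1(2) Bp k1(3) 1 2])
  moreover have "9 * (H * (C + C)) * A = h'" unfolding C_def using k1 l by (simp add: field_simps)
  ultimately have "dominated (wmat M l C) (wmat M k h')" by simp
  then show ?thesis using l(1) C by blast
qed

lemma dominated_coeff:
  fixes w w' :: "('n::finite \<Rightarrow> nat) \<Rightarrow> real"
  assumes "dominated w w'"
  shows "\<exists>C>0. \<forall>f K. K \<ge> 0 \<longrightarrow> gs_le f (\<lambda>\<sigma>. K * w \<sigma>) \<longrightarrow> lam_le (\<lambda>\<gamma>. hermite_coeff \<gamma> f) (\<lambda>\<beta>. (C * K) * w' \<beta>)"
proof -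
  obtain G C where G: "adm G" and C: "C > 0" and w: "\<And>\<sigma>. w \<sigma> \<le> G \<sigma>" and w': "\<And>\<sigma>. 9 ^ msize \<sigma> * G (\<sigma> + (\<lambda>_. 5)) \<le> C * w' \<sigma>"
    using assms unfolding dominated_def by blast
  \<comment> \<open>The summand 1 makes the constant strictly positive, the form in which the
    continuity criteria take it.\<close>
  define D where "D = 2 ^ CARD('n) * decay_const TYPE('n) + 1"
  have D: "D > 0" unfolding D_def using decay_const_nonneg[where 'n = 'n] by (simp add: add_nonneg_pos)
  have "lam_le (\<lambda>\<gamma>. hermite_coeff \<gamma> f) (\<lambda>\<beta>. ((D * C) * K) * w' \<beta>)" if K: "K \<ge> 0" and f: "gs_le f (\<lambda>\<sigma>. K * w \<sigma>)" for f K
    unfolding lam_le_def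
  proof (intro allI)
    fix \<gamma> \<beta> :: "'n \<Rightarrow> nat"
    have fG: "gs_le f (\<lambda>\<sigma>. K * G \<sigma>)" by (rule gs_le_mono[OF f]) (use w K in \<open>simp add: mult_left_mono\<close>)
    have "9 ^ msize \<beta> * G (\<beta> + (\<lambda>_. 3)) \<le> 9 ^ msize \<beta> * G (\<beta> + (\<lambda>_. 5))"
      by (intro mult_left_mono adm_mono[OF G]) (auto simp: le_fun_def)
    also note w'
    finally have le: "9 ^ msize \<beta> * G (\<beta> + (\<lambda>_. 3)) \<le> C * w' \<beta>" .
    have nn: "0 \<le> 9 ^ msize \<beta> * G (\<beta> + (\<lambda>_. 3))" using adm_pos[OF G, of "\<beta> + (\<lambda>_. 3)"] by simp
    have "cmod (hermite_coeff \<gamma> f) * hpow \<gamma> \<beta> \<le> 2 ^ CARD('n) * decay_const TYPE('n) * (K * (9 ^ msize \<beta> * G (\<beta> + (\<lambda>_. 3))))"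
      by (rule hermite_coeff_bound[OF G fG])
    also have "\<dots> \<le> D * (K * (C * w' \<beta>))"
      by (rule mult_mono[OF _ mult_left_mono[OF le K]]) (use D mult_nonneg_nonneg[OF K nn] in \<open>auto simp: D_def\<close>)
    finally show "cmod (hermite_coeff \<gamma> f) * hpow \<gamma> \<beta> \<le> (D * C) * K * w' \<beta>" by (simp only: ac_simps)
  qed
  moreover have "D * C > 0" using D C by simp
  ultimately show ?thesis by blast
qed

lemma dominated_series:
  fixes w w' :: "('n::finite \<Rightarrow> nat) \<Rightarrow> real"
  assumes "dominated w w'"
  shows "\<exists>C>0. \<forall>c K. K \<ge> 0 \<longrightarrow> lam_le c (\<lambda>\<sigma>. K * w \<sigma>) \<longrightarrow>
    (\<forall>\<alpha> \<beta> \<gamma> x. cmod (complex_of_real (xpow x \<alpha>) * (c \<gamma> * pder \<beta> (hermite_fun \<gamma>) x)) \<le> ((C * K) * w' (\<alpha> + \<beta>)) * rho \<gamma>)"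
proof -
  obtain G C where G: "adm G" and C: "C > 0" and w: "\<And>\<sigma>. w \<sigma> \<le> G \<sigma>" and w': "\<And>\<sigma>. 9 ^ msize \<sigma> * G (\<sigma> + (\<lambda>_. 5)) \<le> C * w' \<sigma>"
    using assms unfolding dominated_def by blast
  have "cmod (complex_of_real (xpow x \<alpha>) * (c \<gamma> * pder \<beta> (hermite_fun \<gamma>) x)) \<le> (((64 ^ CARD('n) * C) * K) * w' (\<alpha> + \<beta>)) * rho \<gamma>"
    if K: "K \<ge> 0" and c: "lam_le c (\<lambda>\<sigma>. K * w \<sigma>)" for c K \<alpha> \<beta> \<gamma> x
  proof -
    have cG: "cmod (c \<gamma>) * hpow \<gamma> \<beta> \<le> K * G \<beta>" for \<beta>
      using c mult_left_mono[OF w K] unfolding lam_le_def by (meson order.trans)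
    have "(4::real) ^ msize (\<alpha> + \<beta>) * G (\<alpha> + \<beta> + (\<lambda>_. 5)) \<le> 9 ^ msize (\<alpha> + \<beta>) * G (\<alpha> + \<beta> + (\<lambda>_. 5))"
      using adm_pos[OF G, of "\<alpha> + \<beta> + (\<lambda>_. 5)"] by (intro mult_right_mono power_mono) auto
    also note w'
    finally have le: "4 ^ msize (\<alpha> + \<beta>) * G (\<alpha> + \<beta> + (\<lambda>_. 5)) \<le> C * w' (\<alpha> + \<beta>)" .
    have "cmod (complex_of_real (xpow x \<alpha>) * (c \<gamma> * pder \<beta> (hermite_fun \<gamma>) x))
       = cmod (c \<gamma>) * cmod (complex_of_real (xpow x \<alpha>) * pder \<beta> (hermite_fun \<gamma>) x)"
      by (simp only: norm_mult mult.left_commute)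
    also have "\<dots> \<le> 64 ^ CARD('n) * rho \<gamma> * (K * (4 ^ msize (\<alpha> + \<beta>) * G (\<alpha> + \<beta> + (\<lambda>_. 5))))"
      by (rule hermite_term_bound[OF G cG]) simp
    also have "\<dots> \<le> 64 ^ CARD('n) * rho \<gamma> * (K * (C * w' (\<alpha> + \<beta>)))"
      using le K rho_nonneg[of \<gamma>] by (intro mult_left_mono) auto
    also have "\<dots> = (((64 ^ CARD('n) * C) * K) * w' (\<alpha> + \<beta>)) * rho \<gamma>" by (simp only: ac_simps)
    finally show ?thesis .
  qed
  moreover have "64 ^ CARD('n) * C > 0" using C by simp
  ultimately show ?thesis by blast
qed

text \<open>\<open>hpow_le_adm\<close> compares the half powers of the fixed \<gamma> with the
  admissible weight between w and w'. This sequence bound is what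
  \<open>dominated_hermite_fun\<close> converts into membership of the Hermite functions.\<close>

lemma dominated_unit:
  assumes "dominated w w'"
  shows "\<exists>K\<ge>0. lam_le (\<lambda>\<delta>. if \<delta> = \<gamma> then 1 else 0) (\<lambda>\<beta>. K * w' \<beta>)"
proof -
  obtain G C where G: "adm G" and C: "C > 0" and w': "\<And>\<sigma>. 9 ^ msize \<sigma> * G (\<sigma> + (\<lambda>_. 5)) \<le> C * w' \<sigma>"
    using assms unfolding dominated_def by blast
  define E where "E = exp (real (msize \<gamma>)) / G 0"
  have E: "E \<ge> 0" unfolding E_def using adm_pos[OF G, of 0] by simp
  have Gw: "G \<beta> \<le> C * w' \<beta>" for \<beta>
  proof -
    have "G \<beta> \<le> G (\<beta> + (\<lambda>_. 5))" by (rule adm_mono[OF G]) (simp add: le_fun_def)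
    also have "\<dots> \<le> 9 ^ msize \<beta> * G (\<beta> + (\<lambda>_. 5))"
      using adm_pos[OF G, of "\<beta> + (\<lambda>_. 5)"] mult_right_mono[of 1 "9 ^ msize \<beta>" "G (\<beta> + (\<lambda>_. 5))"] by simp
    also note w'
    finally show ?thesis .
  qed
  have "cmod (if \<delta> = \<gamma> then 1 else 0) * hpow \<delta> \<beta> \<le> (E * C) * w' \<beta>" for \<delta> \<beta>
  proof -
    have "0 \<le> E * G \<beta>" using E adm_pos[OF G, of \<beta>] by simp
    then have "cmod (if \<delta> = \<gamma> then 1 else 0) * hpow \<delta> \<beta> \<le> E * G \<beta>"
      using hpow_le_adm[OF G, of \<gamma> \<beta>] unfolding E_def by auto
    also have "\<dots> \<le> E * (C * w' \<beta>)" by (rule mult_left_mono[OF Gw E])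
    finally show ?thesis by (simp only: mult.assoc)
  qed
  then show ?thesis unfolding lam_le_def using E C by (intro exI[of _ "E * C"]) auto
qed

lemma dominated_pos:
  assumes "dominated w w'"
  shows "0 < w' \<sigma>"
proof -
  obtain G C where G: "adm G" and C: "C > 0" and w': "\<And>\<sigma>. 9 ^ msize \<sigma> * G (\<sigma> + (\<lambda>_. 5)) \<le> C * w' \<sigma>"
    using assms unfolding dominated_def by blast
  have "0 < 9 ^ msize \<sigma> * G (\<sigma> + (\<lambda>_. 5))" using adm_pos[OF G, of "\<sigma> + (\<lambda>_. 5)"] by simp
  also note w'
  finally show ?thesis using C by (simp add: zero_less_mult_iff)
qed

lemma dominated_hseries:
  fixes w w' :: "('n::finite \<Rightarrow> nat) \<Rightarrow> real"
  assumes d: "dominated w w'"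
  shows "\<exists>C>0. \<forall>c K. K \<ge> 0 \<longrightarrow> lam_le c (\<lambda>\<sigma>. K * w \<sigma>) \<longrightarrow>
    gs_le (hseries c) (\<lambda>\<sigma>. (C * K) * w' \<sigma>) \<and> (\<lambda>\<delta>. hermite_coeff \<delta> (hseries c)) = c"
proof -
  obtain C where C: "C > 0" and bd: "\<And>c K \<alpha> \<beta> \<gamma> x. K \<ge> 0 \<Longrightarrow> lam_le c (\<lambda>\<sigma>. K * w \<sigma>) \<Longrightarrow>
      cmod (complex_of_real (xpow x \<alpha>) * (c \<gamma> * pder \<beta> (hermite_fun \<gamma>) x)) \<le> ((C * K) * w' (\<alpha> + \<beta>)) * rho \<gamma>"
    using dominated_series[OF d] by blast
  define t where "t = rho_tail ({} :: ('n \<Rightarrow> nat) set)"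
  have t: "t \<ge> 0" unfolding t_def by (rule rho_tail_nonneg) simp
  have "gs_le (hseries c) (\<lambda>\<sigma>. ((C * (t + 1)) * K) * w' \<sigma>) \<and> (\<lambda>\<delta>. hermite_coeff \<delta> (hseries c)) = c"
    if K: "K \<ge> 0" and c: "lam_le c (\<lambda>\<sigma>. K * w \<sigma>)" for c K
  proof
    show "gs_le (hseries c) (\<lambda>\<sigma>. ((C * (t + 1)) * K) * w' \<sigma>)"
    proof (rule gs_le_mono[OF gs_le_hseries[OF bd[OF K c]]])
      fix \<sigma>
      have "(C * K * w' \<sigma>) * t \<le> (C * K * w' \<sigma>) * (t + 1)"
        using C K dominated_pos[OF d, of \<sigma>] by (intro mult_left_mono) auto
      then show "C * K * w' \<sigma> * rho_tail ({} :: ('n \<Rightarrow> nat) set) \<le> (C * (t + 1)) * K * w' \<sigma>"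
        unfolding t_def[symmetric] by (simp only: ac_simps)
    qed
    show "(\<lambda>\<delta>. hermite_coeff \<delta> (hseries c)) = c"
      using hermite_coeff_hseries[OF bd[OF K c]] by (rule ext)
  qed
  moreover have "C * (t + 1) > 0" using C t by simp
  ultimately show ?thesis by blast
qed

lemma hermite_coeff_lincomb_gs_le:
  assumes "gs_le f w" "gs_le g w'"
  shows "hermite_coeff \<gamma> (\<lambda>x. a * f x + b * g x) = a * hermite_coeff \<gamma> f + b * hermite_coeff \<gamma> g"
  by (rule hermite_coeff_lincomb[OF borel_measurable_smooth[OF gs_le_smooth[OF assms(1)]] gs_le_bound[OF assms(1)]
      borel_measurable_smooth[OF gs_le_smooth[OF assms(2)]] gs_le_bound[OF assms(2)]])

text \<open>The series and f have the same coefficients, and both are bounded and continuous, so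
  completeness applies to their difference.\<close>

lemma hseries_hermite_coeff:
  assumes f: "gs_le f w" and h: "gs_le (hseries (\<lambda>\<gamma>. hermite_coeff \<gamma> f)) w'"
    and c: "(\<lambda>\<delta>. hermite_coeff \<delta> (hseries (\<lambda>\<gamma>. hermite_coeff \<gamma> f))) = (\<lambda>\<gamma>. hermite_coeff \<gamma> f)"
  shows "hseries (\<lambda>\<gamma>. hermite_coeff \<gamma> f) = f"
proof
  fix y
  let ?h = "hseries (\<lambda>\<gamma>. hermite_coeff \<gamma> f)"
  have "1 * ?h y + (- 1) * f y = 0"
  proof (rule hermite_complete)
    show "continuous_on UNIV (\<lambda>x. 1 * ?h x + (- 1) * f x)"
      by (intro continuous_intros continuous_on_smooth gs_le_smooth[OF f] gs_le_smooth[OF h])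
    show "cmod (1 * ?h x + (- 1) * f x) \<le> w' 0 + w 0" for x
      using norm_triangle_ineq4[of "?h x" "f x"] gs_le_bound[OF f, of x] gs_le_bound[OF h, of x] by simp
    show "hermite_coeff \<gamma> (\<lambda>x. 1 * ?h x + (- 1) * f x) = 0" for \<gamma>
      unfolding hermite_coeff_lincomb_gs_le[OF h f] using fun_cong[OF c, of \<gamma>] by simp
  qed
  then show "?h y = f y" by simp
qed

text \<open>One constant L serves the remainders and the single terms. The former give convergence
  of the expansion, the latter, through the summable \<open>rho\<close>, its absolute convergence
  under a continuous seminorm.\<close>

lemma dominated_expansion:
  fixes w w' :: "('n::finite \<Rightarrow> nat) \<Rightarrow> real"
  assumes d: "dominated w w'" and f: "gs_le f w0" and K: "K \<ge> 0" and c: "lam_le (\<lambda>\<gamma>. hermite_coeff \<gamma> f) (\<lambda>\<sigma>. K * w \<sigma>)"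
  shows "hseries (\<lambda>\<gamma>. hermite_coeff \<gamma> f) = f"
    and "\<exists>L\<ge>0. (\<forall>F. finite F \<longrightarrow> gs_le (\<lambda>x. (\<Sum>\<gamma>\<in>F. hermite_coeff \<gamma> f * hermite_fun \<gamma> x) - f x) (\<lambda>\<sigma>. (L * rho_tail F) * w' \<sigma>)) \<and>
      (\<forall>\<gamma>. gs_le (\<lambda>x. hermite_coeff \<gamma> f * hermite_fun \<gamma> x) (\<lambda>\<sigma>. (L * rho \<gamma>) * w' \<sigma>))"
proof -
  show e: "hseries (\<lambda>\<gamma>. hermite_coeff \<gamma> f) = f"
    using dominated_hseries[OF d] hseries_hermite_coeff[OF f] K c by blast
  obtain C where C: "C > 0" and bd: "\<And>\<alpha> \<beta> \<gamma> x.
      cmod (complex_of_real (xpow x \<alpha>) * (hermite_coeff \<gamma> f * pder \<beta> (hermite_fun \<gamma>) x)) \<le> ((C * K) * w' (\<alpha> + \<beta>)) * rho \<gamma>"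
    using dominated_series[OF d] K c by blast
  have 1: "gs_le (\<lambda>x. (\<Sum>\<gamma>\<in>F. hermite_coeff \<gamma> f * hermite_fun \<gamma> x) - f x) (\<lambda>\<sigma>. ((C * K) * rho_tail F) * w' \<sigma>)" if "finite F" for F
  proof -
    have "gs_le (\<lambda>x. (\<Sum>\<gamma>\<in>F. hermite_coeff \<gamma> f * hermite_fun \<gamma> x) - hseries (\<lambda>\<gamma>. hermite_coeff \<gamma> f) x) (\<lambda>\<sigma>. (C * K) * w' \<sigma> * rho_tail F)"
      by (rule hseries_estimate[OF bd that])
    then show ?thesis unfolding e by (simp only: ac_simps)
  qed
  have 2: "gs_le (\<lambda>x. hermite_coeff \<gamma> f * hermite_fun \<gamma> x) (\<lambda>\<sigma>. ((C * K) * rho \<gamma>) * w' \<sigma>)" for \<gamma>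
    unfolding gs_le_def
  proof (intro conjI allI)
    have eq: "(\<lambda>x. hermite_coeff \<gamma> f * hermite_fun \<gamma> x) = (\<lambda>x. hermite_coeff \<gamma> f * hermite_fun \<gamma> x + 0 * hermite_fun \<gamma> x)" by simp
    show "smooth (\<lambda>x. hermite_coeff \<gamma> f * hermite_fun \<gamma> x)"
      unfolding eq by (rule smooth_lincomb[OF smooth_hermite_fun smooth_hermite_fun])
    fix \<alpha> \<beta> x
    have "pder \<beta> (\<lambda>x. hermite_coeff \<gamma> f * hermite_fun \<gamma> x) x = hermite_coeff \<gamma> f * pder \<beta> (hermite_fun \<gamma>) x"
      unfolding eq pder_lincomb[OF smooth_hermite_fun smooth_hermite_fun] by simp
    then show "cmod (complex_of_real (xpow x \<alpha>) * pder \<beta> (\<lambda>x. hermite_coeff \<gamma> f * hermite_fun \<gamma> x) x) \<le> ((C * K) * rho \<gamma>) * w' (\<alpha> + \<beta>)"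
      using bd[of x \<alpha> \<gamma> \<beta>] by (simp only: ac_simps)
  qed
  show "\<exists>L\<ge>0. (\<forall>F. finite F \<longrightarrow> gs_le (\<lambda>x. (\<Sum>\<gamma>\<in>F. hermite_coeff \<gamma> f * hermite_fun \<gamma> x) - f x) (\<lambda>\<sigma>. (L * rho_tail F) * w' \<sigma>)) \<and>
      (\<forall>\<gamma>. gs_le (\<lambda>x. hermite_coeff \<gamma> f * hermite_fun \<gamma> x) (\<lambda>\<sigma>. (L * rho \<gamma>) * w' \<sigma>))"
  proof (intro exI[of _ "C * K"] conjI allI impI)
    show "0 \<le> C * K" using C K by simp
  qed (use 1 2 in auto)
qed

text \<open>The first domination bounds the unit sequence at \<gamma>, and the second turns a
  sequence bound into bounds on series terms; the term with index \<gamma> is the Hermite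
  function.\<close>

lemma dominated_hermite_fun:
  assumes d: "dominated w w'" and d': "dominated w' w''"
  shows "\<exists>K\<ge>0. gs_le (hermite_fun \<gamma>) (\<lambda>\<sigma>. K * w'' \<sigma>)"
proof -
  obtain K where K: "K \<ge> 0" "lam_le (\<lambda>\<delta>. if \<delta> = \<gamma> then 1 else 0) (\<lambda>\<beta>. K * w' \<beta>)"
    using dominated_unit[OF d] by blast
  obtain C where C: "C > 0" and bd: "\<And>\<alpha> \<beta> \<delta> x.
      cmod (complex_of_real (xpow x \<alpha>) * ((if \<delta> = \<gamma> then 1 else 0) * pder \<beta> (hermite_fun \<delta>) x)) \<le> ((C * K) * w'' (\<alpha> + \<beta>)) * rho \<delta>"
    using dominated_series[OF d'] K by blast
  have "gs_le (hermite_fun \<gamma>) (\<lambda>\<sigma>. (C * K * rho \<gamma>) * w'' \<sigma>)"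
    unfolding gs_le_def
  proof (intro conjI allI smooth_hermite_fun)
    show "cmod (complex_of_real (xpow x \<alpha>) * pder \<beta> (hermite_fun \<gamma>) x) \<le> (C * K * rho \<gamma>) * w'' (\<alpha> + \<beta>)" for \<alpha> \<beta> x
      using bd[of x \<alpha> \<gamma> \<beta>] by (simp only: if_True refl mult_1 ac_simps)
  qed
  moreover have "C * K * rho \<gamma> \<ge> 0" using C K rho_nonneg[of \<gamma>] by simp
  ultimately show ?thesis by blast
qed

section \<open>The Roumieu case\<close>

text \<open>Since M at the index 0 is 1, K bounds the sup norm of f for every pair of parameters.
  Adding 1 keeps the constant positive.\<close>

lemma hermite_coeff_gs_bound:
  assumes "gs_le f (\<lambda>\<sigma>. K * wmat M l h \<sigma>)" "weight_matrix M" "l > 0"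
  shows "cmod (hermite_coeff \<gamma> f) \<le> (hermite_L1 \<gamma> + 1) * K"
proof -
  have b: "cmod (f x) \<le> K" for x using gs_le_bound[OF assms(1), of x] wmat_0[OF assms(2,3)] by simp
  have K: "K \<ge> 0" using b[of undefined] norm_ge_zero order.trans by blast
  have "cmod (hermite_coeff \<gamma> f) \<le> K * hermite_L1 \<gamma>"
    by (rule hermite_coeff_sup_bound[OF borel_measurable_smooth[OF gs_le_smooth[OF assms(1)]] b])
  also have "\<dots> \<le> (hermite_L1 \<gamma> + 1) * K" using K by (simp add: algebra_simps)
  finally show ?thesis .
qed

text \<open>Homogeneity moves the coefficient inside p, so a bound on p of the single terms by the
  summable \<open>rho\<close> is enough; nonnegativity of p removes the absolute value.\<close>

lemma summable_seminorm_terms: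
  assumes p: "cont_seminorm Z p" and X: "lin_space (topspace Z)" and e: "\<And>\<gamma>. hermite_fun \<gamma> \<in> topspace Z"
    and bd: "\<And>\<gamma>. p (\<lambda>x. c \<gamma> * hermite_fun \<gamma> x) \<le> D * rho \<gamma>"
  shows "(\<lambda>\<gamma>. cmod (c \<gamma>) * p (hermite_fun \<gamma>)) summable_on UNIV"
proof -
  have eq: "p (\<lambda>x. c \<gamma> * hermite_fun \<gamma> x) = cmod (c \<gamma>) * p (hermite_fun \<gamma>)" for \<gamma>
    using p e unfolding cont_seminorm_def by blast
  have "0 \<le> p (hermite_fun \<gamma>)" for \<gamma>
    by (rule cont_seminorm_nonneg[OF p e lin_space_scale[OF X e]])
  then have "norm (cmod (c \<gamma>) * p (hermite_fun \<gamma>)) \<le> D * rho \<gamma>" for \<gamma> using bd[of \<gamma>] unfolding eq by simp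
  then have "(\<lambda>\<gamma>. norm (cmod (c \<gamma>) * p (hermite_fun \<gamma>))) summable_on UNIV"
    by (rule Infinite_Sum.abs_summable_on_comparison_test'[OF summable_on_cmult_right[OF rho_summable]])
  then show ?thesis by (rule abs_summable_summable)
qed

text \<open>The sequence spaces are topologised by norms whose two parameters equal the same natural
  number, the function spaces by all pairs of positive reals; this reconciles the two index
  sets.\<close>

lemma ex_nat_ge:
  fixes a b :: real
  shows "\<exists>j::nat. j \<ge> 1 \<and> a \<le> real j \<and> b \<le> real j"
proof -
  obtain n :: nat where "max a b \<le> real n" using real_arch_simple by blast
  then show ?thesis by (intro exI[of _ "Suc n"]) auto
qed

text \<open>\<open>fwd\<close> and \<open>bwd\<close> start from the parameters of a source step and
  find those of a target step, as the criterion for inductive limits asks. The expansion of a given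
  f takes place inside a single step, which suffices for its convergence and for the summability
  under a continuous seminorm.\<close>

theorem Roumieu_case:
  fixes M :: "real \<Rightarrow> ('n::finite \<Rightarrow> nat) \<Rightarrow> real"
  assumes M: "weight_matrix M" and R: "condR1 M" "condR2 M"
  shows "abs_schauder_basis (S_Roumieu_top M) hermite_fun"
    and "top_lin_iso (S_Roumieu_top M) (Lam_Roumieu_top M) (\<lambda>f \<gamma>. hermite_coeff \<gamma> f)"
proof -
  define X where "X = S_Roumieu M"
  define Y where "Y = Lam_Roumieu M"
  define I where "I = {(l::real, h::real). l > 0 \<and> h > 0}"
  define N where "N = (\<lambda>(l, h). gs_norm (M l) h)"
  define P where "P = (\<lambda>j::nat. lam_norm (M (real j)) (real j))"
  define T where "T = (\<lambda>(f :: real^'n \<Rightarrow> complex) \<gamma>. hermite_coeff \<gamma> f)"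
  have top: "S_Roumieu_top M = ind_top X I N" "Lam_Roumieu_top M = ind_top Y {j. j \<ge> 1} P"
    unfolding S_Roumieu_top_def Lam_Roumieu_top_def X_def Y_def I_def N_def P_def by (rule refl)+
  have X: "lin_space X" unfolding X_def by (rule lin_space_S_Roumieu[OF M])
  have Y: "lin_space Y" unfolding Y_def by (rule lin_space_Lam_Roumieu[OF M])
  have XD: "\<exists>l>0. \<exists>h>0. \<exists>K\<ge>0. gs_le f (\<lambda>\<sigma>. K * wmat M l h \<sigma>)" if "f \<in> X" for f
    using that unfolding X_def S_Roumieu_iff[OF M] .
  have XI: "f \<in> X" if "l > 0" "h > 0" "K \<ge> 0" "gs_le f (\<lambda>\<sigma>. K * wmat M l h \<sigma>)" for f l h K
    using that unfolding X_def S_Roumieu_iff[OF M] by blast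
  have YD: "\<exists>l>0. \<exists>h>0. \<exists>K\<ge>0. lam_le c (\<lambda>\<sigma>. K * wmat M l h \<sigma>)" if "c \<in> Y" for c
    using that unfolding Y_def Lam_Roumieu_iff[OF M] .
  have YI: "c \<in> Y" if "l > 0" "h > 0" "K \<ge> 0" "lam_le c (\<lambda>\<sigma>. K * wmat M l h \<sigma>)" for c l h K
    using that unfolding Y_def Lam_Roumieu_iff[OF M] by blast
  have XS: "smooth f" if "f \<in> X" for f using XD[OF that] gs_le_smooth by blast
  have NI: "N (l, h) f \<le> ereal K \<longleftrightarrow> gs_le f (\<lambda>\<sigma>. K * wmat M l h \<sigma>)" if "l > 0" "h > 0" "f \<in> X" for l h f K
    unfolding N_def using gs_norm_le[OF M that(1,2) XS[OF that(3)]] by simp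
  have PI: "P j c \<le> ereal K \<longleftrightarrow> lam_le c (\<lambda>\<sigma>. K * wmat M (real j) (real j) \<sigma>)" if "j \<ge> 1" "K \<ge> 0" for j c K
    unfolding P_def using lam_norm_le[OF M, of "real j" "real j" K c] that by simp
  have Tlin: "linear_on X T"
    unfolding linear_on_def
  proof (intro ballI allI)
    fix f g a b assume f: "f \<in> X" and g: "g \<in> X"
    obtain w w' where "gs_le f w" "gs_le g w'" using XD[OF f] XD[OF g] by blast
    then show "T (\<lambda>x. a * f x + b * g x) = (\<lambda>y. a * T f y + b * T g y)"
      unfolding T_def using hermite_coeff_lincomb_gs_le by blast
  qed
  have fwd: "\<exists>k>0. \<exists>h'>0. \<exists>C>0. \<forall>f K. K \<ge> 0 \<longrightarrow> gs_le f (\<lambda>\<sigma>. K * wmat M l h \<sigma>) \<longrightarrow> lam_le (T f) (\<lambda>\<beta>. (C * K) * wmat M k h' \<beta>)"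
    if lh: "l > 0" "h > 0" for l h
  proof -
    obtain k h' where k: "k > 0" "h' > 0" and d: "dominated (wmat M l h) (wmat M k h')" using dominated_Roumieu[OF M R lh] by blast
    show ?thesis unfolding T_def
      by (rule exI[of _ k], rule conjI[OF k(1)], rule exI[of _ h'], rule conjI[OF k(2)], rule dominated_coeff[OF d])
  qed
  have bwd: "\<exists>k>0. \<exists>h'>0. \<exists>C>0. \<forall>c K. K \<ge> 0 \<longrightarrow> lam_le c (\<lambda>\<sigma>. K * wmat M l h \<sigma>) \<longrightarrow>
      gs_le (hseries c) (\<lambda>\<sigma>. (C * K) * wmat M k h' \<sigma>) \<and> T (hseries c) = c"
    if lh: "l > 0" "h > 0" for l h
  proof -
    obtain k h' where k: "k > 0" "h' > 0" and d: "dominated (wmat M l h) (wmat M k h')" using dominated_Roumieu[OF M R lh] by blast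
    show ?thesis unfolding T_def
      by (rule exI[of _ k], rule conjI[OF k(1)], rule exI[of _ h'], rule conjI[OF k(2)], rule dominated_hseries[OF d])
  qed
  have TY: "T f \<in> Y" if "f \<in> X" for f
  proof -
    obtain l h K where f: "l > 0" "h > 0" "K \<ge> 0" "gs_le f (\<lambda>\<sigma>. K * wmat M l h \<sigma>)" using XD[OF \<open>f \<in> X\<close>] by blast
    obtain k h' C where k: "k > 0" "h' > 0" "C > 0" "lam_le (T f) (\<lambda>\<beta>. (C * K) * wmat M k h' \<beta>)"
      using fwd[OF f(1,2)] f(3,4) by blast
    show ?thesis by (rule YI[OF k(1,2) _ k(4)]) (use k f in simp)
  qed
  have RX: "hseries c \<in> X \<and> T (hseries c) = c" if "c \<in> Y" for c
  proof -
    obtain l h K where f: "l > 0" "h > 0" "K \<ge> 0" "lam_le c (\<lambda>\<sigma>. K * wmat M l h \<sigma>)" using YD[OF \<open>c \<in> Y\<close>] by blast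
    obtain k h' C where k: "k > 0" "h' > 0" "C > 0" "gs_le (hseries c) (\<lambda>\<sigma>. (C * K) * wmat M k h' \<sigma>)" "T (hseries c) = c"
      using bwd[OF f(1,2)] f(3,4) by blast
    have "hseries c \<in> X" by (rule XI[OF k(1,2) _ k(4)]) (use k f in simp)
    then show ?thesis using k(5) by blast
  qed
  have exp: "hseries (T f) = f \<and> (\<exists>k>0. \<exists>h'>0. \<exists>L\<ge>0.
      (\<forall>F. finite F \<longrightarrow> gs_le (\<lambda>x. (\<Sum>\<gamma>\<in>F. T f \<gamma> * hermite_fun \<gamma> x) - f x) (\<lambda>\<sigma>. (L * rho_tail F) * wmat M k h' \<sigma>)) \<and>
      (\<forall>\<gamma>. gs_le (\<lambda>x. T f \<gamma> * hermite_fun \<gamma> x) (\<lambda>\<sigma>. (L * rho \<gamma>) * wmat M k h' \<sigma>)))" if fX: "f \<in> X" for f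
  proof -
    obtain w0 where f: "gs_le f w0" using XD[OF fX] by blast
    obtain l h K where c: "l > 0" "h > 0" "K \<ge> 0" "lam_le (T f) (\<lambda>\<sigma>. K * wmat M l h \<sigma>)" using YD[OF TY[OF fX]] by blast
    obtain k h' where k: "k > 0" "h' > 0" and d: "dominated (wmat M l h) (wmat M k h')" using dominated_Roumieu[OF M R c(1,2)] by blast
    note e = dominated_expansion[OF d f c(3) c(4)[unfolded T_def]]
    show ?thesis unfolding T_def
      by (rule conjI[OF e(1)], rule exI[of _ k], rule conjI[OF k(1)], rule exI[of _ h'], rule conjI[OF k(2) e(2)])
  qed
  have HX: "hermite_fun \<gamma> \<in> X" for \<gamma>
  proof -
    \<comment> \<open>Any step may serve as a start; two dominations lead from it to a step that
      contains all Hermite functions.\<close>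
    obtain k h' where k: "k > 0" "h' > 0" and d: "dominated (wmat M 1 1) (wmat M k h')" using dominated_Roumieu[OF M R, of 1 1] by auto
    obtain k2 h2 where k2: "k2 > 0" "h2 > 0" and d2: "dominated (wmat M k h') (wmat M k2 h2)" using dominated_Roumieu[OF M R k] by blast
    obtain K where K: "K \<ge> 0" "gs_le (hermite_fun \<gamma>) (\<lambda>\<sigma>. K * wmat M k2 h2 \<sigma>)" using dominated_hermite_fun[OF d d2] by blast
    show ?thesis by (rule XI[OF k2 K])
  qed
  have sumX: "(\<lambda>x. \<Sum>\<gamma>\<in>F. c \<gamma> * hermite_fun \<gamma> x) \<in> X" for c F
    by (rule lin_space_sum[OF X HX HX])
  note topX = topspace_ind_top[OF X] and topY = topspace_ind_top[OF Y]
  show "top_lin_iso (S_Roumieu_top M) (Lam_Roumieu_top M) (\<lambda>f \<gamma>. hermite_coeff \<gamma> f)"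
    unfolding top T_def[symmetric]
  proof (rule top_lin_isoI[where R = hseries])
    show "continuous_map (ind_top X I N) (ind_top Y {j. j \<ge> 1} P) T"
    proof (rule continuous_map_ind_top[OF X Y TY Tlin])
      fix i assume "i \<in> I"
      then obtain l h where i: "i = (l, h)" "l > 0" "h > 0" unfolding I_def by auto
      obtain k h' C where k: "k > 0" "h' > 0" "C > 0"
        and C: "\<And>f K. K \<ge> 0 \<Longrightarrow> gs_le f (\<lambda>\<sigma>. K * wmat M l h \<sigma>) \<Longrightarrow> lam_le (T f) (\<lambda>\<beta>. (C * K) * wmat M k h' \<beta>)"
        using fwd[OF i(2,3)] by blast
      \<comment> \<open>Enlarging both parameters to one natural number weakens the bound, so the
        image stays in a step of the sequence space.\<close>
      obtain j :: nat where j: "j \<ge> 1" "k \<le> real j" "h' \<le> real j" using ex_nat_ge by blast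
      have "P j (T f) \<le> ereal (C * K)" if f: "f \<in> X" "K \<ge> 0" "N i f \<le> ereal K" for f K
      proof -
        have "gs_le f (\<lambda>\<sigma>. K * wmat M l h \<sigma>)" using f(3) NI[OF i(2,3) f(1)] unfolding i(1) by blast
        then have "lam_le (T f) (\<lambda>\<beta>. (C * K) * wmat M k h' \<beta>)" by (rule C[OF f(2)])
        then have "lam_le (T f) (\<lambda>\<beta>. (C * K) * wmat M (real j) (real j) \<beta>)"
          by (rule lam_le_wmat_mono[OF _ M k(1) j(2) k(2) j(3)]) (use k f in auto)
        then show ?thesis using PI[OF j(1), of "C * K"] k(3) f(2) by simp
      qed
      then show "\<exists>j\<in>{j. j \<ge> 1}. \<exists>C>0. \<forall>f\<in>X. \<forall>K\<ge>0. N i f \<le> ereal K \<longrightarrow> P j (T f) \<le> ereal (C * K)"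
        using j(1) k(3) by blast
    qed
    show "continuous_map (ind_top Y {j. j \<ge> 1} P) (ind_top X I N) hseries"
    proof (rule continuous_map_ind_top[OF Y X])
      show "hseries c \<in> X" if "c \<in> Y" for c using RX[OF that] by blast
      show "linear_on Y hseries"
        by (rule linear_on_inverse[OF Tlin X]) (use RX exp in auto)
      fix j :: nat assume "j \<in> {j. j \<ge> 1}"
      then have j: "j \<ge> 1" "real j > 0" by auto
      obtain k h' C where k: "k > 0" "h' > 0" "C > 0"
        and C: "\<And>c K. K \<ge> 0 \<Longrightarrow> lam_le c (\<lambda>\<sigma>. K * wmat M (real j) (real j) \<sigma>) \<Longrightarrow> gs_le (hseries c) (\<lambda>\<sigma>. (C * K) * wmat M k h' \<sigma>)"
        using bwd[OF j(2,2)] by blast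
      have "N (k, h') (hseries c) \<le> ereal (C * K)" if c: "c \<in> Y" "K \<ge> 0" "P j c \<le> ereal K" for c K
        using C[OF c(2)] c(3) PI[OF j(1) c(2)] NI[OF k(1,2), of "hseries c"] RX[OF c(1)] by blast
      moreover have "(k, h') \<in> I" unfolding I_def using k by simp
      ultimately show "\<exists>i\<in>I. \<exists>C>0. \<forall>f\<in>Y. \<forall>K\<ge>0. P j f \<le> ereal K \<longrightarrow> N i (hseries f) \<le> ereal (C * K)"
        using k(3) by blast
    qed
    show "linear_on (topspace (ind_top X I N)) T" unfolding topX by (rule Tlin)
    show "hseries (T f) = f" if "f \<in> topspace (ind_top X I N)" for f using that exp unfolding topX by blast
    show "T (hseries c) = c" if "c \<in> topspace (ind_top Y {j. j \<ge> 1} P)" for c using that RX unfolding topY by blast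
  qed
  show "abs_schauder_basis (S_Roumieu_top M) hermite_fun"
    unfolding top
  proof (rule abs_schauder_basisI[where \<xi> = "\<lambda>\<gamma> f. T f \<gamma>"])
    show "hermite_fun \<gamma> \<in> topspace (ind_top X I N)" for \<gamma> unfolding topX by (rule HX)
    show "continuous_map (ind_top X I N) euclidean (\<lambda>f. T f \<gamma>)" for \<gamma>
    proof (rule continuous_functional_ind_top[OF X])
      show "T (\<lambda>x. a * f x + b * g x) \<gamma> = a * T f \<gamma> + b * T g \<gamma>" if "f \<in> X" "g \<in> X" for f g a b
        using linear_onD[OF Tlin that] by simp
      fix i assume "i \<in> I"
      then obtain l h where i: "i = (l, h)" "l > 0" "h > 0" unfolding I_def by auto
      have "cmod (T f \<gamma>) \<le> (hermite_L1 \<gamma> + 1) * K" if "f \<in> X" "N i f \<le> ereal K" for f K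
        unfolding T_def using hermite_coeff_gs_bound[OF _ M i(2)] NI[OF i(2,3) that(1)] that(2) unfolding i(1) by blast
      then show "\<exists>C>0. \<forall>f\<in>X. \<forall>K\<ge>0. N i f \<le> ereal K \<longrightarrow> cmod (T f \<gamma>) \<le> C * K"
        using hermite_L1_nonneg[of \<gamma>] by (intro exI[of _ "hermite_L1 \<gamma> + 1"]) auto
    qed
    show "T (\<lambda>x. \<Sum>\<gamma>\<in>F. c \<gamma> * hermite_fun \<gamma> x) \<delta> = (if \<delta> \<in> F then c \<delta> else 0)" if "finite F" for \<delta> c F
      unfolding T_def by (rule hermite_coeff_sum[OF that])
    fix f assume "f \<in> topspace (ind_top X I N)"
    then have fX: "f \<in> X" unfolding topX .
    obtain k h' L where k: "k > 0" "h' > 0" "L \<ge> 0"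
      and S: "\<And>F. finite F \<Longrightarrow> gs_le (\<lambda>x. (\<Sum>\<gamma>\<in>F. T f \<gamma> * hermite_fun \<gamma> x) - f x) (\<lambda>\<sigma>. (L * rho_tail F) * wmat M k h' \<sigma>)"
      and E: "\<And>\<gamma>. gs_le (\<lambda>x. T f \<gamma> * hermite_fun \<gamma> x) (\<lambda>\<sigma>. (L * rho \<gamma>) * wmat M k h' \<sigma>)"
      using exp[OF fX] by blast
    have kI: "(k, h') \<in> I" unfolding I_def using k by simp
    show "expands (ind_top X I N) hermite_fun (\<lambda>\<gamma>. T f \<gamma>) f"
      unfolding expands_def
    proof (rule limitin_ind_top[OF X fX _ kI, where t = "\<lambda>F. L * rho_tail F"])
      show "\<forall>\<^sub>F F in finite_subsets_at_top UNIV. N (k, h') (\<lambda>x. (\<Sum>\<gamma>\<in>F. T f \<gamma> * hermite_fun \<gamma> x) - f x) \<le> ereal (L * rho_tail F)"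
        by (rule eventually_finite_subsets_at_top_weakI) (use NI[OF k(1,2) lin_space_diff[OF X sumX fX]] S in blast)
      show "((\<lambda>F. L * rho_tail F) \<longlongrightarrow> 0) (finite_subsets_at_top (UNIV :: ('n \<Rightarrow> nat) set))"
        using tendsto_mult_right_zero[OF rho_tail_tendsto] .
    qed (use sumX in simp)
    fix p assume p: "cont_seminorm (ind_top X I N) p"
    have Nh: "N (k, h') (\<lambda>x. a * g x) \<le> ereal (cmod a * K)" if "g \<in> X" "K \<ge> 0" "N (k, h') g \<le> ereal K" for g a K
      using NI[OF k(1,2) lin_space_scale[OF X that(1)]] NI[OF k(1,2) that(1)] that(3) gs_le_scale by blast
    obtain D where D: "D \<ge> 0" "\<And>g K. g \<in> X \<Longrightarrow> K \<ge> 0 \<Longrightarrow> N (k, h') g \<le> ereal K \<Longrightarrow> p g \<le> D * K"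
      using cont_seminorm_ind_bound[OF p X kI Nh] by blast
    have "p (\<lambda>x. T f \<gamma> * hermite_fun \<gamma> x) \<le> (D * L) * rho \<gamma>" for \<gamma>
    proof -
      have gX: "(\<lambda>x. T f \<gamma> * hermite_fun \<gamma> x) \<in> X" by (rule lin_space_scale[OF X HX])
      have "p (\<lambda>x. T f \<gamma> * hermite_fun \<gamma> x) \<le> D * (L * rho \<gamma>)"
        by (rule D(2)[OF gX]) (use k rho_nonneg[of \<gamma>] NI[OF k(1,2) gX] E in auto)
      then show ?thesis by (simp only: mult.assoc)
    qed
    then show "(\<lambda>\<gamma>. cmod (T f \<gamma>) * p (hermite_fun \<gamma>)) summable_on UNIV"
      by (rule summable_seminorm_terms[OF p, unfolded topX, OF X HX])
  qed
qed

section \<open>The Beurling case\<close>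

lemma ex_nat_inverse_le:
  fixes a b :: real
  assumes "a > 0" "b > 0"
  shows "\<exists>j::nat. j \<ge> 1 \<and> 1 / real j \<le> a \<and> 1 / real j \<le> b"
proof -
  obtain j :: nat where j: "j \<ge> 1" "1 / a \<le> real j" "1 / b \<le> real j" using ex_nat_ge by blast
  then have "1 / real j \<le> a" "1 / real j \<le> b" using assms by (simp_all add: field_simps)
  then show ?thesis using j(1) by blast
qed

text \<open>The quantifiers of the Roumieu case are reversed: the parameters of the target norm are
  given, and \<open>dominated_Beurling\<close> finds those of the source. Membership and convergence
  must be checked at every pair of parameters, with constants depending on the pair.\<close>

theorem Beurling_case:
  fixes M :: "real \<Rightarrow> ('n::finite \<Rightarrow> nat) \<Rightarrow> real"
  assumes M: "weight_matrix M" and B: "condB1 M" "condB2 M"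
  shows "abs_schauder_basis (S_Beurling_top M) hermite_fun"
    and "top_lin_iso (S_Beurling_top M) (Lam_Beurling_top M) (\<lambda>f \<gamma>. hermite_coeff \<gamma> f)"
proof -
  define X where "X = S_Beurling M"
  define Y where "Y = Lam_Beurling M"
  define I where "I = {(l::real, h::real). l > 0 \<and> h > 0}"
  define N where "N = (\<lambda>(l, h). gs_norm (M l) h)"
  define P where "P = (\<lambda>j::nat. lam_norm (M (1 / real j)) (1 / real j))"
  define T where "T = (\<lambda>(f :: real^'n \<Rightarrow> complex) \<gamma>. hermite_coeff \<gamma> f)"
  have top: "S_Beurling_top M = proj_top X I N" "Lam_Beurling_top M = proj_top Y {j. j \<ge> 1} P"
    unfolding S_Beurling_top_def Lam_Beurling_top_def X_def Y_def I_def N_def P_def by (rule refl)+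
  have X: "lin_space X" unfolding X_def by (rule lin_space_S_Beurling[OF M])
  have Y: "lin_space Y" unfolding Y_def by (rule lin_space_Lam_Beurling[OF M])
  have XD: "\<exists>K\<ge>0. gs_le f (\<lambda>\<sigma>. K * wmat M l h \<sigma>)" if "f \<in> X" "l > 0" "h > 0" for f l h
    using that unfolding X_def S_Beurling_iff[OF M] by blast
  have XI: "f \<in> X" if "\<And>l h. l > 0 \<Longrightarrow> h > 0 \<Longrightarrow> \<exists>K\<ge>0. gs_le f (\<lambda>\<sigma>. K * wmat M l h \<sigma>)" for f
    using that unfolding X_def S_Beurling_iff[OF M] by blast
  have YD: "\<exists>K\<ge>0. lam_le c (\<lambda>\<sigma>. K * wmat M l h \<sigma>)" if "c \<in> Y" "l > 0" "h > 0" for c l h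
    using that unfolding Y_def Lam_Beurling_iff[OF M] by blast
  have YI: "c \<in> Y" if "\<And>l h. l > 0 \<Longrightarrow> h > 0 \<Longrightarrow> \<exists>K\<ge>0. lam_le c (\<lambda>\<sigma>. K * wmat M l h \<sigma>)" for c
    using that unfolding Y_def Lam_Beurling_iff[OF M] by blast
  have XS: "smooth f" if "f \<in> X" for f using XD[OF that, of 1 1] gs_le_smooth by auto
  have NI: "N (l, h) f \<le> ereal K \<longleftrightarrow> gs_le f (\<lambda>\<sigma>. K * wmat M l h \<sigma>)" if "l > 0" "h > 0" "f \<in> X" for l h f K
    unfolding N_def using gs_norm_le[OF M that(1,2) XS[OF that(3)]] by simp
  have PI: "P j c \<le> ereal K \<longleftrightarrow> lam_le c (\<lambda>\<sigma>. K * wmat M (1 / real j) (1 / real j) \<sigma>)" if "j \<ge> 1" "K \<ge> 0" for j c K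
    unfolding P_def using lam_norm_le[OF M, of "1 / real j" "1 / real j" K c] that by simp
  have Tlin: "linear_on X T"
    unfolding linear_on_def
  proof (intro ballI allI)
    fix f g a b assume f: "f \<in> X" and g: "g \<in> X"
    obtain w w' where "gs_le f w" "gs_le g w'" using XD[OF f, of 1 1] XD[OF g, of 1 1] by auto
    then show "T (\<lambda>x. a * f x + b * g x) = (\<lambda>y. a * T f y + b * T g y)"
      unfolding T_def using hermite_coeff_lincomb_gs_le by blast
  qed
  have fwd: "\<exists>l>0. \<exists>h>0. \<exists>C>0. \<forall>f K. K \<ge> 0 \<longrightarrow> gs_le f (\<lambda>\<sigma>. K * wmat M l h \<sigma>) \<longrightarrow> lam_le (T f) (\<lambda>\<beta>. (C * K) * wmat M k h' \<beta>)"
    if kh: "k > 0" "h' > 0" for k h'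
  proof -
    obtain l h where l: "l > 0" "h > 0" and d: "dominated (wmat M l h) (wmat M k h')" using dominated_Beurling[OF M B kh] by blast
    show ?thesis unfolding T_def
      by (rule exI[of _ l], rule conjI[OF l(1)], rule exI[of _ h], rule conjI[OF l(2)], rule dominated_coeff[OF d])
  qed
  have bwd: "\<exists>l>0. \<exists>h>0. \<exists>C>0. \<forall>c K. K \<ge> 0 \<longrightarrow> lam_le c (\<lambda>\<sigma>. K * wmat M l h \<sigma>) \<longrightarrow>
      gs_le (hseries c) (\<lambda>\<sigma>. (C * K) * wmat M k h' \<sigma>) \<and> T (hseries c) = c"
    if kh: "k > 0" "h' > 0" for k h'
  proof -
    obtain l h where l: "l > 0" "h > 0" and d: "dominated (wmat M l h) (wmat M k h')" using dominated_Beurling[OF M B kh] by blast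
    show ?thesis unfolding T_def
      by (rule exI[of _ l], rule conjI[OF l(1)], rule exI[of _ h], rule conjI[OF l(2)], rule dominated_hseries[OF d])
  qed
  have TY: "T f \<in> Y" if fX: "f \<in> X" for f
  proof (rule YI)
    fix k h' :: real assume kh: "k > 0" "h' > 0"
    obtain l h C where l: "l > 0" "h > 0" "C > 0"
      and C: "\<And>K. K \<ge> 0 \<Longrightarrow> gs_le f (\<lambda>\<sigma>. K * wmat M l h \<sigma>) \<Longrightarrow> lam_le (T f) (\<lambda>\<beta>. (C * K) * wmat M k h' \<beta>)"
      using fwd[OF kh] by blast
    obtain K where K: "K \<ge> 0" "gs_le f (\<lambda>\<sigma>. K * wmat M l h \<sigma>)" using XD[OF fX l(1,2)] by blast
    have "C * K \<ge> 0" using l K by simp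
    then show "\<exists>K\<ge>0. lam_le (T f) (\<lambda>\<sigma>. K * wmat M k h' \<sigma>)" using C[OF K] by blast
  qed
  have RX: "hseries c \<in> X \<and> T (hseries c) = c" if cY: "c \<in> Y" for c
  proof -
    have 1: "\<exists>K\<ge>0. gs_le (hseries c) (\<lambda>\<sigma>. K * wmat M k h' \<sigma>) \<and> T (hseries c) = c" if kh: "k > 0" "h' > 0" for k h'
    proof -
      obtain l h C where l: "l > 0" "h > 0" "C > 0"
        and C: "\<And>K. K \<ge> 0 \<Longrightarrow> lam_le c (\<lambda>\<sigma>. K * wmat M l h \<sigma>) \<Longrightarrow> gs_le (hseries c) (\<lambda>\<sigma>. (C * K) * wmat M k h' \<sigma>) \<and> T (hseries c) = c"
        using bwd[OF kh] by blast
      obtain K where K: "K \<ge> 0" "lam_le c (\<lambda>\<sigma>. K * wmat M l h \<sigma>)" using YD[OF cY l(1,2)] by blast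
      have "C * K \<ge> 0" using l K by simp
      then show ?thesis using C[OF K] by blast
    qed
    have "hseries c \<in> X" by (rule XI) (use 1 in blast)
    moreover have "T (hseries c) = c" using 1[of 1 1] by auto
    ultimately show ?thesis by blast
  qed
  have exp: "hseries (T f) = f \<and> (\<exists>L\<ge>0.
      (\<forall>F. finite F \<longrightarrow> gs_le (\<lambda>x. (\<Sum>\<gamma>\<in>F. T f \<gamma> * hermite_fun \<gamma> x) - f x) (\<lambda>\<sigma>. (L * rho_tail F) * wmat M k h' \<sigma>)) \<and>
      (\<forall>\<gamma>. gs_le (\<lambda>x. T f \<gamma> * hermite_fun \<gamma> x) (\<lambda>\<sigma>. (L * rho \<gamma>) * wmat M k h' \<sigma>)))"
    if fX: "f \<in> X" and kh: "k > 0" "h' > 0" for f k h'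
  proof -
    obtain w0 where f: "gs_le f w0" using XD[OF fX kh] by blast
    obtain l h where l: "l > 0" "h > 0" and d: "dominated (wmat M l h) (wmat M k h')" using dominated_Beurling[OF M B kh] by blast
    obtain K where K: "K \<ge> 0" "lam_le (T f) (\<lambda>\<sigma>. K * wmat M l h \<sigma>)" using YD[OF TY[OF fX] l] by blast
    show ?thesis unfolding T_def by (rule conjI[OF dominated_expansion[OF d f K(1) K(2)[unfolded T_def]]])
  qed
  have inv: "hseries (T f) = f" if "f \<in> X" for f using exp[OF that, of 1 1] by simp
  have HX: "hermite_fun \<gamma> \<in> X" for \<gamma>
  proof (rule XI)
    fix k h' :: real assume kh: "k > 0" "h' > 0"
    obtain l h where l: "l > 0" "h > 0" and d: "dominated (wmat M l h) (wmat M k h')" using dominated_Beurling[OF M B kh] by blast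
    obtain l2 h2 where d2: "dominated (wmat M l2 h2) (wmat M l h)" using dominated_Beurling[OF M B l] by blast
    show "\<exists>K\<ge>0. gs_le (hermite_fun \<gamma>) (\<lambda>\<sigma>. K * wmat M k h' \<sigma>)" by (rule dominated_hermite_fun[OF d2 d])
  qed
  have sumX: "(\<lambda>x. \<Sum>\<gamma>\<in>F. c \<gamma> * hermite_fun \<gamma> x) \<in> X" for c F
    by (rule lin_space_sum[OF X HX HX])
  note topX = topspace_proj_top[of X I N] and topY = topspace_proj_top[of Y "{j. j \<ge> 1}" P]
  show "top_lin_iso (S_Beurling_top M) (Lam_Beurling_top M) (\<lambda>f \<gamma>. hermite_coeff \<gamma> f)"
    unfolding top T_def[symmetric]
  proof (rule top_lin_isoI[where R = hseries])
    show "continuous_map (proj_top X I N) (proj_top Y {j. j \<ge> 1} P) T"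
    proof (rule continuous_map_proj_top[OF X TY Tlin])
      fix j :: nat assume "j \<in> {j. j \<ge> 1}"
      then have j: "j \<ge> 1" "1 / real j > 0" by auto
      obtain l h C where l: "l > 0" "h > 0" "C > 0"
        and C: "\<And>f K. K \<ge> 0 \<Longrightarrow> gs_le f (\<lambda>\<sigma>. K * wmat M l h \<sigma>) \<Longrightarrow> lam_le (T f) (\<lambda>\<beta>. (C * K) * wmat M (1 / real j) (1 / real j) \<beta>)"
        using fwd[OF j(2,2)] by blast
      have "P j (T f) \<le> ereal (C * K)" if f: "f \<in> X" "K \<ge> 0" "N (l, h) f \<le> ereal K" for f K
      proof -
        have "gs_le f (\<lambda>\<sigma>. K * wmat M l h \<sigma>)" using f(3) NI[OF l(1,2) f(1)] by blast
        then have "lam_le (T f) (\<lambda>\<beta>. (C * K) * wmat M (1 / real j) (1 / real j) \<beta>)" by (rule C[OF f(2)])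
        then show ?thesis using PI[OF j(1), of "C * K"] l(3) f(2) by simp
      qed
      moreover have "(l, h) \<in> I" unfolding I_def using l by simp
      ultimately show "\<exists>i\<in>I. \<exists>C>0. \<forall>f\<in>X. \<forall>K\<ge>0. N i f \<le> ereal K \<longrightarrow> P j (T f) \<le> ereal (C * K)"
        using l(3) by blast
    qed
    show "continuous_map (proj_top Y {j. j \<ge> 1} P) (proj_top X I N) hseries"
    proof (rule continuous_map_proj_top[OF Y])
      show "hseries c \<in> X" if "c \<in> Y" for c using RX[OF that] by blast
      show "linear_on Y hseries"
        by (rule linear_on_inverse[OF Tlin X]) (use RX inv in auto)
      fix i assume "i \<in> I"
      then obtain k h' where i: "i = (k, h')" "k > 0" "h' > 0" unfolding I_def by auto
      obtain l h C where l: "l > 0" "h > 0" "C > 0"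
        and C: "\<And>c K. K \<ge> 0 \<Longrightarrow> lam_le c (\<lambda>\<sigma>. K * wmat M l h \<sigma>) \<Longrightarrow> gs_le (hseries c) (\<lambda>\<sigma>. (C * K) * wmat M k h' \<sigma>)"
        using bwd[OF i(2,3)] by blast
      \<comment> \<open>Now the available norms have parameters 1/j; shrinking both parameters
        strengthens the bound, so a large j dominates the required source norm.\<close>
      obtain j :: nat where j: "j \<ge> 1" "1 / real j \<le> l" "1 / real j \<le> h" using ex_nat_inverse_le[OF l(1,2)] by blast
      have jp: "1 / real j > 0" using j(1) by simp
      have "N i (hseries c) \<le> ereal (C * K)" if c: "c \<in> Y" "K \<ge> 0" "P j c \<le> ereal K" for c K
      proof -
        have "lam_le c (\<lambda>\<sigma>. K * wmat M (1 / real j) (1 / real j) \<sigma>)" using c(3) PI[OF j(1) c(2)] by blast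
        then have "lam_le c (\<lambda>\<sigma>. K * wmat M l h \<sigma>)"
          by (rule lam_le_wmat_mono[OF _ M jp j(2) jp j(3) c(2) order.refl])
        then have "gs_le (hseries c) (\<lambda>\<sigma>. (C * K) * wmat M k h' \<sigma>)" by (rule C[OF c(2)])
        then show ?thesis using NI[OF i(2,3), of "hseries c" "C * K"] RX[OF c(1)] unfolding i(1) by blast
      qed
      then show "\<exists>j\<in>{j. j \<ge> 1}. \<exists>C>0. \<forall>f\<in>Y. \<forall>K\<ge>0. P j f \<le> ereal K \<longrightarrow> N i (hseries f) \<le> ereal (C * K)"
        using l(3) j(1) by blast
    qed
    show "linear_on (topspace (proj_top X I N)) T" unfolding topX by (rule Tlin)
    show "hseries (T f) = f" if "f \<in> topspace (proj_top X I N)" for f using that inv unfolding topX by blast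
    show "T (hseries c) = c" if "c \<in> topspace (proj_top Y {j. j \<ge> 1} P)" for c using that RX unfolding topY by blast
  qed
  show "abs_schauder_basis (S_Beurling_top M) hermite_fun"
    unfolding top
  proof (rule abs_schauder_basisI[where \<xi> = "\<lambda>\<gamma> f. T f \<gamma>"])
    show "hermite_fun \<gamma> \<in> topspace (proj_top X I N)" for \<gamma> unfolding topX by (rule HX)
    show "continuous_map (proj_top X I N) euclidean (\<lambda>f. T f \<gamma>)" for \<gamma>
    \<comment> \<open>One norm controls the coefficient, because any of them bounds the sup norm;
      the pair (1, 1) is an arbitrary choice.\<close>
    proof (rule continuous_functional_proj_top[OF X, where i = "(1, 1)" and C = "hermite_L1 \<gamma> + 1"])
      show "T (\<lambda>x. a * f x + b * g x) \<gamma> = a * T f \<gamma> + b * T g \<gamma>" if "f \<in> X" "g \<in> X" for f g a b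
        using linear_onD[OF Tlin that] by simp
      show "(1, 1) \<in> I" unfolding I_def by simp
      show "hermite_L1 \<gamma> + 1 > 0" using hermite_L1_nonneg[of \<gamma>] by simp
      show "cmod (T f \<gamma>) \<le> (hermite_L1 \<gamma> + 1) * K" if "f \<in> X" "N (1, 1) f \<le> ereal K" for f K
        unfolding T_def using hermite_coeff_gs_bound[OF _ M, of f K 1 1] NI[OF _ _ that(1), of 1 1] that(2) by simp
    qed
    show "T (\<lambda>x. \<Sum>\<gamma>\<in>F. c \<gamma> * hermite_fun \<gamma> x) \<delta> = (if \<delta> \<in> F then c \<delta> else 0)" if "finite F" for \<delta> c F
      unfolding T_def by (rule hermite_coeff_sum[OF that])
    fix f assume "f \<in> topspace (proj_top X I N)"
    then have fX: "f \<in> X" unfolding topX .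
    have ex: "\<exists>L\<ge>0. (\<forall>F. finite F \<longrightarrow> N i (\<lambda>x. (\<Sum>\<gamma>\<in>F. T f \<gamma> * hermite_fun \<gamma> x) - f x) \<le> ereal (L * rho_tail F)) \<and>
      (\<forall>\<gamma>. N i (\<lambda>x. T f \<gamma> * hermite_fun \<gamma> x) \<le> ereal (L * rho \<gamma>))" if iI: "i \<in> I" for i
    proof -
      obtain k h' where i: "i = (k, h')" "k > 0" "h' > 0" using iI unfolding I_def by auto
      show ?thesis
        unfolding i(1) NI[OF i(2,3) lin_space_diff[OF X sumX fX]] NI[OF i(2,3) lin_space_scale[OF X HX]]
        using exp[OF fX i(2,3)] by blast
    qed
    show "expands (proj_top X I N) hermite_fun (\<lambda>\<gamma>. T f \<gamma>) f"
      unfolding expands_def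
    proof (rule limitin_proj_top[OF fX])
      fix i assume "i \<in> I"
      then obtain L where L: "\<And>F. finite F \<Longrightarrow> N i (\<lambda>x. (\<Sum>\<gamma>\<in>F. T f \<gamma> * hermite_fun \<gamma> x) - f x) \<le> ereal (L * rho_tail F)"
        using ex by blast
      show "\<exists>t. (t \<longlongrightarrow> 0) (finite_subsets_at_top UNIV) \<and>
        (\<forall>\<^sub>F F in finite_subsets_at_top UNIV. N i (\<lambda>x. (\<Sum>\<gamma>\<in>F. T f \<gamma> * hermite_fun \<gamma> x) - f x) \<le> ereal (t F))"
        by (intro exI[of _ "\<lambda>F. L * rho_tail F"] conjI tendsto_mult_right_zero[OF rho_tail_tendsto] eventually_finite_subsets_at_top_weakI L)
    qed (use sumX in simp)
    fix p assume p: "cont_seminorm (proj_top X I N) p"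
    have Nh: "N i (\<lambda>x. a * g x) \<le> ereal (cmod a * K)" if "i \<in> I" "g \<in> X" "K \<ge> 0" "N i g \<le> ereal K" for i g a K
    proof -
      obtain k h' where i: "i = (k, h')" "k > 0" "h' > 0" using \<open>i \<in> I\<close> unfolding I_def by auto
      show ?thesis using that(4) unfolding i(1) NI[OF i(2,3) that(2)] NI[OF i(2,3) lin_space_scale[OF X that(2)]]
        by (rule gs_le_scale)
    qed
    obtain D F where D: "D \<ge> 0" "finite F" "F \<subseteq> I" "\<And>g K. g \<in> X \<Longrightarrow> K \<ge> 0 \<Longrightarrow> (\<forall>i\<in>F. N i g \<le> ereal K) \<Longrightarrow> p g \<le> D * K"
      using cont_seminorm_proj_bound[OF p X Nh] by blast
    have "\<forall>i\<in>F. \<exists>L\<ge>0. \<forall>\<gamma>. N i (\<lambda>x. T f \<gamma> * hermite_fun \<gamma> x) \<le> ereal (L * rho \<gamma>)" using ex D(3) by blast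
    then obtain L where L: "\<And>i. i \<in> F \<Longrightarrow> L i \<ge> 0" "\<And>i \<gamma>. i \<in> F \<Longrightarrow> N i (\<lambda>x. T f \<gamma> * hermite_fun \<gamma> x) \<le> ereal (L i * rho \<gamma>)"
      by metis
    \<comment> \<open>The seminorm is controlled by finitely many norms, each with its own constant
      \<open>L i\<close>; their sum is a common constant.\<close>
    have "p (\<lambda>x. T f \<gamma> * hermite_fun \<gamma> x) \<le> (D * sum L F) * rho \<gamma>" for \<gamma>
    proof -
      have "N i (\<lambda>x. T f \<gamma> * hermite_fun \<gamma> x) \<le> ereal (sum L F * rho \<gamma>)" if i: "i \<in> F" for i
      proof -
        have "L i \<le> sum L F" using i D(2) L(1) by (intro member_le_sum) auto
        then have "ereal (L i * rho \<gamma>) \<le> ereal (sum L F * rho \<gamma>)" using rho_nonneg[of \<gamma>] by (simp add: mult_right_mono)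
        then show ?thesis using L(2)[OF i] order.trans by blast
      qed
      then have "p (\<lambda>x. T f \<gamma> * hermite_fun \<gamma> x) \<le> D * (sum L F * rho \<gamma>)"
        by (intro D(4) lin_space_scale[OF X HX] ballI) (auto intro!: mult_nonneg_nonneg sum_nonneg L rho_nonneg)
      then show ?thesis by (simp only: mult.assoc)
    qed
    then show "(\<lambda>\<gamma>. cmod (T f \<gamma>) * p (hermite_fun \<gamma>)) summable_on UNIV"
      by (rule summable_seminorm_terms[OF p, unfolded topX, OF X HX])
  qed
qed

theorem theorem5p1:
  fixes M :: "real \<Rightarrow> ('n::finite \<Rightarrow> nat) \<Rightarrow> real"
  assumes "weight_matrix M"
  shows "(condR1 M \<and> condR2 M \<longrightarrow>
            abs_schauder_basis (S_Roumieu_top M) hermite_fun \<and>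
            top_lin_iso (S_Roumieu_top M) (Lam_Roumieu_top M) (\<lambda>f \<gamma>. hermite_coeff \<gamma> f)) \<and>
         (condB1 M \<and> condB2 M \<longrightarrow>
            abs_schauder_basis (S_Beurling_top M) hermite_fun \<and>
            top_lin_iso (S_Beurling_top M) (Lam_Beurling_top M) (\<lambda>f \<gamma>. hermite_coeff \<gamma> f))"
  using Roumieu_case[OF assms] Beurling_case[OF assms] by blast

end
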